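(* Let $A$ and $M$ be two vector spaces. Let $\mathfrak g,\mathfrak h,\mathfrak a$ and $p$ be as in the context. Then there is an $L_\infty$-algebra structure on the graded vector space $s^{-1}\mathfrak h\oplus\mathfrak a$ with structure maps $\{l_k\}_{k\ge1}$ given by $$l_2\big((s^{-1}f,0),(s^{-1}g,0)\big)=\big((-1)^{|f|}s^{-1}[f,g]_{\mathsf{MM}},0\big),$$ $$l_k\big((s^{-1}f,0),(0,h_1),\dots,(0,h_{k-1})\big)=\big(0,\,p[\cdots[[f,h_1]_{\mathsf{MM}},h_2]_{\mathsf{MM}},\dots,h_{k-1}]_{\mathsf{MM}}\big),\quad k\ge2,$$ for homogeneous $f,g\in\mathfrak h$ and homogeneous $h_1,\dots,h_{k-1}\in\mathfrak a$, where the values of $l_2$ on permutations of $(s^{-1}f,0),(s^{-1}g,0)$ and of $l_k$ ($k\ge2$) on permutations of $(s^{-1}f,0),(0,h_1),\dots,(0,h_{k-1})$ are determined by graded symmetry, and the maps $l_k$ ($k\ge1$) vanish on all other combinations of homogeneous inputs from $s^{-1}\mathfrak h$ and $\mathfrak a$ (in particular $l_1=0$).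
   Context: Everything is over a field $\mathbf k$ of characteristic $0$. Trees. $Y_n$ ($n\ge 1$) is the set of planar binary trees with $n$ trivalent vertices, one root and $n+1$ leaves labelled $0,1,\dots,n$ from left to right. For $m,n\ge1$, $1\le i\le m$: $R_0^{m;i,n}:Y_{m+n-1}\to Y_m$ deletes the leaves labelled $i,\dots,i+n-2$, and $R_i^{m;i,n}:Y_{m+n-1}\to Y_n$ deletes the leaves labelled $0,\dots,i-2$ and $i+n,\dots,m+n-1$ (labels refer to the original tree; resulting bivalent vertices are removed). Majumdar-Mukherjee bracket. For a vector space $D$ put $CY^n(D,D)=\mathrm{Hom}(\mathbf k[Y_n]\otimes D^{\otimes n},D)$. For $f\in CY^m(D,D)$, $g\in CY^n(D,D)$, $m,n\geq 1$, $$(f\circ_i g)(y;a_1,\dots,a_{m+n-1})=f\big(R_0^{m;i,n}(y);a_1,\dots,a_{i-1},g(R_i^{m;i,n}(y);a_i,\dots,a_{i+n-1}),a_{i+n},\dots,a_{m+n-1}\big),$$ $$[f,g]_{\mathsf{MM}}=\sum_{i=1}^m(-1)^{(i-1)(n-1)}f\circ_i g-(-1)^{(m-1)(n-1)}\sum_{i=1}^n(-1)^{(i-1)(m-1)}g\circ_i f .$$ $\big(\oplus_{n\ge0}CY^{n+1}(D,D),[\ ,\ ]_{\mathsf{MM}}\big)$ is a graded Lie algebra with $CY^{n+1}(D,D)$ in degree $n$. Let $\mathfrak g=\oplus_{n\ge0}CY^{n+1}(A\oplus M,A\oplus M)$ be this graded Lie algebra for $D=A\oplus M$. Let $\mathcal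 A^{k,l}\subset(A\oplus M)^{\otimes(k+l)}$ be the direct sum of all tensor products of $k$ copies of $A$ and $l$ copies of $M$, in any order. An element $f\in CY^{n+1}(A\oplus M,A\oplus M)$ has bidegree $k|l$, $k+l=n$, if $f(\mathbf k[Y_{n+1}]\otimes\mathcal A^{k+1,l})\subset A$, $f(\mathbf k[Y_{n+1}]\otimes\mathcal A^{k,l+1})\subset M$ and $f=0$ on all other summands; $CY^{k|l}(A\oplus M, A\oplus M)$ is the space of these. Put $\mathfrak h=\oplus_{n\ge0}\mathfrak h_n$, $\mathfrak h_n=CY^{n|0}(A\oplus M,A\oplus M)$ (so $|f|=n$ for $f\in\mathfrak h_n$), and $\mathfrak a=\oplus_{n\ge0}\mathfrak a_n$, $\mathfrak a_n=CY^{-1|n+1}(A\oplus M,A\oplus M)\cong\mathrm{Hom}(\mathbf k[Y_{n+1}]\otimes M^{\otimes n+1},A)$. $p:\mathfrak g\to\mathfrak g$ is the projection onto $\mathfrak a$ (taking the component with all inputs in $M$ and output in $A$). $s^{-1}\mathfrak h$ is the shift with $(s^{-1}\mathfrak h)_k=\mathfrak h_{k+1}$. $L_\infty$-algebra: a graded vector space $L$ with degree $1$ graded symmetric maps $l_k:L^{\otimes k}\to L$, $k\ge1$, such that for all $n\ge1$ and homogeneous $x_1,\dots,x_n$, $\sum_{i+j=n+1}\sum_{\sigma\in\mathbb S_{(i,n-i)}}\epsilon(\sigma)\,l_j(l_i(x_{\sigma(1)},\dots,x_{\sigma(i)}),x_{\sigma(i+1)},\dots,x_{\sigma(n)})=0$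 ($(i,n-i)$-shuffles, Koszul sign $\epsilon(\sigma)$). *)

theory Defs
  imports
    "HOL-Analysis.Product_Vector"
    "HOL-Library.Function_Algebras"
    "HOL-Library.Tree"
    "HOL-Combinatorics.Permutations"
begin

text \<open>
  Vector spaces are given by a type together with a scalar multiplication satisfying the library
  locale \<open>vector_space\<close>.  Function types and product types carry the pointwise additive structure.
  Sequences of vectors are lists, so the paper's \<open>a\<^sub>i\<close> is the list entry with index \<open>i - 1\<close>.
\<close>

definition multilinear_on ::
    "('k::field \<Rightarrow> 'v::ab_group_add \<Rightarrow> 'v) \<Rightarrow> 'v set \<Rightarrow> ('k \<Rightarrow> 'w::ab_group_add \<Rightarrow> 'w) \<Rightarrow>
      nat \<Rightarrow> ('v list \<Rightarrow> 'w) \<Rightarrow> bool" where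
  "multilinear_on s V t k F \<longleftrightarrow>
    (\<forall>xs i. length xs = k \<and> set xs \<subseteq> V \<and> i < k \<longrightarrow>
      (\<forall>x\<in>V. \<forall>y\<in>V. F (xs[i := x + y]) = F (xs[i := x]) + F (xs[i := y])) \<and>
      (\<forall>c. \<forall>x\<in>V. F (xs[i := s c x]) = t c (F (xs[i := x]))))"


section \<open>L-infinity algebras\<close>

text \<open>
  A graded vector space is an internal direct sum: a family \<open>V\<close> of independent subspaces of an
  ambient vector space, indexed by the integers.  The ambient space itself may be larger than the
  sum, which is \<open>total_space s V\<close>.
\<close>

definition graded_vector_space ::
    "('k::field \<Rightarrow> 'v::ab_group_add \<Rightarrow> 'v) \<Rightarrow> (int \<Rightarrow> 'v set) \<Rightarrow> bool" where
  "graded_vector_space s V \<longleftrightarrow>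
    vector_space s \<and>
    (\<forall>i. module.subspace s (V i)) \<and>
    (\<forall>I x. finite I \<and> (\<forall>i\<in>I. x i \<in> V i) \<and> (\<Sum>i\<in>I. x i) = 0 \<longrightarrow> (\<forall>i\<in>I. x i = 0))"

definition total_space ::
    "('k::field \<Rightarrow> 'v::ab_group_add \<Rightarrow> 'v) \<Rightarrow> (int \<Rightarrow> 'v set) \<Rightarrow> 'v set" where
  "total_space s V = module.span s (\<Union>i. V i)"

text \<open>\<open>homogeneous_list V ds xs\<close>: the entries of \<open>xs\<close> are homogeneous, with degrees listed in \<open>ds\<close>.\<close>

definition homogeneous_list :: "(int \<Rightarrow> 'v set) \<Rightarrow> int list \<Rightarrow> 'v list \<Rightarrow> bool" where
  "homogeneous_list V ds xs \<longleftrightarrow> list_all2 (\<lambda>d x. x \<in> V d) ds xs"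

definition permute_entries :: "(nat \<Rightarrow> nat) \<Rightarrow> 'v list \<Rightarrow> 'v list" where
  "permute_entries \<sigma> xs = map (\<lambda>i. xs ! \<sigma> i) [0..<length xs]"

text \<open>
  The sign determined by
  \<open>x\<^sub>1 \<cdots> x\<^sub>n = \<epsilon>(\<sigma>) x\<^bsub>\<sigma>(1)\<^esub> \<cdots> x\<^bsub>\<sigma>(n)\<^esub>\<close> in the graded symmetric algebra, the \<open>x\<^sub>i\<close> having degrees \<open>ds\<close>.
\<close>

definition koszul_sign :: "int list \<Rightarrow> (nat \<Rightarrow> nat) \<Rightarrow> 'k::field" where
  "koszul_sign ds \<sigma> =
    (\<Prod>(i, j) \<in> {(i, j). i < j \<and> j < length ds \<and> \<sigma> j < \<sigma> i}. (-1) powi (ds ! \<sigma> i * ds ! \<sigma> j))"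

definition shuffle_perms :: "nat \<Rightarrow> nat \<Rightarrow> (nat \<Rightarrow> nat) set" where
  "shuffle_perms i n =
    {\<sigma>. \<sigma> permutes {..<n} \<and> strict_mono_on {..<i} \<sigma> \<and> strict_mono_on {i..<n} \<sigma>}"

text \<open>\<open>l k xs\<close> is only meaningful for \<open>k \<ge> 1\<close> and lists \<open>xs\<close> of length \<open>k\<close> in the total space.\<close>

definition L_infinity_algebra ::
    "('k::field \<Rightarrow> 'v::ab_group_add \<Rightarrow> 'v) \<Rightarrow> (int \<Rightarrow> 'v set) \<Rightarrow> (nat \<Rightarrow> 'v list \<Rightarrow> 'v) \<Rightarrow> bool" where
  "L_infinity_algebra s V l \<longleftrightarrow>
    graded_vector_space s V \<and>
    (\<forall>k\<ge>1. multilinear_on s (total_space s V) s k (l k)) \<and>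
    (\<forall>k\<ge>1. \<forall>ds xs. length xs = k \<and> homogeneous_list V ds xs \<longrightarrow>
      l k xs \<in> V (sum_list ds + 1)) \<and>
    (\<forall>k\<ge>1. \<forall>ds xs \<sigma>. length xs = k \<and> homogeneous_list V ds xs \<and> \<sigma> permutes {..<k} \<longrightarrow>
      l k (permute_entries \<sigma> xs) = s (koszul_sign ds \<sigma>) (l k xs)) \<and>
    (\<forall>n\<ge>1. \<forall>ds xs. length xs = n \<and> homogeneous_list V ds xs \<longrightarrow>
      (\<Sum>i = 1..n. \<Sum>\<sigma>\<in>shuffle_perms i n.
        s (koszul_sign ds \<sigma>)
          (l (n + 1 - i) (l i (take i (permute_entries \<sigma> xs)) # drop i (permute_entries \<sigma> xs)))) = 0)"


section \<open>Planar binary trees\<close>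

text \<open>The inner nodes of a \<open>unit tree\<close> are the trivalent vertices, its \<open>Leaf\<close>s the leaves.\<close>

definition Y :: "nat \<Rightarrow> unit tree set" where
  "Y n = {y. size y = n}"

text \<open>
  \<open>delete_leaves S j y\<close> deletes the leaves with label in \<open>S\<close>, where the leaves of \<open>y\<close> are labelled
  \<open>j, j + 1, \<dots>\<close> from left to right; \<open>None\<close> means that nothing is left.
\<close>

primrec delete_leaves :: "nat set \<Rightarrow> nat \<Rightarrow> unit tree \<Rightarrow> unit tree option" where
  "delete_leaves S j Leaf = (if j \<in> S then None else Some Leaf)"
| "delete_leaves S j (Node l u r) =
    (case (delete_leaves S j l, delete_leaves S (j + size1 l) r) of
      (None, r') \<Rightarrow> r'
    | (Some l', None) \<Rightarrow> Some l'
    | (Some l', Some r') \<Rightarrow> Some (Node l' u r'))"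

definition R_outer :: "nat \<Rightarrow> nat \<Rightarrow> nat \<Rightarrow> unit tree \<Rightarrow> unit tree" where
  \<comment> \<open>\<open>R\<^sub>0\<close> with superscript \<open>m;i,n\<close>; the set is \<open>{i, \<dots>, i + n - 2}\<close>\<close>
  "R_outer m i n y = the (delete_leaves {i..<i + n - 1} 0 y)"

definition R_inner :: "nat \<Rightarrow> nat \<Rightarrow> nat \<Rightarrow> unit tree \<Rightarrow> unit tree" where
  \<comment> \<open>\<open>R\<^sub>i\<close> with superscript \<open>m;i,n\<close>; the first set is \<open>{0, \<dots>, i - 2}\<close>\<close>
  "R_inner m i n y = the (delete_leaves ({0..<i - 1} \<union> {i + n..m + n - 1}) 0 y)"


section \<open>The Majumdar-Mukherjee bracket\<close>

text \<open>
  A linear map from \<open>k[Y\<^sub>n] \<otimes> D\<^sup>\<otimes>\<^sup>n\<close> to \<open>D\<close> is a family, indexed by \<open>Y\<^sub>n\<close>, of \<open>n\<close>-linear maps.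
  It is extended by zero to all trees and lists, so that the spaces \<open>CY s n\<close> for different \<open>n\<close> are
  independent subspaces of one function space and sums of cochains of different arity make sense.
\<close>

type_synonym 'd cochain = "unit tree \<Rightarrow> 'd list \<Rightarrow> 'd"

definition cochain_scale :: "('k \<Rightarrow> 'd \<Rightarrow> 'd) \<Rightarrow> 'k \<Rightarrow> 'd cochain \<Rightarrow> 'd cochain" where
  "cochain_scale s c f = (\<lambda>y as. s c (f y as))"

definition CY :: "('k::field \<Rightarrow> 'd::ab_group_add \<Rightarrow> 'd) \<Rightarrow> nat \<Rightarrow> 'd cochain set" where
  "CY s n = {f. (\<forall>y\<in>Y n. multilinear_on s UNIV s n (f y)) \<and>
                (\<forall>y as. y \<notin> Y n \<or> length as \<noteq> n \<longrightarrow> f y as = 0)}"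

definition MM_circ ::
    "nat \<Rightarrow> nat \<Rightarrow> nat \<Rightarrow> 'd::ab_group_add cochain \<Rightarrow> 'd cochain \<Rightarrow> 'd cochain" where
  "MM_circ m n i f g = (\<lambda>y as.
    if y \<in> Y (m + n - 1) \<and> length as = m + n - 1
    then f (R_outer m i n y)
           (take (i - 1) as @ [g (R_inner m i n y) (take n (drop (i - 1) as))] @ drop (i + n - 1) as)
    else 0)"

text \<open>The bracket of the arity \<open>m\<close> component of \<open>f\<close> with the arity \<open>n\<close> component of \<open>g\<close>.\<close>

definition MM_bracket_hom ::
    "('k::field \<Rightarrow> 'd::ab_group_add \<Rightarrow> 'd) \<Rightarrow> nat \<Rightarrow> nat \<Rightarrow> 'd cochain \<Rightarrow> 'd cochain \<Rightarrow> 'd cochain" where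
  "MM_bracket_hom s m n f g =
    (\<Sum>i = 1..m. cochain_scale s ((-1) ^ ((i - 1) * (n - 1))) (MM_circ m n i f g)) -
    cochain_scale s ((-1) ^ ((m - 1) * (n - 1)))
      (\<Sum>i = 1..n. cochain_scale s ((-1) ^ ((i - 1) * (m - 1))) (MM_circ n m i g f))"

text \<open>
  The biadditive extension to all cochains: a list of length \<open>N\<close> is only seen by the brackets of
  components of arities \<open>m, n \<ge> 1\<close> with \<open>m + n - 1 = N\<close>.
\<close>

definition MM_bracket ::
    "('k::field \<Rightarrow> 'd::ab_group_add \<Rightarrow> 'd) \<Rightarrow> 'd cochain \<Rightarrow> 'd cochain \<Rightarrow> 'd cochain" where
  "MM_bracket s f g =
    (\<lambda>y as. \<Sum>m = 1..length as. MM_bracket_hom s m (length as + 1 - m) f g y as)"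


section \<open>The direct sum of two vector spaces\<close>

text \<open>
  The direct sum of \<open>A\<close> and \<open>M\<close> is the product type, with scalar multiplication
  \<open>module_prod.scale sA sM\<close>; \<open>A\<close> is the set of pairs with \<open>snd x = 0\<close>, \<open>M\<close> that with \<open>fst x = 0\<close>.
  In \<open>CY_bideg\<close>, \<open>S\<close> is the set of positions of the tensor factors \<open>A\<close>.  For lists of length
  \<open>k + l + 1\<close>, the summands of \<open>\<A>\<^bsup>k+1,l\<^esup>\<close> are those with \<open>card S = k + 1\<close>, and the summands of
  \<open>\<A>\<^bsup>k,l+1\<^esup>\<close> those with \<open>card S = k\<close>.
\<close>

definition CY_bideg ::
    "('k::field \<Rightarrow> 'a::ab_group_add \<Rightarrow> 'a) \<Rightarrow> ('k \<Rightarrow> 'm::ab_group_add \<Rightarrow> 'm) \<Rightarrow>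
      int \<Rightarrow> int \<Rightarrow> ('a \<times> 'm) cochain set" where
  "CY_bideg sA sM k l =
    {f \<in> CY (module_prod.scale sA sM) (nat (k + l + 1)).
      \<forall>y as S. y \<in> Y (nat (k + l + 1)) \<and> length as = nat (k + l + 1) \<and> S \<subseteq> {..<length as} \<and>
        (\<forall>i\<in>S. snd (as ! i) = 0) \<and> (\<forall>i\<in>{..<length as} - S. fst (as ! i) = 0) \<longrightarrow>
        (if int (card S) = k + 1 then snd (f y as) = 0
         else if int (card S) = k then fst (f y as) = 0
         else f y as = 0)}"

definition h_deg ::
    "('k::field \<Rightarrow> 'a::ab_group_add \<Rightarrow> 'a) \<Rightarrow> ('k \<Rightarrow> 'm::ab_group_add \<Rightarrow> 'm) \<Rightarrow>
      nat \<Rightarrow> ('a \<times> 'm) cochain set" where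
  "h_deg sA sM n = CY_bideg sA sM (int n) 0"

definition a_deg ::
    "('k::field \<Rightarrow> 'a::ab_group_add \<Rightarrow> 'a) \<Rightarrow> ('k \<Rightarrow> 'm::ab_group_add \<Rightarrow> 'm) \<Rightarrow>
      nat \<Rightarrow> ('a \<times> 'm) cochain set" where
  "a_deg sA sM n = CY_bideg sA sM (-1) (int n + 1)"

definition proj_a :: "('a::zero \<times> 'm::zero) cochain \<Rightarrow> ('a \<times> 'm) cochain" where
  "proj_a f = (\<lambda>y as. (fst (f y (map (\<lambda>x. (0, snd x)) as)), 0))"

definition int_graded :: "(nat \<Rightarrow> 'v::zero set) \<Rightarrow> int \<Rightarrow> 'v set" where
  "int_graded V k = (if k \<ge> 0 then V (nat k) else {0})"

text \<open>
  The direct sum of the desuspension of \<open>h\<close> and of \<open>a\<close>: the element \<open>s\<^sup>-\<^sup>1 f\<close> is represented by \<open>f\<close>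
  itself, the shift being visible only in the grading.
\<close>

definition sh_plus_a ::
    "('k::field \<Rightarrow> 'a::ab_group_add \<Rightarrow> 'a) \<Rightarrow> ('k \<Rightarrow> 'm::ab_group_add \<Rightarrow> 'm) \<Rightarrow>
      int \<Rightarrow> (('a \<times> 'm) cochain \<times> ('a \<times> 'm) cochain) set" where
  "sh_plus_a sA sM k = int_graded (h_deg sA sM) (k + 1) \<times> int_graded (a_deg sA sM) k"

definition sh_plus_a_scale ::
    "('k::field \<Rightarrow> 'a::ab_group_add \<Rightarrow> 'a) \<Rightarrow> ('k \<Rightarrow> 'm::ab_group_add \<Rightarrow> 'm) \<Rightarrow>
      'k \<Rightarrow> ('a \<times> 'm) cochain \<times> ('a \<times> 'm) cochain \<Rightarrow> ('a \<times> 'm) cochain \<times> ('a \<times> 'm) cochain" where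
  "sh_plus_a_scale sA sM =
    module_prod.scale (cochain_scale (module_prod.scale sA sM)) (cochain_scale (module_prod.scale sA sM))"

end

theory Submission
  imports Defs
begin

text \<open>
  The Majumdar-Mukherjee bracket is the commutator of a graded pre-Lie product: deleting leaves is
  functorial, so the partial compositions satisfy the sequential and parallel axioms of a nonsymmetric
  operad, and the associator is a sum over pairs of distinct slots.  This gives the Jacobi identity.
  The elements of \<open>a\<close> commute with each other, and the kernel of the projection \<open>p\<close> is closed under the
  bracket and contains \<open>h\<close>.  The claimed operations are therefore higher derived brackets in the
  sense of Voronov: the higher Jacobi identity is trivial unless exactly two of its arguments lie in
  \<open>h\<close> (or all of its three arguments do), and for two arguments \<open>f, g\<close> it is the Leibniz rule for
  \<open>[\<dots>[[f, g], h\<^sub>1], \<dots>, h\<^sub>r]\<close> combined with \<open>p [x, y] = p [p x, y] + p [x, p y]\<close>.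
\<close>

section \<open>Signs and unshuffles\<close>

text \<open>Two demands pull in opposite directions. Multilinearity is required on the whole total
  space, whereas Koszul signs are defined through degrees, which only homogeneous elements have.
  Signs are therefore produced by operators that are linear everywhere: the parity projections
  \<open>ev\<close>, \<open>od\<close> and the grading involution \<open>tau\<close>. On homogeneous
  arguments they reduce to \<open>sg\<close>, a sign that uses only negation and so works alike for
  vectors, cochains and pairs. For the Jacobi identities, the sum over shuffle permutations is
  traded for the recursive \<open>unshuffle_sum\<close>, which admits induction on the list of
  arguments; graded symmetry and additivity then allow the arguments to be split into their two
  components and those from \<open>h\<close> to be moved to the front. A direct check that
  \<open>h\<close> is closed under the bracket would have to follow the factors from
  \<open>M\<close> through every composition; instead \<open>h\<close> is recognised as a family of
  eigenspaces of a derivation of degree 0, which is where characteristic 0 enters.\<close>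

definition sg :: "int \<Rightarrow> 'a::ab_group_add \<Rightarrow> 'a" where
  "sg n x = (if even n then x else - x)"

lemma sg_sg: "sg a (sg b x) = sg (a + b) x"
  and sg_add: "sg a (x + y) = sg a x + sg a y"
  and sg_zero [simp]: "sg a 0 = 0"
  and sg_0 [simp]: "sg 0 x = x"
  by (auto simp: sg_def)

lemma sg_mult_cancel: "sg (a * b) (sg (b * a) x) = x"
  by (simp add: sg_def)

lemma sg_cong: "even a = even b \<Longrightarrow> sg a x = sg b x"
  by (simp add: sg_def)

lemma sg_Pair: "sg a (x, y) = (sg a x, sg a y)"
  by (simp add: sg_def uminus_prod_def)

lemma sg_sum: "sg a (\<Sum>i\<in>I. f i) = (\<Sum>i\<in>I. sg a (f i))"
  by (simp add: sg_def sum_negf)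

lemma sg_eq_0_iff [simp]: "sg a x = 0 \<longleftrightarrow> x = 0"
  by (simp add: sg_def)

lemma sg_eq_scale:
  assumes "vector_space s"
  shows "sg (int n) x = s ((-1) ^ n) x" and "sg a x = s ((-1) powi a) x"
proof -
  interpret vector_space s by fact
  show "sg (int n) x = s ((-1) ^ n) x"
    by (cases "even n") (simp_all add: sg_def)
  show "sg a x = s ((-1) powi a) x"
    by (cases "even a") (simp_all add: sg_def)
qed

definition deg :: "(int \<times> 'v) list \<Rightarrow> int" where
  "deg xs = sum_list (map fst xs)"

lemma deg_simps [simp]: "deg [] = 0" "deg (x # xs) = fst x + deg xs" "deg (xs @ ys) = deg xs + deg ys"
  by (simp_all add: deg_def)

text \<open>The sum over all ways to distribute the entries of a list to two lists, preserving the order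
  within both, with the Koszul sign of the resulting unshuffle.\<close>

primrec unshuffle_sum ::
    "(int \<times> 'v) list \<Rightarrow> ((int \<times> 'v) list \<Rightarrow> (int \<times> 'v) list \<Rightarrow> 'w::ab_group_add) \<Rightarrow> 'w" where
  "unshuffle_sum [] = (\<lambda>F. F [] [])"
| "unshuffle_sum (x # xs) = (\<lambda>F. unshuffle_sum xs (\<lambda>S T. F (x # S) T) +
     unshuffle_sum xs (\<lambda>S T. sg (fst x * deg S) (F S (x # T))))"

text \<open>The multiset equation records that \<open>S\<close> and \<open>T\<close> together hold
  the entries of \<open>xs\<close>; later arguments need no more than this, for instance to pass
  degree conditions on to both halves.\<close>

lemma unshuffle_sum_cong:
  assumes "\<And>S T. mset S + mset T = mset xs \<Longrightarrow> F S T = F' S T"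
  shows "unshuffle_sum xs F = unshuffle_sum xs F'"
  using assms
proof (induction xs arbitrary: F F')
  case (Cons x xs)
  have "unshuffle_sum xs (\<lambda>S T. F (x # S) T) = unshuffle_sum xs (\<lambda>S T. F' (x # S) T)"
    by (rule Cons.IH) (rule Cons.prems, simp)
  moreover have "unshuffle_sum xs (\<lambda>S T. sg (fst x * deg S) (F S (x # T))) =
      unshuffle_sum xs (\<lambda>S T. sg (fst x * deg S) (F' S (x # T)))"
    by (rule Cons.IH) (simp add: Cons.prems)
  ultimately show ?case by simp
qed simp

lemma unshuffle_sum_add:
  "unshuffle_sum xs (\<lambda>S T. F S T + F' S T) = unshuffle_sum xs F + unshuffle_sum xs F'"
  by (induction xs arbitrary: F F') (simp_all add: sg_add algebra_simps)

lemma unshuffle_sum_0 [simp]: "unshuffle_sum xs (\<lambda>S T. 0) = 0"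
  by (induction xs) simp_all

lemma unshuffle_sum_eq_0:
  "(\<And>S T. mset S + mset T = mset xs \<Longrightarrow> F S T = 0) \<Longrightarrow> unshuffle_sum xs F = 0"
  using unshuffle_sum_cong[of xs F "\<lambda>S T. 0"] by simp

lemma unshuffle_sum_sg: "unshuffle_sum xs (\<lambda>S T. sg a (F S T)) = sg a (unshuffle_sum xs F)"
proof (induction xs arbitrary: F)
  case (Cons x xs)
  have "unshuffle_sum xs (\<lambda>S T. sg (fst x * deg S) (sg a (F S (x # T)))) =
      unshuffle_sum xs (\<lambda>S T. sg a (sg (fst x * deg S) (F S (x # T))))"
    by (rule unshuffle_sum_cong) (simp add: sg_sg add.commute)
  thus ?case by (simp add: Cons.IH sg_add)
qed simp

text \<open>Additivity of \<phi> is available only on the subgroup \<open>C\<close>, because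
  brackets and projections behave well only on cochains inside a larger space of functions; so
  membership of the sum in \<open>C\<close> is carried through the induction.\<close>

lemma unshuffle_sum_hom:
  assumes "\<And>S T. mset S + mset T = mset xs \<Longrightarrow> F S T \<in> C"
    and C: "0 \<in> C" "\<And>x y. x \<in> C \<Longrightarrow> y \<in> C \<Longrightarrow> x + y \<in> C" "\<And>x. x \<in> C \<Longrightarrow> - x \<in> C"
    and \<phi>: "\<And>x y. x \<in> C \<Longrightarrow> y \<in> C \<Longrightarrow> \<phi> (x + y) = \<phi> x + \<phi> y"
  shows "unshuffle_sum xs F \<in> C" and "\<phi> (unshuffle_sum xs F) = unshuffle_sum xs (\<lambda>S T. \<phi> (F S T))"
proof -
  have "\<phi> (0 + 0) = \<phi> 0 + \<phi> 0" by (rule \<phi>) (use C in auto)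
  hence \<phi>0: "\<phi> 0 = 0" by simp
  have \<phi>m: "\<phi> (- x) = - \<phi> x" if "x \<in> C" for x
  proof -
    have "\<phi> (x + - x) = \<phi> x + \<phi> (- x)" by (rule \<phi>) (use C that in auto)
    thus ?thesis by (simp add: \<phi>0 eq_neg_iff_add_eq_0 add.commute)
  qed
  have \<phi>s: "\<phi> (sg a x) = sg a (\<phi> x)" if "x \<in> C" for a x
    using \<phi>m that by (simp add: sg_def)
  have Cs: "sg a x \<in> C" if "x \<in> C" for a x
    using C that by (simp add: sg_def)
  have "unshuffle_sum xs F \<in> C \<and> \<phi> (unshuffle_sum xs F) = unshuffle_sum xs (\<lambda>S T. \<phi> (F S T))"
    using assms(1)
  proof (induction xs arbitrary: F)
    case (Cons x xs)
    have 1: "unshuffle_sum xs (\<lambda>S T. F (x # S) T) \<in> C \<and>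
      \<phi> (unshuffle_sum xs (\<lambda>S T. F (x # S) T)) = unshuffle_sum xs (\<lambda>S T. \<phi> (F (x # S) T))"
      by (rule Cons.IH) (simp add: Cons.prems)
    have 2: "unshuffle_sum xs (\<lambda>S T. sg (fst x * deg S) (F S (x # T))) \<in> C \<and>
      \<phi> (unshuffle_sum xs (\<lambda>S T. sg (fst x * deg S) (F S (x # T)))) =
        unshuffle_sum xs (\<lambda>S T. \<phi> (sg (fst x * deg S) (F S (x # T))))"
      by (rule Cons.IH) (simp add: Cons.prems Cs)
    have 3: "unshuffle_sum xs (\<lambda>S T. \<phi> (sg (fst x * deg S) (F S (x # T)))) =
        unshuffle_sum xs (\<lambda>S T. sg (fst x * deg S) (\<phi> (F S (x # T))))"
      by (rule unshuffle_sum_cong) (simp add: \<phi>s Cons.prems)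
    show ?case using 1 2 3 C \<phi> by simp
  qed simp
  thus "unshuffle_sum xs F \<in> C" "\<phi> (unshuffle_sum xs F) = unshuffle_sum xs (\<lambda>S T. \<phi> (F S T))"
    by blast+
qed

text \<open>Passing to the complementary split moves the block \<open>S\<close> across the block
  \<open>T\<close>, which costs the sign with exponent \<open>deg S * deg T\<close>. In the
  induction the two summands, new entry on the left or on the right, change places.\<close>

lemma unshuffle_sum_exchange:
  "unshuffle_sum xs F = unshuffle_sum xs (\<lambda>S T. sg (deg S * deg T) (F T S))"
proof (induction xs arbitrary: F)
  case (Cons x xs)
  show ?case
    unfolding unshuffle_sum.simps
    by (subst (1 2) Cons.IH, subst add.commute)
       (intro arg_cong2[of _ _ _ _ "(+)"] unshuffle_sum_cong;
         simp add: sg_sg; rule sg_cong; simp; blast)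
qed simp

text \<open>Only one split has an empty left half, and nothing has been moved in it, so its sign is
  1.\<close>

lemma unshuffle_sum_nil_left:
  "unshuffle_sum xs (\<lambda>S T. if S = [] then F T else 0) = F xs"
proof (induction xs arbitrary: F)
  case (Cons x xs)
  have "unshuffle_sum xs (\<lambda>S T. sg (fst x * deg S) (if S = [] then F (x # T) else 0)) = F (x # xs)"
    by (subst Cons.IH[symmetric], rule unshuffle_sum_cong) auto
  thus ?case by simp
qed simp

text \<open>Splits that put \<open>x\<close> and \<open>y\<close> into the same half are handled by
  the hypotheses on \<open>F\<close>. Those that separate them are matched in pairs, one from each
  order of \<open>x\<close> and \<open>y\<close>, and the Koszul sign of the split itself supplies
  the factor.\<close>

lemma unshuffle_sum_swap:
  assumes "\<And>S S' T. mset S + mset S' + mset T = mset P + mset Q \<Longrightarrow>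
      F (S @ x # y # S') T = sg (fst x * fst y) (F (S @ y # x # S') T)"
    and "\<And>S T T'. mset S + mset T + mset T' = mset P + mset Q \<Longrightarrow>
      F S (T @ x # y # T') = sg (fst x * fst y) (F S (T @ y # x # T'))"
  shows "unshuffle_sum (P @ x # y # Q) F = sg (fst x * fst y) (unshuffle_sum (P @ y # x # Q) F)"
  using assms
proof (induction P arbitrary: F)
  case Nil
  have 1: "unshuffle_sum Q (\<lambda>S T. F (x # y # S) T) =
      sg (fst x * fst y) (unshuffle_sum Q (\<lambda>S T. F (y # x # S) T))"
    by (subst unshuffle_sum_sg[symmetric], rule unshuffle_sum_cong) (use Nil(1)[of "[]"] in simp)
  have 2: "unshuffle_sum Q (\<lambda>S T. sg (fst y * deg S) (sg (fst x * deg S) (F S (x # y # T)))) =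
      sg (fst x * fst y) (unshuffle_sum Q (\<lambda>S T. sg (fst x * deg S) (sg (fst y * deg S) (F S (y # x # T)))))"
    by (subst unshuffle_sum_sg[symmetric], rule unshuffle_sum_cong)
       (use Nil(2)[of _ "[]"] in \<open>simp add: sg_sg algebra_simps\<close>)
  have 3: "unshuffle_sum Q (\<lambda>S T. sg (fst a * (fst b + deg S)) (F (b # S) (a # T))) =
      sg (fst a * fst b) (unshuffle_sum Q (\<lambda>S T. sg (fst a * deg S) (F (b # S) (a # T))))" for a b
    by (subst unshuffle_sum_sg[symmetric], rule unshuffle_sum_cong) (simp add: sg_sg algebra_simps)
  show ?case
    by (simp add: 1 2 3 sg_add sg_mult_cancel add.assoc add.left_commute)
next
  case (Cons z P)
  have 1: "unshuffle_sum (P @ x # y # Q) (\<lambda>S T. F (z # S) T) =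
      sg (fst x * fst y) (unshuffle_sum (P @ y # x # Q) (\<lambda>S T. F (z # S) T))"
    using Cons.prems(1)[of "z # _"] Cons.prems(2)[of "z # _"] by (intro Cons.IH) simp_all
  have 2: "unshuffle_sum (P @ x # y # Q) (\<lambda>S T. sg (fst z * deg S) (F S (z # T))) =
      sg (fst x * fst y) (unshuffle_sum (P @ y # x # Q) (\<lambda>S T. sg (fst z * deg S) (F S (z # T))))"
    using Cons.prems(1)[of _ _ "z # _"] Cons.prems(2)[of _ "z # _"]
    by (intro Cons.IH) (simp_all add: sg_sg algebra_simps)
  show ?case by (simp add: 1 2 sg_add)
qed

text \<open>The two summands and their sum carry the same degree \<open>d\<close>, so the signs of
  the splits agree in all three expressions.\<close>

lemma unshuffle_sum_slot_add:
  assumes "\<And>S S' T. mset S + mset S' + mset T = mset P + mset Q \<Longrightarrow>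
      F (S @ (d, x + y) # S') T = F (S @ (d, x) # S') T + F (S @ (d, y) # S') T"
    and "\<And>S T T'. mset S + mset T + mset T' = mset P + mset Q \<Longrightarrow>
      F S (T @ (d, x + y) # T') = F S (T @ (d, x) # T') + F S (T @ (d, y) # T')"
  shows "unshuffle_sum (P @ (d, x + y) # Q) F =
    unshuffle_sum (P @ (d, x) # Q) F + unshuffle_sum (P @ (d, y) # Q) F"
  using assms
proof (induction P arbitrary: F)
  case Nil
  have 1: "unshuffle_sum Q (\<lambda>S T. F ((d, x + y) # S) T) =
      unshuffle_sum Q (\<lambda>S T. F ((d, x) # S) T) + unshuffle_sum Q (\<lambda>S T. F ((d, y) # S) T)"
    by (subst unshuffle_sum_add[symmetric], rule unshuffle_sum_cong) (use Nil(1)[of "[]"] in simp)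
  have 2: "unshuffle_sum Q (\<lambda>S T. sg (d * deg S) (F S ((d, x + y) # T))) =
      unshuffle_sum Q (\<lambda>S T. sg (d * deg S) (F S ((d, x) # T))) +
      unshuffle_sum Q (\<lambda>S T. sg (d * deg S) (F S ((d, y) # T)))"
    by (subst unshuffle_sum_add[symmetric], rule unshuffle_sum_cong)
       (use Nil(2)[of _ "[]"] in \<open>simp add: sg_add\<close>)
  show ?case by (simp add: 1 2)
next
  case (Cons z P)
  have 1: "unshuffle_sum (P @ (d, x + y) # Q) (\<lambda>S T. F (z # S) T) =
      unshuffle_sum (P @ (d, x) # Q) (\<lambda>S T. F (z # S) T) + unshuffle_sum (P @ (d, y) # Q) (\<lambda>S T. F (z # S) T)"
    using Cons.prems(1)[of "z # _"] Cons.prems(2)[of "z # _"] by (intro Cons.IH) simp_all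
  have 2: "unshuffle_sum (P @ (d, x + y) # Q) (\<lambda>S T. sg (fst z * deg S) (F S (z # T))) =
      unshuffle_sum (P @ (d, x) # Q) (\<lambda>S T. sg (fst z * deg S) (F S (z # T))) +
      unshuffle_sum (P @ (d, y) # Q) (\<lambda>S T. sg (fst z * deg S) (F S (z # T)))"
    using Cons.prems(1)[of _ _ "z # _"] Cons.prems(2)[of _ "z # _"]
    by (intro Cons.IH) (simp_all add: sg_add)
  show ?case by (simp add: 1 2)
qed

text \<open>Adjacent transpositions generate all permutations: each entry of the target list is
  carried leftwards to its place, behind a prefix that is already correct.\<close>

lemma swap_closed_mset:
  assumes swap: "\<And>P x y Q. Z (P @ x # y # Q) \<Longrightarrow> Z (P @ y # x # Q)"
    and "mset xs = mset ys" and "Z xs"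
  shows "Z ys"
proof -
  have move: "Z (P @ R @ x # Q) \<Longrightarrow> Z (P @ x # R @ Q)" for P R x Q
  proof (induction R arbitrary: Q rule: rev_induct)
    case (snoc r R)
    thus ?case using swap[of "P @ R" r x Q] by simp
  qed simp
  have "Z (P @ xs) \<Longrightarrow> Z (P @ ys)" for P
    using assms(2)
  proof (induction ys arbitrary: P xs)
    case (Cons y ys)
    from Cons.prems(2) have "y \<in> set xs" by (metis list.set_intros(1) mset_eq_setD)
    then obtain R Q where xs: "xs = R @ y # Q" by (meson split_list)
    have "Z ((P @ [y]) @ (R @ Q))" using Cons.prems(1) move xs by simp
    moreover have "mset (R @ Q) = mset ys" using Cons.prems(2) xs by simp
    ultimately show ?case using Cons.IH[of "P @ [y]" "R @ Q"] by simp
  qed simp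
  from this[of "[]"] show ?thesis using assms(3) by simp
qed

section \<open>Koszul signs\<close>

text \<open>The exponent of the Koszul sign that sorting the word \<open>w\<close> costs when the
  letter \<open>a\<close> has degree \<open>d a\<close>.\<close>

primrec inversion_sum :: "(nat \<Rightarrow> int) \<Rightarrow> nat list \<Rightarrow> int" where
  "inversion_sum d [] = 0"
| "inversion_sum d (a # w) = (\<Sum>b\<leftarrow>w. if b < a then d a * d b else 0) + inversion_sum d w"

lemma inversion_sum_map_upt:
  assumes "i \<le> n"
  shows "inversion_sum d (map \<sigma> [i..<n]) =
    (\<Sum>(i, j)\<in>{(i', j). i \<le> i' \<and> i' < j \<and> j < n \<and> \<sigma> j < \<sigma> i'}. d (\<sigma> i) * d (\<sigma> j))"
  using assms
proof (induction i rule: inc_induct)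
  case base
  have empty: "{(i', j). n \<le> i' \<and> i' < j \<and> j < n \<and> \<sigma> j < \<sigma> i'} = {}" by auto
  show ?case unfolding empty by simp
next
  case (step i)
  let ?B = "\<lambda>i. {(i', j). i \<le> i' \<and> i' < j \<and> j < n \<and> \<sigma> j < \<sigma> i'}"
  have fin: "finite (?B k)" for k
    by (rule finite_subset[of _ "{..<n} \<times> {..<n}"]) auto
  \<comment> \<open>Inversions are grouped by their left position: it is \<open>i\<close>, or it is
    a later one.\<close>
  have eq: "?B i = Pair i ` {j \<in> {Suc i..<n}. \<sigma> j < \<sigma> i} \<union> ?B (Suc i)"
  proof (rule set_eqI)
    fix z show "z \<in> ?B i \<longleftrightarrow> z \<in> Pair i ` {j \<in> {Suc i..<n}. \<sigma> j < \<sigma> i} \<union> ?B (Suc i)"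
      by (cases z, cases "fst z = i") (auto simp: image_iff)
  qed
  have "(\<Sum>b\<leftarrow>map \<sigma> [Suc i..<n]. if b < \<sigma> i then d (\<sigma> i) * d b else 0) =
      (\<Sum>j\<in>{Suc i..<n}. if \<sigma> j < \<sigma> i then d (\<sigma> i) * d (\<sigma> j) else 0)"
    by (simp add: comp_def sum_list_distinct_conv_sum_set)
  also have "\<dots> = (\<Sum>j\<in>{j \<in> {Suc i..<n}. \<sigma> j < \<sigma> i}. d (\<sigma> i) * d (\<sigma> j))"
    by (rule sum.inter_filter[symmetric]) simp
  also have "\<dots> = (\<Sum>(i, j)\<in>Pair i ` {j \<in> {Suc i..<n}. \<sigma> j < \<sigma> i}. d (\<sigma> i) * d (\<sigma> j))"
    by (subst sum.reindex) (auto simp: inj_on_def)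
  finally have *: "(\<Sum>b\<leftarrow>map \<sigma> [Suc i..<n]. if b < \<sigma> i then d (\<sigma> i) * d b else 0) = \<dots>" .
  show ?case
    unfolding eq
  proof (subst sum.union_disjoint)
    show "Pair i ` {j \<in> {Suc i..<n}. \<sigma> j < \<sigma> i} \<inter> ?B (Suc i) = {}" by auto
    have "inversion_sum d (map \<sigma> [i..<n]) =
      (\<Sum>b\<leftarrow>map \<sigma> [Suc i..<n]. if b < \<sigma> i then d (\<sigma> i) * d b else 0) + inversion_sum d (map \<sigma> [Suc i..<n])"
      using step.hyps by (simp only: upt_conv_Cons list.map inversion_sum.simps)
    thus "inversion_sum d (map \<sigma> [i..<n]) =
      (\<Sum>(i, j)\<in>Pair i ` {j \<in> {Suc i..<n}. \<sigma> j < \<sigma> i}. d (\<sigma> i) * d (\<sigma> j)) +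
      (\<Sum>(i, j)\<in>?B (Suc i). d (\<sigma> i) * d (\<sigma> j))"
      by (simp only: * step.IH)
  qed (use fin in auto)
qed

lemma koszul_sign_scale:
  fixes s :: "'k::field \<Rightarrow> 'v::ab_group_add \<Rightarrow> 'v"
  assumes "vector_space s" and "length ds = n"
  shows "s (koszul_sign ds \<sigma>) x = sg (inversion_sum ((!) ds) (map \<sigma> [0..<n])) x"
proof -
  have "koszul_sign ds \<sigma> = (-1 :: 'k) powi (\<Sum>(i, j)\<in>{(i, j). i < j \<and> j < n \<and> \<sigma> j < \<sigma> i}. ds ! \<sigma> i * ds ! \<sigma> j)"
  proof -
    have fin: "finite {(i, j). i < j \<and> j < n \<and> \<sigma> j < \<sigma> i}" (is "finite ?B")
      by (rule finite_subset[of _ "{..<n} \<times> {..<n}"]) auto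
    have "(-1 :: 'k) powi (sum f B) = (\<Prod>z\<in>B. (-1) powi f z)" if "finite B" for f and B :: "(nat \<times> nat) set"
      using that by (induction B) (simp_all add: power_int_add)
    from this[OF fin] show ?thesis
      unfolding koszul_sign_def assms(2) by (simp add: case_prod_beta)
  qed
  also have "\<dots> = (-1) powi (inversion_sum ((!) ds) (map \<sigma> [0..<n]))"
    by (subst inversion_sum_map_upt) simp_all
  finally show ?thesis by (simp add: sg_eq_scale(2)[OF assms(1)])
qed

text \<open>Insertion sort: moving a letter past a smaller one is one application of the swap rule
  and adds the product of the two degrees, so the total cost is the inversion sum.\<close>

lemma swap_sorted:
  assumes swap: "\<And>P a b Q. F (P @ a # b # Q) = sg (d a * d b) (F (P @ b # a # Q))"
  shows "F w = sg (inversion_sum d w) (F (sort w))"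
proof -
  have insert: "F (P @ a # w) = sg (\<Sum>b\<leftarrow>w. if b < a then d a * d b else 0) (F (P @ insort a w))"
    if "sorted w" for P a w
    using that
  proof (induction w arbitrary: P)
    case (Cons b w)
    show ?case
    proof (cases "a \<le> b")
      case True
      have "(\<Sum>b\<leftarrow>b # w. if b < a then d a * d b else 0) = (\<Sum>b\<leftarrow>b # w. 0)"
        by (rule arg_cong[of _ _ sum_list], rule map_cong) (use True Cons.prems in auto)
      thus ?thesis using True by simp
    next
      case False
      have "sorted w" using Cons.prems by simp
      from Cons.IH[OF this, of "P @ [b]"] show ?thesis
        unfolding swap[of P a b w] using False by (simp add: sg_sg)
    qed
  qed simp
  have "F (P @ w) = sg (inversion_sum d w) (F (P @ sort w))" for P
  proof (induction w arbitrary: P)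
    case (Cons a w)
    have "F (P @ a # w) = sg (inversion_sum d w) (F (P @ a # sort w))"
      using Cons.IH[of "P @ [a]"] by simp
    also have "F (P @ a # sort w) = sg (\<Sum>b\<leftarrow>sort w. if b < a then d a * d b else 0) (F (P @ sort (a # w)))"
      by (subst insert) simp_all
    \<comment> \<open>The cost of inserting \<open>a\<close> depends only on which letters are
      smaller, not on their order; this is why the tail may be sorted first.\<close>
    also have "(\<Sum>b\<leftarrow>sort w. if b < a then d a * d b else 0) = (\<Sum>b\<leftarrow>w. if b < a then d a * d b else 0)"
      by (simp only: sum_mset_sum_list[symmetric] mset_map mset_sort)
    finally show ?case by (simp add: sg_sg add.commute)
  qed simp
  from this[of "[]"] show ?thesis by simp
qed

lemma inversion_sum_minimal_left: "\<forall>b\<in>set w. a < b \<Longrightarrow> inversion_sum d (a # w) = inversion_sum d w"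
proof -
  assume *: "\<forall>b\<in>set w. a < b"
  have "(\<Sum>b\<leftarrow>w. if b < a then d a * d b else 0) = (\<Sum>b\<leftarrow>w. 0)"
    by (rule arg_cong[of _ _ sum_list], rule map_cong) (use * in auto)
  thus ?thesis by simp
qed

text \<open>Putting the least letter \<open>a\<close> behind the block \<open>v\<close> creates one
  inversion with each letter of \<open>v\<close>; this is the exponent \<open>fst x * deg S\<close>
  in the recursion of \<open>unshuffle_sum\<close>.\<close>

lemma inversion_sum_minimal_middle:
  assumes "\<forall>b\<in>set (v @ w). a < b"
  shows "inversion_sum d (v @ a # w) = d a * (\<Sum>b\<leftarrow>v. d b) + inversion_sum d (v @ w)"
  using assms
proof (induction v)
  case Nil
  thus ?case using inversion_sum_minimal_left[of w a d] by simp
next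
  case (Cons c v)
  thus ?case by (simp add: algebra_simps)
qed

lemma sum_Pow_insert:
  assumes "finite A" and "a \<notin> A"
  shows "(\<Sum>I\<in>Pow (insert a A). f I) = (\<Sum>I\<in>Pow A. f (insert a I)) + (\<Sum>I\<in>Pow A. f I)"
proof -
  have "inj_on (insert a) (Pow A)" using assms(2) by (auto simp: inj_on_def)
  moreover have "Pow A \<inter> insert a ` Pow A = {}" using assms(2) by auto
  ultimately show ?thesis
    using assms by (simp add: Pow_insert sum.union_disjoint sum.reindex add.commute)
qed

text \<open>A split is encoded by the set \<open>I\<close> of letters that go to the left half.
  Since the head of a sorted list is its least letter, deciding whether it belongs to
  \<open>I\<close> reproduces the two summands of the recursion with their signs.\<close>

lemma sum_Pow_eq_unshuffle_sum:
  assumes "sorted L" and "distinct L" and d: "\<And>a. d a = fst (x a)"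
  shows "(\<Sum>I\<in>Pow (set L). sg (inversion_sum d (filter (\<lambda>a. a \<in> I) L @ filter (\<lambda>a. a \<notin> I) L))
      (F (map x (filter (\<lambda>a. a \<in> I) L)) (map x (filter (\<lambda>a. a \<notin> I) L)))) =
    unshuffle_sum (map x L) F"
proof -
  define fI where "fI I = filter (\<lambda>a. a \<in> I)" for I :: "nat set"
  define fC where "fC I = filter (\<lambda>a. a \<notin> I)" for I :: "nat set"
  have "(\<Sum>I\<in>Pow (set L). sg (inversion_sum d (fI I L @ fC I L)) (F (map x (fI I L)) (map x (fC I L)))) =
      unshuffle_sum (map x L) F"
    using assms(1,2)
  proof (induction L arbitrary: F)
    case (Cons a L)
    let ?G = "\<lambda>I. F (map x (fI I (a # L))) (map x (fC I (a # L)))"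
    have less: "\<forall>b\<in>set (fI I L @ fC I L). a < b" for I
      using Cons.prems by (auto simp: fI_def fC_def order_less_le)
    have aL: "a \<notin> set L" and L: "sorted L" "distinct L" using Cons.prems by auto
    have 1: "(\<Sum>I\<in>Pow (set L). sg (inversion_sum d (fI (insert a I) (a # L) @ fC (insert a I) (a # L))) (?G (insert a I))) =
        unshuffle_sum (map x L) (\<lambda>S T. F (x a # S) T)"
      unfolding Cons.IH[OF L, symmetric]
    proof (rule sum.cong[OF refl])
      fix I assume "I \<in> Pow (set L)"
      have eq: "fI (insert a I) (a # L) = a # fI I L" "fC (insert a I) (a # L) = fC I L"
        using aL by (auto simp: fI_def fC_def intro!: filter_cong)
      show "sg (inversion_sum d (fI (insert a I) (a # L) @ fC (insert a I) (a # L))) (?G (insert a I)) =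
          sg (inversion_sum d (fI I L @ fC I L)) (F (x a # map x (fI I L)) (map x (fC I L)))"
        unfolding eq append_Cons inversion_sum_minimal_left[OF less] by simp
    qed
    have 2: "(\<Sum>I\<in>Pow (set L). sg (inversion_sum d (fI I (a # L) @ fC I (a # L))) (?G I)) =
        unshuffle_sum (map x L) (\<lambda>S T. sg (fst (x a) * deg S) (F S (x a # T)))"
      unfolding Cons.IH[OF L, symmetric]
    proof (rule sum.cong[OF refl])
      fix I assume "I \<in> Pow (set L)"
      hence eq: "fI I (a # L) = fI I L" "fC I (a # L) = a # fC I L"
        using aL by (auto simp: fI_def fC_def)
      have deg_eq: "(\<Sum>b\<leftarrow>fI I L. d b) = deg (map x (fI I L))"
        by (simp add: deg_def d comp_def)
      show "sg (inversion_sum d (fI I (a # L) @ fC I (a # L))) (?G I) = sg (inversion_sum d (fI I L @ fC I L))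
          (sg (fst (x a) * deg (map x (fI I L))) (F (map x (fI I L)) (x a # map x (fC I L))))"
        unfolding eq inversion_sum_minimal_middle[OF less] deg_eq d[of a] sg_sg by (simp add: add.commute)
    qed
    show ?case
      by (simp only: list.set sum_Pow_insert[OF finite_set aL] 1 2 list.map unshuffle_sum.simps)
  qed (simp add: fI_def fC_def)
  thus ?thesis by (simp only: fI_def fC_def)
qed

text \<open>Both blocks of a shuffle are increasing, so each is the sorted enumeration of its set of
  values, and the image of the first block determines everything.\<close>

lemma shuffle_perms_filter:
  assumes \<sigma>: "\<sigma> \<in> shuffle_perms i n" and "i \<le> n"
  shows "map \<sigma> [0..<i] = filter (\<lambda>a. a \<in> \<sigma> ` {..<i}) [0..<n]"
    and "map \<sigma> [i..<n] = filter (\<lambda>a. a \<notin> \<sigma> ` {..<i}) [0..<n]"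
proof -
  have perm: "\<sigma> permutes {..<n}" and s1: "strict_mono_on {..<i} \<sigma>" and s2: "strict_mono_on {i..<n} \<sigma>"
    using \<sigma> by (auto simp: shuffle_perms_def)
  have inj: "inj \<sigma>" using perm by (rule permutes_inj)
  have img: "\<sigma> ` {..<n} = {..<n}" using perm by (rule permutes_image)
  have sub: "\<sigma> ` {..<i} \<subseteq> {..<n}" using img assms(2) by (metis image_mono lessThan_subset_iff)
  have split: "{i..<n} = {..<n} - {..<i}" by auto
  have rest: "\<sigma> ` {i..<n} = {..<n} - \<sigma> ` {..<i}"
    unfolding split image_set_diff[OF inj] img ..
  show "map \<sigma> [0..<i] = filter (\<lambda>a. a \<in> \<sigma> ` {..<i}) [0..<n]"
  proof (rule sorted_distinct_set_unique)
    show "sorted (map \<sigma> [0..<i])"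
      using s1 by (auto simp: sorted_wrt_map sorted_wrt_iff_nth_less strict_mono_on_def intro!: less_imp_le)
    show "distinct (map \<sigma> [0..<i])" using inj_on_subset[OF inj] by (simp add: distinct_map)
    show "set (map \<sigma> [0..<i]) = set (filter (\<lambda>a. a \<in> \<sigma> ` {..<i}) [0..<n])"
      using sub by (auto simp: lessThan_atLeast0)
  qed (auto simp: sorted_wrt_filter)
  show "map \<sigma> [i..<n] = filter (\<lambda>a. a \<notin> \<sigma> ` {..<i}) [0..<n]"
  proof (rule sorted_distinct_set_unique)
    show "sorted (map \<sigma> [i..<n])"
      by (auto simp: sorted_wrt_map sorted_wrt_iff_nth_less intro!: less_imp_le strict_mono_onD[OF s2])
    show "distinct (map \<sigma> [i..<n])" using inj_on_subset[OF inj] by (simp add: distinct_map)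
    show "set (map \<sigma> [i..<n]) = set (filter (\<lambda>a. a \<notin> \<sigma> ` {..<i}) [0..<n])"
      using rest by auto
  qed (auto simp: sorted_wrt_filter)
qed

text \<open>The converse construction: listing \<open>I\<close> and then its complement, both in
  increasing order, is a shuffle.\<close>

lemma filter_filter_bij:
  assumes "I \<subseteq> {..<n}"
  defines "w \<equiv> filter (\<lambda>a. a \<in> I) [0..<n] @ filter (\<lambda>a. a \<notin> I) [0..<n]"
  defines "\<sigma> \<equiv> \<lambda>k. if k < n then w ! k else k"
  shows "\<sigma> \<in> shuffle_perms (card I) n" and "\<sigma> ` {..<card I} = I" and "card I \<le> n"
proof -
  have len1: "length (filter (\<lambda>a. a \<in> I) [0..<n]) = card I"
  proof -
    have "distinct (filter (\<lambda>a. a \<in> I) [0..<n])" by simp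
    hence "length (filter (\<lambda>a. a \<in> I) [0..<n]) = card (set (filter (\<lambda>a. a \<in> I) [0..<n]))"
      by (simp only: distinct_card)
    also have "set (filter (\<lambda>a. a \<in> I) [0..<n]) = I" using assms(1) by auto
    finally show ?thesis .
  qed
  show cI: "card I \<le> n" using card_mono[OF _ assms(1)] by simp
  have len: "length w = n"
    unfolding w_def using sum_length_filter_compl[of "\<lambda>a. a \<in> I" "[0..<n]"] by simp
  have dist: "distinct w" unfolding w_def by auto
  have set: "set w = {..<n}" unfolding w_def by auto
  have \<sigma>w: "\<sigma> k = w ! k" if "k < n" for k using that by (simp add: \<sigma>_def)
  have "bij_betw ((!) w) {..<n} {..<n}" by (rule bij_betw_nth[OF dist]) (simp_all only: len set)
  hence "bij_betw \<sigma> {..<n} {..<n}" by (rule bij_betw_cong[THEN iffD1, rotated]) (simp add: \<sigma>w)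
  hence perm: "\<sigma> permutes {..<n}" by (rule bij_imp_permutes) (simp add: \<sigma>_def)
  have nth1: "\<sigma> k = filter (\<lambda>a. a \<in> I) [0..<n] ! k" if "k < card I" for k
    using that cI len1 by (simp add: \<sigma>_def w_def nth_append)
  have nth2: "\<sigma> k = filter (\<lambda>a. a \<notin> I) [0..<n] ! (k - card I)" if "card I \<le> k" "k < n" for k
    using that len1 by (simp add: \<sigma>_def w_def nth_append)
  have len2: "length (filter (\<lambda>a. a \<notin> I) [0..<n]) = n - card I"
    using len len1 by (simp add: w_def)
  have sort: "sorted_wrt (<) (filter P [0..<n])" for P
    by (rule sorted_wrt_filter) (rule sorted_wrt_upt)
  have s1: "strict_mono_on {..<card I} \<sigma>"
    by (rule strict_mono_onI) (use sorted_wrt_nth_less[OF sort] len1 in \<open>auto simp: nth1\<close>)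
  have s2: "strict_mono_on {card I..<n} \<sigma>"
  proof (rule strict_mono_onI)
    fix r s assume "r \<in> {card I..<n}" "s \<in> {card I..<n}" "r < s"
    thus "\<sigma> r < \<sigma> s"
      using sorted_wrt_nth_less[OF sort, of "r - card I" "s - card I" "\<lambda>a. a \<notin> I"] len2
      by (simp add: nth2)
  qed
  show "\<sigma> \<in> shuffle_perms (card I) n" using perm s1 s2 by (simp add: shuffle_perms_def)
  have "\<sigma> ` {..<card I} = (!) (filter (\<lambda>a. a \<in> I) [0..<n]) ` {..<card I}"
    by (intro image_cong) (simp_all add: nth1)
  also have "\<dots> = set (filter (\<lambda>a. a \<in> I) [0..<n])"
    using len1 by (auto simp: set_conv_nth)
  also have "\<dots> = I" using assms(1) by auto
  finally show "\<sigma> ` {..<card I} = I" .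
qed

text \<open>Shuffles of all block sizes together correspond to subsets of the positions. The range
  starts at \<open>i = 0\<close>, whereas the Jacobi identity starts at 1; the extra summand is
  disposed of in \<open>l_jacobi\<close>.\<close>

lemma sum_shuffle_perms_eq_unshuffle_sum:
  fixes F :: "(int \<times> 'v) list \<Rightarrow> (int \<times> 'v) list \<Rightarrow> 'w::ab_group_add"
  assumes "length xs = n"
  shows "(\<Sum>i = 0..n. \<Sum>\<sigma>\<in>shuffle_perms i n. sg (inversion_sum ((!) (map fst xs)) (map \<sigma> [0..<n]))
      (F (take i (permute_entries \<sigma> xs)) (drop i (permute_entries \<sigma> xs)))) = unshuffle_sum xs F"
proof -
  define d where "d = (!) (map fst xs)"
  define fI where "fI I = filter (\<lambda>a. a \<in> I) [0..<n]" for I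
  define fC where "fC I = filter (\<lambda>a. a \<notin> I) [0..<n]" for I
  \<comment> \<open>Outside the positions the witness is the identity, as \<open>permutes\<close>
    requires.\<close>
  define perm where "perm I = (\<lambda>k. if k < n then (fI I @ fC I) ! k else k)" for I
  have fin: "finite (shuffle_perms i n)" for i
    by (rule finite_subset[OF _ finite_permutations[of "{..<n}"]]) (auto simp: shuffle_perms_def)
  have word: "map \<sigma> [0..<i] = fI (\<sigma> ` {..<i})" "map \<sigma> [i..<n] = fC (\<sigma> ` {..<i})"
      "map \<sigma> [0..<n] = fI (\<sigma> ` {..<i}) @ fC (\<sigma> ` {..<i})"
    if "\<sigma> \<in> shuffle_perms i n" "i \<le> n" for i \<sigma>
  proof -
    show a: "map \<sigma> [0..<i] = fI (\<sigma> ` {..<i})" and b: "map \<sigma> [i..<n] = fC (\<sigma> ` {..<i})"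
      using shuffle_perms_filter[OF that] by (simp_all add: fI_def fC_def)
    show "map \<sigma> [0..<n] = fI (\<sigma> ` {..<i}) @ fC (\<sigma> ` {..<i})"
      using upt_add_eq_append[of 0 i "n - i"] that(2) by (simp flip: a b map_append)
  qed
  have "(\<Sum>i = 0..n. \<Sum>\<sigma>\<in>shuffle_perms i n. sg (inversion_sum d (map \<sigma> [0..<n]))
      (F (take i (permute_entries \<sigma> xs)) (drop i (permute_entries \<sigma> xs)))) =
    (\<Sum>(i, \<sigma>)\<in>Sigma {0..n} (\<lambda>i. shuffle_perms i n). sg (inversion_sum d (map \<sigma> [0..<n]))
      (F (take i (permute_entries \<sigma> xs)) (drop i (permute_entries \<sigma> xs))))"
    using fin by (simp add: sum.Sigma)
  also have "\<dots> = (\<Sum>I\<in>Pow (set [0..<n]). sg (inversion_sum d (fI I @ fC I))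
      (F (map ((!) xs) (fI I)) (map ((!) xs) (fC I))))"
  proof (rule sum.reindex_bij_witness[where i = "\<lambda>I. (card I, perm I)" and j = "\<lambda>(i, \<sigma>). \<sigma> ` {..<i}"])
    fix z assume "z \<in> Sigma {0..n} (\<lambda>i. shuffle_perms i n)"
    then obtain i \<sigma> where z: "z = (i, \<sigma>)" "i \<le> n" "\<sigma> \<in> shuffle_perms i n" by auto
    note w = word[OF z(3,2)]
    have p: "\<sigma> permutes {..<n}" using z(3) by (simp add: shuffle_perms_def)
    have perm: "\<sigma> k = perm (\<sigma> ` {..<i}) k" for k
    proof (cases "k < n")
      case True
      thus ?thesis using arg_cong[OF w(3), of "\<lambda>l. l ! k"] by (simp add: perm_def)
    next
      case False
      thus ?thesis using p by (simp add: perm_def permutes_def)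
    qed
    have "card (\<sigma> ` {..<i}) = i" using inj_on_subset[OF permutes_inj[OF p]] by (simp add: card_image)
    moreover have "perm (\<sigma> ` {..<i}) = \<sigma>" by (rule ext) (rule perm[symmetric])
    ultimately show "(\<lambda>I. (card I, perm I)) ((\<lambda>(i, \<sigma>). \<sigma> ` {..<i}) z) = z" by (simp add: z)
    show "(\<lambda>(i, \<sigma>). \<sigma> ` {..<i}) z \<in> Pow (set [0..<n])"
      using permutes_image[OF p] z(2) image_mono[of "{..<i}" "{..<n}" \<sigma>] by (auto simp: z)
    have "take i (permute_entries \<sigma> xs) = map ((!) xs) (map \<sigma> [0..<i])"
      "drop i (permute_entries \<sigma> xs) = map ((!) xs) (map \<sigma> [i..<n])"
      using z(2) by (simp_all add: permute_entries_def assms take_map drop_map)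
    thus "sg (inversion_sum d (fI ((\<lambda>(i, \<sigma>). \<sigma> ` {..<i}) z) @ fC ((\<lambda>(i, \<sigma>). \<sigma> ` {..<i}) z)))
      (F (map ((!) xs) (fI ((\<lambda>(i, \<sigma>). \<sigma> ` {..<i}) z))) (map ((!) xs) (fC ((\<lambda>(i, \<sigma>). \<sigma> ` {..<i}) z)))) =
      (case z of (i, \<sigma>) \<Rightarrow> sg (inversion_sum d (map \<sigma> [0..<n]))
      (F (take i (permute_entries \<sigma> xs)) (drop i (permute_entries \<sigma> xs))))"
      unfolding z prod.case w by simp
  next
    fix I assume "I \<in> Pow (set [0..<n])"
    hence "I \<subseteq> {..<n}" by auto
    note b = filter_filter_bij[OF this, folded fI_def fC_def, folded perm_def]
    show "(\<lambda>(i, \<sigma>). \<sigma> ` {..<i}) (card I, perm I) = I" "(card I, perm I) \<in> Sigma {0..n} (\<lambda>i. shuffle_perms i n)"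
      using b by auto
  qed
  also have "\<dots> = (\<Sum>I\<in>Pow (set [0..<n]). sg (inversion_sum (\<lambda>a. fst (xs ! a)) (fI I @ fC I))
      (F (map ((!) xs) (fI I)) (map ((!) xs) (fC I))))"
  proof (intro sum.cong refl arg_cong2[of _ _ _ _ sg])
    fix I
    \<comment> \<open>The two degree functions are compared on actual positions only, since indexing
      beyond the end of a list is unspecified.\<close>
    have *: "inversion_sum d w = inversion_sum (\<lambda>a. fst (xs ! a)) w" if "set w \<subseteq> {..<n}" for w
      using that
    proof (induction w)
      case (Cons a w)
      have "(\<Sum>b\<leftarrow>w. if b < a then d a * d b else 0) = (\<Sum>b\<leftarrow>w. if b < a then fst (xs ! a) * fst (xs ! b) else 0)"
        by (rule arg_cong[of _ _ sum_list], rule map_cong) (use Cons.prems assms in \<open>auto simp: d_def\<close>)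
      thus ?case using Cons by simp
    qed simp
    show "inversion_sum d (fI I @ fC I) = inversion_sum (\<lambda>a. fst (xs ! a)) (fI I @ fC I)"
      by (rule *) (auto simp: fI_def fC_def)
  qed
  also have "\<dots> = unshuffle_sum (map ((!) xs) [0..<n]) F"
    unfolding fI_def fC_def by (rule sum_Pow_eq_unshuffle_sum) simp_all
  also have "map ((!) xs) [0..<n] = xs" using assms map_nth by blast
  finally show ?thesis unfolding d_def .
qed

section \<open>Higher derived brackets\<close>

text \<open>The distinguished entry will be the one that supplies the element of \<open>H\<close>,
  all others supplying elements of \<open>A\<close>. \<open>P\<close> accumulates the entries
  already passed, so that the sign of moving the distinguished entry to the front can be read
  off.\<close>

primrec slot_sum :: "('x list \<Rightarrow> 'x \<Rightarrow> 'x list \<Rightarrow> 'w::comm_monoid_add) \<Rightarrow> 'x list \<Rightarrow> 'x list \<Rightarrow> 'w" where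
  "slot_sum t P [] = 0"
| "slot_sum t P (x # xs) = t P x xs + slot_sum t (P @ [x]) xs"

lemma slot_sum_cong:
  "(\<And>A x B. xs = A @ x # B \<Longrightarrow> t (P @ A) x B = t' (P @ A) x B) \<Longrightarrow> slot_sum t P xs = slot_sum t' P xs"
proof (induction xs arbitrary: P)
  case (Cons x xs)
  have "slot_sum t (P @ [x]) xs = slot_sum t' (P @ [x]) xs"
    using Cons.prems[of "x # _"] by (intro Cons.IH) simp
  thus ?case using Cons.prems[of "[]" x xs] by simp
qed simp

lemma slot_sum_0 [simp]: "slot_sum (\<lambda>A x B. 0) P xs = 0"
  by (induction xs arbitrary: P) simp_all

lemma slot_sum_eq_0:
  assumes "\<And>A x B. xs = A @ x # B \<Longrightarrow> t (P @ A) x B = 0"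
  shows "slot_sum t P xs = 0"
  using slot_sum_cong[of xs t P "\<lambda>A x B. 0"] assms by simp

lemma slot_sum_map: "slot_sum t (map g P) (map g xs) = slot_sum (\<lambda>A x B. t (map g A) (g x) (map g B)) P xs"
proof (induction xs arbitrary: P)
  case (Cons x xs)
  show ?case using Cons.IH[of "P @ [x]"] by simp
qed simp

lemma slot_sum_closed:
  assumes "\<And>A x B. P @ xs = A @ x # B \<Longrightarrow> t A x B \<in> C"
    and "0 \<in> C" "\<And>x y. x \<in> C \<Longrightarrow> y \<in> C \<Longrightarrow> x + y \<in> C"
  shows "slot_sum t P xs \<in> C"
  using assms(1)
proof (induction xs arbitrary: P)
  case (Cons x xs)
  have "slot_sum t (P @ [x]) xs \<in> C"
    by (rule Cons.IH) (rule Cons.prems, simp)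
  thus ?case using Cons.prems[of P x xs] assms(3) by simp
qed (simp add: assms(2))

text \<open>The three numbered hypotheses on \<open>t\<close> distinguish where the varied entry
  stands: it is the distinguished one, it comes after it, or it comes before it. In the application
  \<psi> is multiplication by a scalar.\<close>

lemma slot_sum_lin:
  fixes \<psi> :: "'w::ab_group_add \<Rightarrow> 'w"
  assumes \<psi>: "\<And>u v. u \<in> W \<Longrightarrow> v \<in> W \<Longrightarrow> \<psi> (u + v) = \<psi> u + \<psi> v" "\<psi> 0 = 0"
    and W: "0 \<in> W" "\<And>u v. u \<in> W \<Longrightarrow> v \<in> W \<Longrightarrow> u + v \<in> W"
    and W1: "\<And>A z B. P @ R @ x # Q = A @ z # B \<Longrightarrow> t A z B \<in> W"
    and 1: "t (P @ R) w Q = \<psi> (t (P @ R) x Q) + t (P @ R) y Q"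
    and 2: "\<And>A z B B'. P @ R = A @ z # B \<Longrightarrow>
      t A z (B @ w # Q) = \<psi> (t A z (B @ x # Q)) + t A z (B @ y # Q)"
    and 3: "\<And>A z B. Q = A @ z # B \<Longrightarrow>
      t (P @ R @ w # A) z B = \<psi> (t (P @ R @ x # A) z B) + t (P @ R @ y # A) z B"
  shows "slot_sum t P (R @ w # Q) = \<psi> (slot_sum t P (R @ x # Q)) + slot_sum t P (R @ y # Q)"
proof -
  have tail: "slot_sum t (P @ R @ w # A) B =
      \<psi> (slot_sum t (P @ R @ x # A) B) + slot_sum t (P @ R @ y # A) B" if "Q = A @ B" for A B
    using that
  proof (induction B arbitrary: A)
    case (Cons z B)
    have IH: "slot_sum t (P @ R @ w # A @ [z]) B =
      \<psi> (slot_sum t (P @ R @ x # A @ [z]) B) + slot_sum t (P @ R @ y # A @ [z]) B"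
      by (rule Cons.IH) (simp add: Cons.prems)
    have "t (P @ R @ x # A) z B \<in> W" by (rule W1) (simp add: Cons.prems)
    moreover have "slot_sum t (P @ R @ x # A @ [z]) B \<in> W"
      by (rule slot_sum_closed) (use W1 W Cons.prems in auto)
    ultimately show ?case
      using 3[OF Cons.prems] IH by (simp add: \<psi> algebra_simps)
  qed (simp add: \<psi>)
  have "slot_sum t A (B @ w # Q) = \<psi> (slot_sum t A (B @ x # Q)) + slot_sum t A (B @ y # Q)" if "P @ R = A @ B" for A B
    using that
  proof (induction B arbitrary: A)
    case Nil
    have "t A x Q \<in> W" by (rule W1) (use Nil in simp)
    moreover have "slot_sum t (A @ [x]) Q \<in> W"
      by (rule slot_sum_closed) (use W1 W Nil in auto)
    moreover have [simp]: "A = P @ R" using Nil by simp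
    ultimately show ?case
      using tail[of "[]" Q] 1 by (simp add: \<psi> algebra_simps)
  next
    case (Cons z B)
    have "slot_sum t (A @ [z]) (B @ w # Q) = \<psi> (slot_sum t (A @ [z]) (B @ x # Q)) + slot_sum t (A @ [z]) (B @ y # Q)"
      by (rule Cons.IH) (simp add: Cons.prems)
    moreover have eq: "P @ R @ x # Q = A @ z # B @ x # Q" using Cons.prems by (metis append.assoc append_Cons)
    hence "t A z (B @ x # Q) \<in> W" by (rule W1)
    moreover have "slot_sum t (A @ [z]) (B @ x # Q) \<in> W"
      by (rule slot_sum_closed) (use W1 W in \<open>auto simp: eq\<close>)
    ultimately show ?case
      using 2[OF Cons.prems] by (simp add: \<psi> algebra_simps)
  qed
  from this[of P R] show ?thesis by simp
qed

text \<open>A distinguished entry away from \<open>x\<close> and \<open>y\<close> only sees its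
  context swapped. The terms in which \<open>x\<close> or \<open>y\<close> is itself distinguished
  trade places, which is what hypotheses 2 and 3 describe.\<close>

lemma slot_sum_swap:
  assumes 1: "\<And>A z B. P @ R = A @ z # B \<Longrightarrow> t A z (B @ x # y # Q) = sg n (t A z (B @ y # x # Q))"
    and 2: "t (P @ R) x (y # Q) = sg n (t (P @ R @ [y]) x Q)"
    and 3: "t (P @ R @ [x]) y Q = sg n (t (P @ R) y (x # Q))"
    and 4: "\<And>A z B. Q = A @ z # B \<Longrightarrow> t (P @ R @ x # y # A) z B = sg n (t (P @ R @ y # x # A) z B)"
  shows "slot_sum t P (R @ x # y # Q) = sg n (slot_sum t P (R @ y # x # Q))"
proof -
  have tail: "slot_sum t (P @ R @ x # y # A) B = sg n (slot_sum t (P @ R @ y # x # A) B)" if "Q = A @ B" for A B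
    using that
  proof (induction B arbitrary: A)
    case (Cons z B)
    have "slot_sum t (P @ R @ x # y # A @ [z]) B = sg n (slot_sum t (P @ R @ y # x # A @ [z]) B)"
      by (rule Cons.IH) (simp add: Cons.prems)
    thus ?case using 4[OF Cons.prems] by (simp add: sg_add)
  qed simp
  have "slot_sum t A (B @ x # y # Q) = sg n (slot_sum t A (B @ y # x # Q))" if "P @ R = A @ B" for A B
    using that
  proof (induction B arbitrary: A)
    case Nil
    hence [simp]: "A = P @ R" by simp
    show ?case using tail[of "[]" Q] 2 3 by (simp add: sg_add algebra_simps)
  next
    case (Cons z B)
    have "slot_sum t (A @ [z]) (B @ x # y # Q) = sg n (slot_sum t (A @ [z]) (B @ y # x # Q))"
      by (rule Cons.IH) (simp add: Cons.prems)
    thus ?case using 1[OF Cons.prems] by (simp add: sg_add)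
  qed
  from this[of P R] show ?thesis by simp
qed

text \<open>\<open>G\<close> is a graded Lie algebra, \<open>H\<close> a graded subalgebra killed by
  \<open>p\<close>, and \<open>A\<close> an abelian one onto which \<open>p\<close> projects. The
  ambient \<open>C\<close> may be larger than the sum of the \<open>G n\<close>; it is the domain on
  which everything is linear. The projections \<open>ev\<close> and \<open>od\<close> to even and
  odd degrees belong to the data, because on such a \<open>C\<close> they cannot be recovered from
  the grading.\<close>

locale derived_bracket_data = vector_space sc
  for sc :: "'k::field \<Rightarrow> 'v::ab_group_add \<Rightarrow> 'v" +
  fixes C :: "'v set" and G H A :: "int \<Rightarrow> 'v set"
    and br :: "'v \<Rightarrow> 'v \<Rightarrow> 'v" and p ev od :: "'v \<Rightarrow> 'v"
  assumes C: "subspace C"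
    and G: "subspace (G n)" "G n \<subseteq> C"
    and indep: "finite I \<Longrightarrow> (\<And>i. i \<in> I \<Longrightarrow> w i \<in> G i) \<Longrightarrow> (\<Sum>i\<in>I. w i) = 0 \<Longrightarrow> i \<in> I \<Longrightarrow> w i = 0"
    and br_C: "x \<in> C \<Longrightarrow> y \<in> C \<Longrightarrow> br x y \<in> C"
    and br_lin: "x \<in> C \<Longrightarrow> y \<in> C \<Longrightarrow> z \<in> C \<Longrightarrow> br (sc c x + y) z = sc c (br x z) + br y z"
      "x \<in> C \<Longrightarrow> y \<in> C \<Longrightarrow> z \<in> C \<Longrightarrow> br z (sc c x + y) = sc c (br z x) + br z y"
    and br_G: "x \<in> G a \<Longrightarrow> y \<in> G b \<Longrightarrow> br x y \<in> G (a + b)"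
    and antisym: "x \<in> G a \<Longrightarrow> y \<in> G b \<Longrightarrow> br x y = - sg (a * b) (br y x)"
    and jacobi: "x \<in> G a \<Longrightarrow> y \<in> G b \<Longrightarrow> z \<in> G d \<Longrightarrow>
      br (br x y) z = br x (br y z) + sg (b * d) (br (br x z) y)"
    and H: "subspace (H n)" "H n \<subseteq> G n"
    and br_H: "x \<in> H a \<Longrightarrow> y \<in> H b \<Longrightarrow> br x y \<in> H (a + b)"
    and A: "subspace (A n)" "A n \<subseteq> G n"
    and br_A: "x \<in> A a \<Longrightarrow> y \<in> A b \<Longrightarrow> br x y = 0"
    and p_C: "x \<in> C \<Longrightarrow> p x \<in> C"
    and p_lin: "x \<in> C \<Longrightarrow> y \<in> C \<Longrightarrow> p (sc c x + y) = sc c (p x) + p y"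
    and p_A: "x \<in> G n \<Longrightarrow> p x \<in> A n"
    and p_id: "x \<in> A n \<Longrightarrow> p x = x"
    and p_H: "x \<in> H n \<Longrightarrow> p x = 0"
    and p_kernel: "x \<in> G a \<Longrightarrow> y \<in> G b \<Longrightarrow> p x = 0 \<Longrightarrow> p y = 0 \<Longrightarrow> p (br x y) = 0"
    and parity_C: "x \<in> C \<Longrightarrow> ev x \<in> C" "x \<in> C \<Longrightarrow> od x \<in> C"
    and parity_lin: "x \<in> C \<Longrightarrow> y \<in> C \<Longrightarrow> ev (sc c x + y) = sc c (ev x) + ev y"
      "x \<in> C \<Longrightarrow> y \<in> C \<Longrightarrow> od (sc c x + y) = sc c (od x) + od y"
    and parity: "x \<in> G n \<Longrightarrow> ev x = (if even n then x else 0)"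
      "x \<in> G n \<Longrightarrow> od x = (if even n then 0 else x)"
begin

section \<open>Linearity, signs and iterated brackets\<close>

lemma in_C: "x \<in> G n \<Longrightarrow> x \<in> C"
  using G by blast
lemma H_G: "x \<in> H n \<Longrightarrow> x \<in> G n"
  using H by blast
lemma A_G: "x \<in> A n \<Longrightarrow> x \<in> G n"
  using A by blast

lemma zero_in [simp]: "0 \<in> C" "0 \<in> G n" "0 \<in> H n" "0 \<in> A n"
  using C G H A by (auto intro: subspace_0)

lemma sg_in: "x \<in> G n \<Longrightarrow> sg k x \<in> G n" "x \<in> C \<Longrightarrow> sg k x \<in> C" "x \<in> H n \<Longrightarrow> sg k x \<in> H n" "x \<in> A n \<Longrightarrow> sg k x \<in> A n"
  using C G H A by (auto simp: sg_def intro: subspace_neg)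

lemma add_C: "x \<in> C \<Longrightarrow> y \<in> C \<Longrightarrow> x + y \<in> C"
  using C by (rule subspace_add)
lemma br_0 [simp]: "x \<in> C \<Longrightarrow> br 0 x = 0" "x \<in> C \<Longrightarrow> br x 0 = 0"
  using br_lin[of 0 0 x 1] by simp_all

lemma p_0 [simp]: "p 0 = 0"
  using p_id[of 0 0] by simp

lemma br_add: "x \<in> C \<Longrightarrow> y \<in> C \<Longrightarrow> z \<in> C \<Longrightarrow> br (x + y) z = br x z + br y z"
    "x \<in> C \<Longrightarrow> y \<in> C \<Longrightarrow> z \<in> C \<Longrightarrow> br z (x + y) = br z x + br z y"
  using br_lin[of x y z 1] by simp_all

lemma br_sg: "x \<in> C \<Longrightarrow> y \<in> C \<Longrightarrow> br (sg k x) y = sg k (br x y)"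
    "x \<in> C \<Longrightarrow> y \<in> C \<Longrightarrow> br x (sg k y) = sg k (br x y)"
  using br_lin(1)[of x 0 y "-1"] br_lin(2)[of y 0 x "-1"] by (simp_all add: sg_def)

lemma p_add: "x \<in> C \<Longrightarrow> y \<in> C \<Longrightarrow> p (x + y) = p x + p y"
  using p_lin[of x y 1] by simp

lemma p_sg: "x \<in> C \<Longrightarrow> p (sg k x) = sg k (p x)"
  using p_lin[of x 0 "-1"] by (simp add: sg_def)

text \<open>The grading involution, multiplication by \<open>(-1)^n\<close> in degree
  \<open>n\<close>, in a form that is linear on all of \<open>C\<close>.\<close>

definition tau :: "'v \<Rightarrow> 'v" where
  "tau x = ev x - od x"

lemma tau_G: "x \<in> G n \<Longrightarrow> tau x = sg n x"
  by (simp add: tau_def parity sg_def)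

lemma tau_0 [simp]: "tau 0 = 0"
  using tau_G[of 0 0] by simp

lemma parity_0 [simp]: "ev 0 = 0" "od 0 = 0"
  using parity[of 0 0] by simp_all

lemma tau_C: "x \<in> C \<Longrightarrow> tau x \<in> C"
  using C parity_C by (simp add: tau_def subspace_diff)

lemma tau_lin: "x \<in> C \<Longrightarrow> y \<in> C \<Longrightarrow> tau (sc c x + y) = sc c (tau x) + tau y"
  by (simp add: tau_def parity_lin scale_right_diff_distrib)

lemma foldl_C: "f \<in> C \<Longrightarrow> set hs \<subseteq> C \<Longrightarrow> foldl br f hs \<in> C"
  by (induction hs arbitrary: f) (auto intro: br_C)

lemma foldl_0 [simp]: "set hs \<subseteq> C \<Longrightarrow> foldl br 0 hs = 0"
  by (induction hs) auto

lemma foldl_lin_head: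
  "f \<in> C \<Longrightarrow> f' \<in> C \<Longrightarrow> set hs \<subseteq> C \<Longrightarrow> foldl br (sc c f + f') hs = sc c (foldl br f hs) + foldl br f' hs"
  by (induction hs arbitrary: f f') (auto simp: br_lin br_C)

lemma foldl_add_head:
  "f \<in> C \<Longrightarrow> f' \<in> C \<Longrightarrow> set hs \<subseteq> C \<Longrightarrow> foldl br (f + f') hs = foldl br f hs + foldl br f' hs"
  using foldl_lin_head[of f f' hs 1] by simp

lemma foldl_sg_head: "f \<in> C \<Longrightarrow> set hs \<subseteq> C \<Longrightarrow> foldl br (sg k f) hs = sg k (foldl br f hs)"
  using foldl_lin_head[of f 0 hs "-1"] by (simp add: sg_def)

lemma foldl_lin_slot:
  assumes "f \<in> C" "set P \<subseteq> C" "set Q \<subseteq> C" "h \<in> C" "h' \<in> C"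
  shows "foldl br f (P @ (sc c h + h') # Q) = sc c (foldl br f (P @ h # Q)) + foldl br f (P @ h' # Q)"
  using assms by (simp add: br_lin foldl_C foldl_lin_head br_C)

lemma foldl_zero_slot: "f \<in> C \<Longrightarrow> set hs \<subseteq> C \<Longrightarrow> 0 \<in> set hs \<Longrightarrow> foldl br f hs = 0"
  by (induction hs arbitrary: f) (auto intro: br_C)

definition l_term :: "('v \<times> 'v) list \<Rightarrow> 'v \<times> 'v \<Rightarrow> ('v \<times> 'v) list \<Rightarrow> 'v" where
  "l_term P x Q = p (foldl br (ev (fst x)) (map (tau \<circ> snd) P @ map snd Q)) +
    p (foldl br (od (fst x)) (map snd (P @ Q)))"

text \<open>In \<open>l_term\<close> the operator \<open>tau\<close> implements the Koszul sign of moving \<open>x\<close> to the front, its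
  degree as an element of the shifted space being odd for its even part.\<close>

definition l :: "('v \<times> 'v) list \<Rightarrow> 'v \<times> 'v" where
  "l xs = (if length xs = 2 then br (tau (fst (xs ! 0))) (fst (xs ! 1)) else 0, slot_sum l_term [] xs)"

lemma map_C: "set P \<subseteq> C \<times> C \<Longrightarrow> set (map snd P) \<subseteq> C" "set P \<subseteq> C \<times> C \<Longrightarrow> set (map (tau \<circ> snd) P) \<subseteq> C"
  by (auto simp: tau_C)

lemma l_term_C:
  "set P \<subseteq> C \<times> C \<Longrightarrow> x \<in> C \<times> C \<Longrightarrow> set Q \<subseteq> C \<times> C \<Longrightarrow> l_term P x Q \<in> C"
  unfolding l_term_def using map_C[of P] map_C[of Q]
  by (intro add_C p_C foldl_C) (auto simp: parity_C)

lemma l_lin: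
  fixes c :: 'k
  assumes "set P \<subseteq> C \<times> C" "set Q \<subseteq> C \<times> C" "x \<in> C \<times> C" "y \<in> C \<times> C"
  defines "w \<equiv> (sc c (fst x) + fst y, sc c (snd x) + snd y)"
  shows "l (P @ w # Q) = (sc c (fst (l (P @ x # Q))) + fst (l (P @ y # Q)),
    sc c (snd (l (P @ x # Q))) + snd (l (P @ y # Q)))"
proof -
  have w: "fst w = sc c (fst x) + fst y" "snd w = sc c (snd x) + snd y" by (simp_all add: w_def)
  have xC: "fst x \<in> C" "snd x \<in> C" "fst y \<in> C" "snd y \<in> C" using assms by auto
  have mC: "snd ` set P \<subseteq> C" "(\<lambda>z. tau (snd z)) ` set P \<subseteq> C" if "set P \<subseteq> C \<times> C" for P
    using that by (auto simp: tau_C)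
  have 1: "l_term R w Q' = sc c (l_term R x Q') + l_term R y Q'"
    if "set R \<subseteq> C \<times> C" "set Q' \<subseteq> C \<times> C" for R Q'
    using mC[OF that(1)] mC[OF that(2)] xC
    by (simp add: l_term_def w parity_lin foldl_lin_head foldl_C parity_C p_lin scale_right_distrib comp_def)
        (simp add: ac_simps)?
  have 2: "l_term R z (B @ w # Q') = sc c (l_term R z (B @ x # Q')) + l_term R z (B @ y # Q')"
    if "set R \<subseteq> C \<times> C" "set B \<subseteq> C \<times> C" "set Q' \<subseteq> C \<times> C" "z \<in> C \<times> C" for R B Q' z
  proof -
    have "fst z \<in> C" using that by auto
    thus ?thesis
      using mC[OF that(1)] mC[OF that(2)] mC[OF that(3)] xC
        foldl_lin_slot[of "ev (fst z)" "map (tau \<circ> snd) R @ map snd B" "map snd Q'" "snd x" "snd y" c]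
        foldl_lin_slot[of "od (fst z)" "map snd R @ map snd B" "map snd Q'" "snd x" "snd y" c]
      by (simp add: l_term_def w parity_C foldl_C br_C p_lin scale_right_distrib comp_def)
        (simp add: ac_simps)?
  qed
  have 3: "l_term (R @ w # B) z Q' = sc c (l_term (R @ x # B) z Q') + l_term (R @ y # B) z Q'"
    if "set R \<subseteq> C \<times> C" "set B \<subseteq> C \<times> C" "set Q' \<subseteq> C \<times> C" "z \<in> C \<times> C" for R B Q' z
  proof -
    have "fst z \<in> C" using that by auto
    thus ?thesis
      using mC[OF that(1)] mC[OF that(2)] mC[OF that(3)] xC
        foldl_lin_slot[of "ev (fst z)" "map (tau \<circ> snd) R" "map (tau \<circ> snd) B @ map snd Q'" "tau (snd x)" "tau (snd y)" c]
        foldl_lin_slot[of "od (fst z)" "map snd R" "map snd B @ map snd Q'" "snd x" "snd y" c]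
      by (simp add: l_term_def w parity_C tau_C tau_lin foldl_C br_C p_lin scale_right_distrib comp_def)
        (simp add: ac_simps)?
  qed
  have "slot_sum l_term [] (P @ w # Q) = sc c (slot_sum l_term [] (P @ x # Q)) + slot_sum l_term [] (P @ y # Q)"
  proof (rule slot_sum_lin[where W = C])
    fix R z B assume "[] @ P @ x # Q = R @ z # B"
    hence "set (R @ z # B) \<subseteq> C \<times> C" using assms by (metis append_Nil insert_subset le_sup_iff list.set(2) set_append)
    thus "l_term R z B \<in> C" by (intro l_term_C) auto
  qed (use assms 1 2 3 in \<open>auto simp: scale_right_distrib add_C\<close>)
  moreover have "fst (l (P @ w # Q)) = sc c (fst (l (P @ x # Q))) + fst (l (P @ y # Q))"
  proof (cases "length P + length Q = 1")
    case True
    then consider z where "P = [z]" "Q = []" | z where "P = []" "Q = [z]"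
      by (metis One_nat_def add_is_1 length_0_conv length_Suc_conv)
    thus ?thesis
      by cases (use assms xC in \<open>auto simp: l_def w tau_lin tau_C br_lin\<close>)
  qed (simp add: l_def)
  ultimately show ?thesis by (simp add: l_def)
qed

section \<open>Homogeneous arguments and graded symmetry\<close>

definition V :: "int \<Rightarrow> ('v \<times> 'v) set" where
  "V d = H (d + 1) \<times> A d"

text \<open>Degrees are carried along as tags, because an element does not determine its degree: 0
  lies in every \<open>V d\<close>.\<close>

definition valid :: "(int \<times> 'v \<times> 'v) list \<Rightarrow> bool" where
  "valid xs \<longleftrightarrow> (\<forall>z\<in>set xs. snd z \<in> V (fst z))"

lemma valid_simps [simp]: "valid []" "valid (x # xs) \<longleftrightarrow> snd x \<in> V (fst x) \<and> valid xs"
  "valid (xs @ ys) \<longleftrightarrow> valid xs \<and> valid ys"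
  by (auto simp: valid_def)

lemma valid_mset: "mset xs = mset ys \<Longrightarrow> valid xs = valid ys"
  by (metis mset_eq_setD valid_def)

lemma VD: "x \<in> V d \<Longrightarrow> fst x \<in> H (d + 1)" "x \<in> V d \<Longrightarrow> snd x \<in> A d"
    "x \<in> V d \<Longrightarrow> fst x \<in> G (d + 1)" "x \<in> V d \<Longrightarrow> snd x \<in> G d"
    "x \<in> V d \<Longrightarrow> fst x \<in> C" "x \<in> V d \<Longrightarrow> snd x \<in> C"
  by (auto simp: V_def intro: H_G A_G in_C[OF H_G] in_C[OF A_G])

lemma V_C: "x \<in> V d \<Longrightarrow> x \<in> C \<times> C"
  using VD(5,6) by (metis mem_Times_iff)

lemma valid_C: "valid xs \<Longrightarrow> set (map snd xs) \<subseteq> C \<times> C"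
  using V_C by (auto simp: valid_def)

lemma valid_snd_C: "valid xs \<Longrightarrow> set (map (snd \<circ> snd) xs) \<subseteq> C"
  by (auto simp: valid_def dest: VD)

abbreviation nest :: "'v \<Rightarrow> (int \<times> 'v \<times> 'v) list \<Rightarrow> 'v" where
  "nest f Q \<equiv> foldl br f (map (snd \<circ> snd) Q)"

lemma foldl_G: "f \<in> G n \<Longrightarrow> valid Q \<Longrightarrow> nest f Q \<in> G (n + deg Q)"
proof (induction Q arbitrary: f n)
  case (Cons z Q)
  have "br f (snd (snd z)) \<in> G (n + fst z)"
    using Cons.prems by (intro br_G) (auto dest: VD)
  from Cons.IH[OF this] show ?case using Cons.prems by (simp add: add.assoc)
qed simp

lemma foldl_tau: "f \<in> C \<Longrightarrow> valid P \<Longrightarrow>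
    foldl br f (map (tau \<circ> snd \<circ> snd) P) = sg (deg P) (nest f P)"
proof (induction P arbitrary: f)
  case (Cons z P)
  have z: "snd (snd z) \<in> G (fst z)" "snd (snd z) \<in> C" using Cons.prems by (auto dest: VD)
  have "foldl br f (map (tau \<circ> snd \<circ> snd) (z # P)) =
      sg (deg P) (foldl br (br f (tau (snd (snd z)))) (map (snd \<circ> snd) P))"
    using Cons.prems z by (simp only: list.map foldl_Cons comp_def valid_simps Cons.IH[unfolded comp_def] br_C tau_C)
  also have "\<dots> = sg (deg P) (sg (fst z) (nest (br f (snd (snd z))) P))"
    using Cons.prems z valid_snd_C[of P] by (simp add: tau_G br_sg br_C foldl_sg_head)
  finally show ?case by (simp add: sg_sg add.commute comp_def)
qed simp

text \<open>\<open>fst (snd x)\<close> has degree \<open>fst x + 1\<close> in \<open>G\<close>, so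
  one of its parity parts vanishes. If \<open>fst x\<close> is odd, the even part remains, whose
  term applies \<open>tau\<close> to every entry of \<open>P\<close> and so collects
  \<open>sg (deg P)\<close>; if \<open>fst x\<close> is even, there is no sign.\<close>

lemma l_term_valid:
  assumes "valid P" "snd x \<in> V (fst x)" "valid Q"
  shows "l_term (map snd P) (snd x) (map snd Q) =
    sg (fst x * deg P) (p (nest (fst (snd x)) (P @ Q)))"
proof -
  let ?f = "fst (snd x)"
  have f: "?f \<in> G (fst x + 1)" "?f \<in> C" using assms by (auto dest: VD)
  note PQ = valid_snd_C[OF assms(1)] valid_snd_C[OF assms(3)]
  have eq: "foldl br ?f (map (tau \<circ> snd \<circ> snd) P @ map (snd \<circ> snd) Q) =
    sg (deg P) (nest ?f (P @ Q))"
    using PQ f assms by (simp add: foldl_tau foldl_sg_head foldl_C)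
  have tP: "set (map (tau \<circ> snd \<circ> snd) P) \<subseteq> C" using PQ tau_C by auto
  show ?thesis
  proof (cases "even (fst x)")
    case True
    thus ?thesis using f PQ tP unfolding l_term_def
      by (simp add: parity[OF f(1)] comp_assoc del: set_map) (simp add: comp_def sg_def)
  next
    case False
    hence "l_term (map snd P) (snd x) (map snd Q) = p (sg (deg P) (nest ?f (P @ Q)))"
      using f PQ tP unfolding l_term_def eq[symmetric]
      by (simp add: parity[OF f(1)] comp_assoc del: set_map)
    also have "\<dots> = sg (deg P) (p (nest ?f (P @ Q)))"
      by (rule p_sg) (use PQ f in \<open>simp add: foldl_C\<close>)
    also have "\<dots> = sg (fst x * deg P) (p (nest ?f (P @ Q)))"
      using False by (intro sg_cong) simp
    finally show ?thesis .
  qed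
qed

lemma slot_sum_valid:
  assumes "valid xs"
  shows "snd (l (map snd xs)) = slot_sum (\<lambda>P x Q. sg (fst x * deg P)
    (p (nest (fst (snd x)) (P @ Q)))) [] xs"
  unfolding l_def snd_conv slot_sum_map[of l_term snd "[]" xs, unfolded list.map]
proof (rule slot_sum_cong)
  fix P x Q assume "xs = P @ x # Q"
  thus "l_term (map snd ([] @ P)) (snd x) (map snd Q) =
      sg (fst x * deg ([] @ P)) (p (nest (fst (snd x)) (([] @ P) @ Q)))"
    unfolding append_Nil using assms by (intro l_term_valid) auto
qed

text \<open>An element of \<open>H\<close> has degree one more in \<open>G\<close> than in the
  shifted grading, which is the 1 in \<open>deg xs + 1\<close>. In the first component this happens
  twice, and one of the two is the shift of the result.\<close>

lemma l_V:
  assumes "valid xs"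
  shows "l (map snd xs) \<in> V (deg xs + 1)"
proof -
  have "snd (l (map snd xs)) \<in> A (deg xs + 1)"
    unfolding slot_sum_valid[OF assms]
  proof (rule slot_sum_closed)
    fix P x Q assume eq: "[] @ xs = P @ x # Q"
    have "nest (fst (snd x)) (P @ Q) \<in> G (fst x + 1 + deg (P @ Q))"
      by (rule foldl_G) (use assms eq in \<open>auto dest: VD\<close>)
    also have "fst x + 1 + deg (P @ Q) = deg xs + 1" using eq by simp
    finally show "sg (fst x * deg P) (p (nest (fst (snd x)) (P @ Q))) \<in> A (deg xs + 1)"
      by (intro sg_in p_A)
  qed (use A(1) in \<open>auto intro: subspace_add\<close>)
  moreover have "fst (l (map snd xs)) \<in> H (deg xs + 1 + 1)"
  proof (cases "length xs = 2")
    case True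
    then obtain x y where xs: "xs = [x, y]" by (auto simp: length_Suc_conv numeral_2_eq_2)
    have *: "fst (snd x) \<in> H (fst x + 1)" "fst (snd y) \<in> H (fst y + 1)" using assms xs by (auto dest: VD)
    hence "br (tau (fst (snd x))) (fst (snd y)) \<in> H (fst x + 1 + (fst y + 1))"
      by (intro br_H) (auto simp: tau_G[OF H_G] sg_in)
    thus ?thesis by (simp add: l_def xs algebra_simps)
  qed (simp add: l_def)
  ultimately show ?thesis by (simp add: V_def mem_Times_iff)
qed

text \<open>The Jacobi identity with \<open>[h, h'] = 0\<close>. Here the commutativity of
  \<open>A\<close> turns iterated brackets into graded symmetric functions of the elements of
  \<open>A\<close>.\<close>

lemma br_swap:
  assumes "u \<in> G n" "h \<in> A a" "h' \<in> A b"
  shows "br (br u h) h' = sg (a * b) (br (br u h') h)"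
  unfolding jacobi[OF assms(1) A_G[OF assms(2)] A_G[OF assms(3)]] br_A[OF assms(2,3)]
  using in_C[OF assms(1)] by simp

lemma foldl_swap:
  assumes "f \<in> G n" "valid P" "valid Q" "snd x \<in> V (fst x)" "snd y \<in> V (fst y)"
  shows "nest f (P @ x # y # Q) =
    sg (fst x * fst y) (nest f (P @ y # x # Q))"
proof -
  let ?u = "nest f P"
  have u: "?u \<in> G (n + deg P)" by (rule foldl_G) fact+
  have xy: "snd (snd x) \<in> A (fst x)" "snd (snd y) \<in> A (fst y)" using assms by (auto dest: VD)
  have C': "?u \<in> C" "snd (snd x) \<in> C" "snd (snd y) \<in> C" using u xy by (auto intro: in_C A_G)
  show ?thesis
    using br_swap[OF u xy] valid_snd_C[OF assms(3)] C' by (simp add: foldl_sg_head br_C)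
qed

text \<open>In the first component, antisymmetry of the bracket becomes graded symmetry through the
  shift and the factor \<open>tau\<close>. In the second, a distinguished entry elsewhere leaves an
  application of \<open>foldl_swap\<close>; if it is \<open>x\<close> or \<open>y\<close>, the
  nested brackets coincide and only the signs of moving it to the front differ.\<close>

lemma l_swap:
  assumes "valid (P @ x # y # Q)"
  shows "l (map snd (P @ x # y # Q)) = sg (fst x * fst y) (l (map snd (P @ y # x # Q)))"
proof -
  have xy: "snd x \<in> V (fst x)" "snd y \<in> V (fst y)" and val: "valid P" "valid Q" using assms by auto
  have "fst (l (map snd (P @ x # y # Q))) = sg (fst x * fst y) (fst (l (map snd (P @ y # x # Q))))"
  proof (cases "P = [] \<and> Q = []")
    case True
    let ?f = "fst (snd x)" and ?g = "fst (snd y)"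
    have fg: "?f \<in> G (fst x + 1)" "?g \<in> G (fst y + 1)" using xy by (auto dest: VD)
    have fgC: "?f \<in> C" "?g \<in> C" using fg by (auto intro: in_C)
    have "br (tau ?f) ?g = sg (fst x + 1) (- sg ((fst x + 1) * (fst y + 1)) (br ?g ?f))"
      unfolding tau_G[OF fg(1)] br_sg(1)[OF fgC] by (rule arg_cong[OF antisym[OF fg]])
    also have "\<dots> = sg (fst x * fst y) (br (tau ?g) ?f)"
      unfolding tau_G[OF fg(2)] br_sg(1)[OF fgC(2,1)]
      by (cases "even (fst x)"; cases "even (fst y)") (simp_all add: sg_def)
    finally show ?thesis using True by (simp add: l_def)
  qed (auto simp: l_def)
  moreover have "snd (l (map snd (P @ x # y # Q))) = sg (fst x * fst y) (snd (l (map snd (P @ y # x # Q))))"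
  proof -
    let ?t = "\<lambda>P x Q. sg (fst x * deg P) (p (nest (fst (snd x)) (P @ Q)))"
    have fG: "fst (snd z) \<in> G (fst z + 1)" if "snd z \<in> V (fst z)" for z using that by (rule VD)
    have pC: "nest (fst (snd z)) R \<in> C" if "snd z \<in> V (fst z)" "valid R" for z R
      using in_C[OF foldl_G[OF fG[OF that(1)] that(2)]] .
    have "slot_sum ?t [] (P @ x # y # Q) = sg (fst x * fst y) (slot_sum ?t [] (P @ y # x # Q))"
    proof (rule slot_sum_swap)
      fix R z B assume "[] @ P = R @ z # B"
      hence v: "valid R" "snd z \<in> V (fst z)" "valid B" using val by auto
      have "nest (fst (snd z)) ((R @ B) @ x # y # Q) =
          sg (fst x * fst y) (nest (fst (snd z)) ((R @ B) @ y # x # Q))"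
        by (rule foldl_swap[OF fG]) (use v val xy in simp_all)
      moreover have "nest (fst (snd z)) (R @ B @ y # x # Q) \<in> C"
        by (rule pC) (use v val xy in simp_all)
      ultimately show "?t R z (B @ x # y # Q) = sg (fst x * fst y) (?t R z (B @ y # x # Q))"
        by (simp only: append_assoc p_sg sg_sg add.commute)
    next
      show "?t ([] @ P) x (y # Q) = sg (fst x * fst y) (?t ([] @ P @ [y]) x Q)"
        by (simp add: sg_sg) (rule sg_cong, simp add: algebra_simps)
      show "?t ([] @ P @ [x]) y Q = sg (fst x * fst y) (?t ([] @ P) y (x # Q))"
        by (simp add: sg_sg algebra_simps)
    next
      fix R z B assume "Q = R @ z # B"
      hence v: "valid R" "snd z \<in> V (fst z)" "valid B" using val by auto
      have "nest (fst (snd z)) (P @ x # y # R @ B) =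
          sg (fst x * fst y) (nest (fst (snd z)) (P @ y # x # R @ B))"
        by (rule foldl_swap[OF fG]) (use v val xy in simp_all)
      moreover have "nest (fst (snd z)) (P @ y # x # R @ B) \<in> C"
        by (rule pC) (use v val xy in simp_all)
      ultimately show "?t ([] @ P @ x # y # R) z B = sg (fst x * fst y) (?t ([] @ P @ y # x # R) z B)"
        by (simp add: p_sg sg_sg algebra_simps del: map_append foldl_append list.map)
    qed
    moreover have yx: "valid (P @ y # x # Q)" using assms by auto
    ultimately show ?thesis by (simp only: slot_sum_valid[OF assms] slot_sum_valid[OF yx])
  qed
  ultimately show ?thesis by (simp add: sg_def prod_eq_iff)
qed

section \<open>The Leibniz rule and the projection\<close>

lemma nest_C: "f \<in> C \<Longrightarrow> valid Q \<Longrightarrow> nest f Q \<in> C"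
  using valid_snd_C by (intro foldl_C)

text \<open>By the Jacobi identity, bracketing with \<open>h\<close> on the right is a graded
  derivation, so each entry of \<open>Q\<close> acts either on \<open>f\<close> or on
  \<open>g\<close>. Those in \<open>S\<close> have to pass \<open>g\<close>, hence the exponent
  \<open>b * deg S\<close>.\<close>

lemma nest_br:
  assumes "f \<in> G a" "g \<in> G b" "valid Q"
  shows "nest (br f g) Q = unshuffle_sum Q (\<lambda>S T. sg (b * deg S) (br (nest f S) (nest g T)))"
  using assms
proof (induction Q arbitrary: f g a b)
  case (Cons z Q)
  let ?h = "snd (snd z)"
  have z: "?h \<in> G (fst z)" and Q: "valid Q" using Cons.prems by (auto dest: VD)
  have gh: "br g ?h \<in> G (b + fst z)" and fh: "br f ?h \<in> G (a + fst z)"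
    using Cons.prems z by (auto intro: br_G)
  have CC: "f \<in> C" "g \<in> C" "?h \<in> C" using Cons.prems z by (auto intro: in_C)
  have "nest (br f g) (z # Q) = nest (br f (br g ?h) + sg (b * fst z) (br (br f ?h) g)) Q"
    using jacobi[OF Cons.prems(1,2) z] by (simp only: list.map foldl_Cons comp_apply)
  also have "\<dots> = nest (br f (br g ?h)) Q + sg (b * fst z) (nest (br (br f ?h) g) Q)"
    using CC valid_snd_C[OF Q] by (simp only: foldl_add_head foldl_sg_head br_C sg_in)
  also have "nest (br f (br g ?h)) Q = unshuffle_sum Q (\<lambda>S T. sg ((b + fst z) * deg S) (br (nest f S) (nest (br g ?h) T)))"
    by (rule Cons.IH) fact+
  also have "nest (br (br f ?h) g) Q = unshuffle_sum Q (\<lambda>S T. sg (b * deg S) (br (nest (br f ?h) S) (nest g T)))"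
    by (rule Cons.IH) fact+
  finally show ?case
    by (simp add: sg_sg algebra_simps comp_def flip: unshuffle_sum_sg)
qed simp

text \<open>An iteration of \<open>br_swap\<close>, which moves \<open>v\<close> past all of
  \<open>S\<close>.\<close>

lemma nest_br_A:
  assumes "f \<in> G n" "v \<in> A k" "valid S"
  shows "nest (br f v) S = sg (k * deg S) (br (nest f S) v)"
  using assms(1,3)
proof (induction S arbitrary: f n)
  case (Cons z S)
  let ?h = "snd (snd z)"
  have z: "?h \<in> A (fst z)" and S: "valid S" using Cons.prems by (auto dest: VD)
  have fh: "br f ?h \<in> G (n + fst z)" using Cons.prems z by (auto intro: br_G A_G)
  have CC: "f \<in> C" "v \<in> C" "?h \<in> C" using Cons.prems z assms(2) by (auto intro: in_C A_G)
  have "nest (br f v) (z # S) = nest (sg (k * fst z) (br (br f ?h) v)) S"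
    using br_swap[OF Cons.prems(1) assms(2) z] by (simp only: list.map foldl_Cons comp_apply)
  also have "\<dots> = sg (k * fst z) (nest (br (br f ?h) v) S)"
    using CC valid_snd_C[OF S] by (simp only: foldl_sg_head br_C)
  also have "\<dots> = sg (k * fst z) (sg (k * deg S) (br (nest (br f ?h) S) v))"
    by (simp only: Cons.IH[OF fh S])
  finally show ?case by (simp add: sg_sg algebra_simps comp_def)
qed simp

lemma p_p: "x \<in> G n \<Longrightarrow> p (p x) = p x"
  using p_A p_id by blast

text \<open>Write \<open>x = x' + p x\<close> and \<open>y = y' + p y\<close> with \<open>x'\<close>
  and \<open>y'\<close> in the kernel of \<open>p\<close>. Of the four resulting brackets,
  \<open>[x', y']\<close> is killed by \<open>p\<close>, and \<open>[p x, p y]\<close> vanishes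
  because \<open>A\<close> is abelian.\<close>

lemma p_br:
  assumes x: "x \<in> G a" and y: "y \<in> G b"
  shows "p (br x y) = p (br (p x) y) + p (br x (p y))"
proof -
  have px: "p x \<in> A a" and py: "p y \<in> A b" using x y p_A by auto
  define x' y' where "x' = x - p x" and "y' = y - p y"
  have x': "x' \<in> G a" and y': "y' \<in> G b"
    using x y px py G by (auto simp: x'_def y'_def intro: subspace_diff A_G)
  have CC: "x' \<in> C" "y' \<in> C" "p x \<in> C" "p y \<in> C"
    using x' y' px py by (auto intro: in_C A_G)
  have "p (x' + p x) = p x' + p (p x)" "p (y' + p y) = p y' + p (p y)"
    using CC by (auto intro: p_add)
  hence "p x' = 0" "p y' = 0" using p_p[OF x] p_p[OF y] by (simp_all add: x'_def y'_def)
  hence "p (br x' y') = 0" by (rule p_kernel[OF x' y'])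
  moreover have "br (p x) (p y) = 0" using br_A[OF px py] .
  moreover have "x = x' + p x" "y = y' + p y" by (simp_all add: x'_def y'_def)
  ultimately show ?thesis
    using CC by (metis (no_types, lifting) add.left_neutral add.right_neutral add_C br_C br_add p_add)
qed

section \<open>The generalised Jacobi identities\<close>

lemma l_zero_entry:
  assumes "0 \<in> set xs" "set xs \<subseteq> C \<times> C"
  shows "l xs = 0"
proof -
  obtain P Q where "xs = P @ 0 # Q" using assms(1) by (meson split_list)
  thus ?thesis
    using l_lin[of P Q 0 0 1] assms(2) by (simp add: prod_eq_iff zero_prod_def)
qed

lemma l_slot_add:
  assumes "valid (P @ (d, x) # Q)" "y \<in> V d"
  shows "l (map snd (P @ (d, x + y) # Q)) = l (map snd (P @ (d, x) # Q)) + l (map snd (P @ (d, y) # Q))"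
  using l_lin[of "map snd P" "map snd Q" x y 1] valid_C[of P] valid_C[of Q] assms V_C[of x d] V_C[of y d]
  by (simp add: prod_eq_iff plus_prod_def)

text \<open>Only the first slot contributes, since every other entry has head 0.\<close>

lemma l_single:
  assumes f: "f \<in> G n" and hs: "set hs \<subseteq> C"
  shows "l ((f, 0) # map (Pair 0) hs) = (0, p (foldl br f hs))"
proof -
  have fC: "f \<in> C" using in_C[OF f] .
  have s: "snd \<circ> Pair (0::'v) = (\<lambda>x. x)" by (simp add: comp_def)
  have "slot_sum l_term [(f, 0)] (map (Pair 0) hs) = 0"
  proof (rule slot_sum_eq_0)
    fix P x Q assume eq: "map (Pair (0::'v)) hs = P @ x # Q"
    have "set (P @ x # Q) \<subseteq> {0} \<times> C" unfolding eq[symmetric] using hs by auto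
    hence "fst x = 0" "set (map snd P) \<subseteq> C" "set (map (tau \<circ> snd) P) \<subseteq> C" "set (map snd Q) \<subseteq> C"
      by (auto simp: tau_C)
    thus "l_term ([(f, 0)] @ P) x Q = 0" by (simp add: l_term_def)
  qed
  moreover have "l_term [] (f, 0) (map (Pair 0) hs) = p (foldl br f hs)"
    using hs by (simp add: l_term_def parity[OF f] s)
  moreover have "fst (l ((f, 0) # map (Pair 0) hs)) = 0"
    using fC hs by (cases hs) (auto simp: l_def tau_C)
  ultimately show ?thesis by (simp add: l_def prod_eq_iff)
qed

text \<open>The left-hand side of the generalised Jacobi identity. The split with
  \<open>S = []\<close> is included; on homogeneous arguments it contributes 0, because
  \<open>l [] = 0\<close>.\<close>

definition jacobiator :: "(int \<times> 'v \<times> 'v) list \<Rightarrow> 'v \<times> 'v" where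
  "jacobiator xs = unshuffle_sum xs (\<lambda>S T. l (l (map snd S) # map snd T))"

lemma l_sg_head:
  assumes "u \<in> C \<times> C" "set xs \<subseteq> C \<times> C"
  shows "l (sg n u # xs) = sg n (l (u # xs))"
proof -
  have z: "(0, 0) \<in> C \<times> C" by simp
  have "l ((0, 0) # xs) = 0"
    by (rule l_zero_entry) (use assms in \<open>auto simp: zero_prod_def\<close>)
  thus ?thesis
    using l_lin[of "[]" xs u "(0, 0)" "- 1"] assms z
    by (auto simp: sg_def uminus_prod_def prod_eq_iff zero_prod_def)
qed

lemma unshuffle_valid:
  assumes "mset S + mset T = mset xs" "valid xs"
  shows "valid S" "valid T"
  using valid_mset[of "S @ T" xs] assms by auto

lemma jacobiator_swap:
  assumes "valid (P @ x # y # Q)"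
  shows "jacobiator (P @ x # y # Q) = sg (fst x * fst y) (jacobiator (P @ y # x # Q))"
  unfolding jacobiator_def
proof (rule unshuffle_sum_swap)
  fix S S' T assume "mset S + mset S' + mset T = mset P + mset Q"
  hence v: "valid S" "valid S'" "valid T" using valid_mset[of "S @ S' @ T" "P @ Q"] assms by (auto simp: ac_simps)
  have "l (map snd (S @ y # x # S')) \<in> C \<times> C"
    by (rule V_C[OF l_V]) (use v assms in simp)
  moreover have "l (map snd (S @ x # y # S')) = sg (fst x * fst y) (l (map snd (S @ y # x # S')))"
    by (rule l_swap) (use v assms in simp)
  ultimately show "l (l (map snd (S @ x # y # S')) # map snd T) =
      sg (fst x * fst y) (l (l (map snd (S @ y # x # S')) # map snd T))"
    by (simp only: l_sg_head valid_C[OF v(3)])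
next
  fix S T T' assume "mset S + mset T + mset T' = mset P + mset Q"
  hence v: "valid S" "valid T" "valid T'" using valid_mset[of "S @ T @ T'" "P @ Q"] assms by (auto simp: ac_simps)
  \<comment> \<open>The inner value enters as an ordinary entry, tagged with its degree
    \<open>deg S + 1\<close>, so that graded symmetry of the outer operation applies to the entries
    behind it.\<close>
  let ?u = "(deg S + 1, l (map snd S))"
  have "l (map snd ((?u # T) @ x # y # T')) = sg (fst x * fst y) (l (map snd ((?u # T) @ y # x # T')))"
    by (rule l_swap) (use v assms l_V in simp)
  thus "l (l (map snd S) # map snd (T @ x # y # T')) =
      sg (fst x * fst y) (l (l (map snd S) # map snd (T @ y # x # T')))"
    by simp
qed

text \<open>This reduces arbitrary arguments to pure ones, an entry \<open>(f, h)\<close> being the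
  sum of \<open>(f, 0)\<close> and \<open>(0, h)\<close>.\<close>

lemma jacobiator_slot_add:
  assumes "valid (P @ (d, x) # Q)" "y \<in> V d"
  shows "jacobiator (P @ (d, x + y) # Q) = jacobiator (P @ (d, x) # Q) + jacobiator (P @ (d, y) # Q)"
  unfolding jacobiator_def
proof (rule unshuffle_sum_slot_add)
  fix S S' T assume "mset S + mset S' + mset T = mset P + mset Q"
  hence v: "valid S" "valid S'" "valid T" using valid_mset[of "S @ S' @ T" "P @ Q"] assms by (auto simp: ac_simps)
  let ?d = "deg (S @ (d, x) # S') + 1"
  have 1: "l (map snd (S @ (d, x) # S')) \<in> V ?d" "l (map snd (S @ (d, y) # S')) \<in> V ?d"
    using l_V[of "S @ (d, x) # S'"] l_V[of "S @ (d, y) # S'"] v assms by auto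
  have 2: "l (map snd (S @ (d, x + y) # S')) = l (map snd (S @ (d, x) # S')) + l (map snd (S @ (d, y) # S'))"
    by (rule l_slot_add) (use v assms in simp_all)
  show "l (l (map snd (S @ (d, x + y) # S')) # map snd T) =
      l (l (map snd (S @ (d, x) # S')) # map snd T) + l (l (map snd (S @ (d, y) # S')) # map snd T)"
    unfolding 2 using l_slot_add[of "[]" ?d _ T] 1 v by simp
next
  fix S T T' assume "mset S + mset T + mset T' = mset P + mset Q"
  hence v: "valid S" "valid T" "valid T'" using valid_mset[of "S @ T @ T'" "P @ Q"] assms by (auto simp: ac_simps)
  show "l (l (map snd S) # map snd (T @ (d, x + y) # T')) =
      l (l (map snd S) # map snd (T @ (d, x) # T')) + l (l (map snd S) # map snd (T @ (d, y) # T'))"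
    using l_slot_add[of "(deg S + 1, l (map snd S)) # T" d x T' y] v assms l_V by simp
qed

definition pure :: "(int \<times> 'v \<times> 'v) list \<Rightarrow> bool" where
  "pure xs \<longleftrightarrow> (\<forall>z\<in>set xs. fst (snd z) = 0 \<or> snd (snd z) = 0)"

text \<open>Zero first components are not counted, so an entry equal to 0 is treated as one from
  \<open>A\<close>.\<close>

definition cnt :: "(int \<times> 'v \<times> 'v) list \<Rightarrow> nat" where
  "cnt xs = size {#z \<in># mset xs. fst (snd z) \<noteq> 0#}"

lemma cnt_simps [simp]: "cnt [] = 0" "cnt (x # xs) = (if fst (snd x) \<noteq> 0 then 1 else 0) + cnt xs"
  "cnt (xs @ ys) = cnt xs + cnt ys"
  by (simp_all add: cnt_def)

lemma cnt_mset: "mset S + mset T = mset xs \<Longrightarrow> cnt xs = cnt S + cnt T"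
  unfolding cnt_def by (metis filter_union_mset size_union)

lemma cnt_eq_0: "cnt xs = 0 \<longleftrightarrow> (\<forall>z\<in>set xs. fst (snd z) = 0)"
  by (induction xs) auto

lemma cnt_le_length: "cnt xs \<le> length xs"
  unfolding cnt_def by (metis size_filter_mset_lesseq size_mset)

lemma snd_l_eq_0:
  assumes "valid xs"
    and "\<And>P x Q. xs = P @ x # Q \<Longrightarrow> fst (snd x) = 0 \<or> (\<exists>z\<in>set (P @ Q). snd (snd z) = 0)"
  shows "snd (l (map snd xs)) = 0"
  unfolding slot_sum_valid[OF assms(1)]
proof (rule slot_sum_eq_0, unfold append_Nil)
  fix P x Q assume eq: "xs = P @ x # Q"
  hence v: "valid (P @ Q)" "fst (snd x) \<in> C" using assms(1) by (auto dest: VD)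
  have "nest (fst (snd x)) (P @ Q) = 0"
    using assms(2)[OF eq]
  proof
    assume "\<exists>z\<in>set (P @ Q). snd (snd z) = 0"
    hence "0 \<in> set (map (snd \<circ> snd) (P @ Q))" by (auto simp: image_iff)
    thus ?thesis by (intro foldl_zero_slot valid_snd_C v)
  qed (use valid_snd_C[OF v(1)] in \<open>simp del: map_append foldl_append\<close>)
  thus "sg (fst x * deg P) (p (nest (fst (snd x)) (P @ Q))) = 0" by simp
qed

lemma fst_l_eq_0:
  assumes "valid xs" and "length xs \<noteq> 2 \<or> cnt xs \<le> 1"
  shows "fst (l (map snd xs)) = 0"
proof (cases "length xs = 2")
  case True
  then obtain x y where xs: "xs = [x, y]" by (auto simp: length_Suc_conv numeral_2_eq_2)
  thus ?thesis using assms by (auto simp: l_def split: if_splits dest: VD intro!: br_0 tau_C)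
qed (simp add: l_def)

lemma l_cnt_0:
  assumes "valid xs" "cnt xs = 0"
  shows "l (map snd xs) = 0"
  using fst_l_eq_0[OF assms(1)] snd_l_eq_0[OF assms(1)] assms(2)
  by (auto simp: prod_eq_iff cnt_eq_0)

text \<open>Whichever entry is distinguished, another one from \<open>H\<close> remains; by purity
  its second component is 0 and annihilates the nested bracket.\<close>

lemma snd_l_cnt_ge_2:
  assumes "valid xs" "pure xs" "cnt xs \<ge> 2"
  shows "snd (l (map snd xs)) = 0"
proof (rule snd_l_eq_0[OF assms(1)])
  fix P x Q assume eq: "xs = P @ x # Q"
  hence "cnt (P @ Q) \<noteq> 0" using assms(3) by (auto split: if_splits)
  then obtain z where "z \<in> set (P @ Q)" "fst (snd z) \<noteq> 0" by (auto simp: cnt_eq_0 simp del: cnt_simps)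
  thus "fst (snd x) = 0 \<or> (\<exists>z\<in>set (P @ Q). snd (snd z) = 0)"
    using assms(2) eq by (auto simp: pure_def)
qed

lemma unshuffle_sum_Pair_0: "unshuffle_sum xs (\<lambda>S T. (0, F S T)) = (0, unshuffle_sum xs F)"
  by (rule unshuffle_sum_hom(2)[of xs F UNIV "Pair 0", symmetric]) simp_all

lemma unshuffle_sum_uminus: "unshuffle_sum xs (\<lambda>S T. - F S T) = - unshuffle_sum xs F"
  using unshuffle_sum_hom(2)[of xs F UNIV uminus] by simp

lemma l_single_valid:
  assumes "f \<in> G n" "valid T" "cnt T = 0"
  shows "l ((f, 0) # map snd T) = (0, p (nest f T))"
proof -
  have "map snd T = map (Pair 0) (map (snd \<circ> snd) T)"
    using assms(3) by (auto simp: cnt_eq_0 prod_eq_iff)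
  thus ?thesis by (simp only: l_single[OF assms(1) valid_snd_C[OF assms(2)]])
qed

text \<open>The Leibniz rule for iterated brackets with elements of the abelian subalgebra, combined with
  the splitting \<open>p_br\<close>.\<close>

lemma p_nest_br:
  assumes f: "f \<in> G a" and g: "g \<in> G b" and Q: "valid Q"
  shows "p (nest (br f g) Q) =
    unshuffle_sum Q (\<lambda>S T. p (nest (br f (p (nest g S))) T)) -
    sg (a * b) (unshuffle_sum Q (\<lambda>S T. p (nest (br g (p (nest f S))) T)))"
proof -
  have fC: "f \<in> C" and gC: "g \<in> C" using f g in_C by auto
  have "p (nest (br f g) Q) = p (unshuffle_sum Q (\<lambda>S T. sg (b * deg S) (br (nest f S) (nest g T))))"
    by (simp only: nest_br[OF assms])
  also have "\<dots> = unshuffle_sum Q (\<lambda>S T. p (sg (b * deg S) (br (nest f S) (nest g T))))"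
    by (rule unshuffle_sum_hom(2)[where C = C])
       (use C fC gC Q in \<open>auto intro!: sg_in br_C nest_C p_add simp: subspace_add subspace_neg dest: unshuffle_valid\<close>)
  also have "\<dots> = unshuffle_sum Q (\<lambda>S T. sg (deg S * deg T) (p (nest (br f (p (nest g T))) S)) +
      - sg (a * b) (p (nest (br g (p (nest f S))) T)))"
  proof (rule unshuffle_sum_cong)
    fix S T assume "mset S + mset T = mset Q"
    hence v: "valid S" "valid T" using Q by (auto dest: unshuffle_valid)
    have G': "nest f S \<in> G (a + deg S)" "nest g T \<in> G (b + deg T)" using f g v by (auto intro: foldl_G)
    have A': "p (nest f S) \<in> A (a + deg S)" "p (nest g T) \<in> A (b + deg T)" using G' p_A by auto
    have CC: "nest f S \<in> C" "nest g T \<in> C" "p (nest f S) \<in> C" "p (nest g T) \<in> C"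
      using G' A' by (auto intro: in_C A_G)
    \<comment> \<open>The projected factor lies in \<open>A\<close>, so \<open>nest_br_A\<close> can
      move it in front of the other entries; this gives both summands the shape of a composite of
      two operations.\<close>
    have 1: "br (nest f S) (p (nest g T)) = sg ((b + deg T) * deg S) (nest (br f (p (nest g T))) S)"
      using nest_br_A[OF f A'(2) v(1)] by (simp add: sg_sg) (simp add: sg_def)
    have "br (p (nest f S)) (nest g T) = - sg ((a + deg S) * (b + deg T)) (br (nest g T) (p (nest f S)))"
      by (rule antisym[OF A_G[OF A'(1)] G'(2)])
    also have "br (nest g T) (p (nest f S)) = sg ((a + deg S) * deg T) (nest (br g (p (nest f S))) T)"
      using nest_br_A[OF g A'(1) v(2)] by (simp add: sg_sg) (simp add: sg_def)
    also have "- sg ((a + deg S) * (b + deg T)) (sg ((a + deg S) * deg T) (nest (br g (p (nest f S))) T)) =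
      sg ((a + deg S) * b + 1) (nest (br g (p (nest f S))) T)"
      by (simp add: sg_def)
    finally have 2: "br (p (nest f S)) (nest g T) = sg ((a + deg S) * b + 1) (nest (br g (p (nest f S))) T)" .
    have C1: "nest (br f (p (nest g T))) S \<in> C" "nest (br g (p (nest f S))) T \<in> C"
      using CC fC gC v by (auto intro!: nest_C br_C)
    have "p (sg (b * deg S) (br (nest f S) (nest g T))) = sg (b * deg S) (p (br (nest f S) (nest g T)))"
      using CC by (intro p_sg br_C)
    also have "\<dots> = sg (b * deg S) (sg ((a + deg S) * b + 1) (p (nest (br g (p (nest f S))) T)) +
      sg ((b + deg T) * deg S) (p (nest (br f (p (nest g T))) S)))"
      by (simp only: p_br[OF G'] 1 2 p_sg C1)
    also have "\<dots> = sg (deg S * deg T) (p (nest (br f (p (nest g T))) S)) +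
      - sg (a * b) (p (nest (br g (p (nest f S))) T))"
      by (cases "even b"; cases "even (deg S)"; cases "even a") (simp_all add: sg_def)
    finally show "p (sg (b * deg S) (br (nest f S) (nest g T))) = \<dots>" .
  qed
  also have "\<dots> = unshuffle_sum Q (\<lambda>S T. sg (deg S * deg T) (p (nest (br f (p (nest g T))) S))) -
      sg (a * b) (unshuffle_sum Q (\<lambda>S T. p (nest (br g (p (nest f S))) T)))"
    unfolding unshuffle_sum_add unshuffle_sum_uminus unshuffle_sum_sg by simp
  \<comment> \<open>In this summand the two halves have the opposite roles; exchanging them absorbs
    the sign.\<close>
  also have "unshuffle_sum Q (\<lambda>S T. sg (deg S * deg T) (p (nest (br f (p (nest g T))) S))) =
      unshuffle_sum Q (\<lambda>S T. p (nest (br f (p (nest g S))) T))"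
    by (rule unshuffle_sum_exchange[symmetric])
  finally show ?thesis .
qed

text \<open>The splits fall into four classes, according to which of \<open>f\<close> and
  \<open>g\<close> are inner arguments. With neither inside, the inner operation vanishes; the other
  three classes sum to \<open>X\<close>, \<open>U\<close> and \<open>W\<close> up to sign, and
  \<open>p_nest_br\<close> is the relation between these.\<close>

lemma jacobiator_two:
  assumes f: "f \<in> H (d + 1)" and g: "g \<in> H (e + 1)" and Q: "valid Q" "cnt Q = 0"
  shows "jacobiator ((d, (f, 0)) # (e, (g, 0)) # Q) = 0"
proof -
  let ?F = "\<lambda>S T. l (l (map snd S) # map snd T)"
  let ?x = "(d, (f, 0))" and ?y = "(e, (g, 0))"
  define U W X where "U = unshuffle_sum Q (\<lambda>S T. p (nest (br g (p (nest f S))) T))"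
    and "W = unshuffle_sum Q (\<lambda>S T. p (nest (br f (p (nest g S))) T))"
    and "X = p (nest (br f g) Q)"
  have fG: "f \<in> G (d + 1)" "f \<in> C" and gG: "g \<in> G (e + 1)" "g \<in> C"
    using f g by (auto intro: H_G in_C[OF H_G])
  have V': "(f, 0) \<in> V d" "(g, 0) \<in> V e" using f g by (simp_all add: V_def)
  have l_pair: "l [(f, 0), (g, 0)] = (sg (d + 1) (br f g), 0)"
  proof -
    have "snd (l (map snd [?x, ?y])) = 0"
      by (rule snd_l_eq_0) (use V' in \<open>auto simp: Cons_eq_append_conv\<close>)
    thus ?thesis using fG gG by (simp add: l_def tau_G br_sg)
  qed
  have split: "valid S" "valid T" "cnt S = 0" "cnt T = 0" if "mset S + mset T = mset Q" for S T
    using that Q cnt_mset[OF that] by (auto dest: unshuffle_valid)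
  have 1: "unshuffle_sum Q (\<lambda>S T. ?F (?x # ?y # S) T) = (0, sg (d + 1) X)"
  proof -
    \<comment> \<open>Two arguments from \<open>H\<close> are combined only by the binary operation,
      so the inner list must consist of \<open>f\<close> and \<open>g\<close> alone.\<close>
    have "unshuffle_sum Q (\<lambda>S T. ?F (?x # ?y # S) T) =
      unshuffle_sum Q (\<lambda>S T. if S = [] then (0, sg (d + 1) (p (nest (br f g) T))) else 0)"
    proof (rule unshuffle_sum_cong)
      fix S T assume "mset S + mset T = mset Q"
      note v = split[OF this]
      show "?F (?x # ?y # S) T = (if S = [] then (0, sg (d + 1) (p (nest (br f g) T))) else 0)"
      proof (cases "S = []")
        case True
        have G': "br f g \<in> G (d + 1 + (e + 1))" using fG gG by (intro br_G)
        have "l ((sg (d + 1) (br f g), 0) # map snd T) = (0, p (nest (sg (d + 1) (br f g)) T))"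
          by (rule l_single_valid) (use G' sg_in v in auto)
        also have "\<dots> = (0, sg (d + 1) (p (nest (br f g) T)))"
          using in_C[OF G'] v by (simp only: foldl_sg_head valid_snd_C p_sg nest_C)
        finally show ?thesis using True l_pair by simp
      next
        case False
        have vS: "valid (?x # ?y # S)" using v V' by simp
        have "snd (l (map snd (?x # ?y # S))) = 0"
        proof (rule snd_l_eq_0[OF vS])
          fix P z R assume "?x # ?y # S = P @ z # R"
          thus "fst (snd z) = 0 \<or> (\<exists>w\<in>set (P @ R). snd (snd w) = 0)"
            using v(3) by (auto simp: Cons_eq_append_conv cnt_eq_0)
        qed
        moreover have "fst (l (map snd (?x # ?y # S))) = 0"
          by (rule fst_l_eq_0[OF vS]) (use False in auto)
        ultimately have "l (map snd (?x # ?y # S)) = 0" by (simp only: prod_eq_iff fst_zero snd_zero)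
        hence "?F (?x # ?y # S) T = l (0 # map snd T)" by (simp only:)
        also have "\<dots> = 0" by (rule l_zero_entry) (use valid_C[OF v(2)] in \<open>auto simp: zero_prod_def\<close>)
        finally show ?thesis using False by (simp only: if_False)
      qed
    qed
    also have "\<dots> = (0, sg (d + 1) X)"
      by (simp add: unshuffle_sum_nil_left[where F = "\<lambda>T. (0, sg (d + 1) (p (nest (br f g) T)))"] X_def)
    finally show ?thesis .
  qed
  have single: "?F ((a, (u, 0)) # S) ((b, (w, 0)) # T) =
      (0, sg ((a + deg S + 1) * b) (p (nest (br w (p (nest u S))) T)))"
    if "mset S + mset T = mset Q" "u \<in> H (a + 1)" "w \<in> H (b + 1)" for S T a b u w
  proof -
    note v = split[OF that(1)]
    have uG: "u \<in> G (a + 1)" and wG: "w \<in> G (b + 1)" using that H_G by auto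
    let ?z = "p (nest u S)"
    have z: "?z \<in> A (a + deg S + 1)" using p_A[OF foldl_G[OF uG v(1)]] by (simp add: ac_simps)
    have lS: "l ((u, 0) # map snd S) = (0, ?z)" by (rule l_single_valid) (use uG v in auto)
    \<comment> \<open>The inner value lies in \<open>A\<close> and stands in front; it is swapped
      with the remaining element of \<open>H\<close>, so that \<open>l_single_valid\<close>
      evaluates the outer operation.\<close>
    have "l (map snd ([] @ (a + deg S + 1, (0, ?z)) # (b, (w, 0)) # T)) =
      sg ((a + deg S + 1) * b) (l (map snd ([] @ (b, (w, 0)) # (a + deg S + 1, (0, ?z)) # T)))"
      using l_swap[of "[]" "(a + deg S + 1, (0, ?z))" "(b, (w, 0))" T] z that v by (simp add: V_def)
    also have "l (map snd ([] @ (b, (w, 0)) # (a + deg S + 1, (0, ?z)) # T)) = (0, p (nest (br w ?z) T))"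
      using l_single_valid[OF wG, of "(a + deg S + 1, (0, ?z)) # T"] v z by (simp add: V_def)
    finally show ?thesis by (simp add: lS sg_Pair comp_def)
  qed
  have 2: "unshuffle_sum Q (\<lambda>S T. sg (e * deg S) (?F (?x # S) (?y # T))) = (0, sg ((d + 1) * e) U)"
    unfolding U_def unshuffle_sum_sg[symmetric] unshuffle_sum_Pair_0[symmetric]
    by (rule unshuffle_sum_cong, subst single[OF _ f g], assumption)
       (simp add: sg_Pair sg_sg, rule sg_cong, simp, blast)
  have 3: "unshuffle_sum Q (\<lambda>S T. sg (d * (e + deg S)) (?F (?y # S) (?x # T))) = (0, sg d W)"
    unfolding W_def unshuffle_sum_sg[symmetric] unshuffle_sum_Pair_0[symmetric]
    by (rule unshuffle_sum_cong, subst single[OF _ g f], assumption)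
       (simp add: sg_Pair sg_sg, rule sg_cong, simp, blast)
  have 4: "unshuffle_sum Q (\<lambda>S T. sg (e * deg S) (sg (d * deg S) (?F S (?x # ?y # T)))) = 0"
  proof (rule unshuffle_sum_eq_0)
    fix S T assume "mset S + mset T = mset Q"
    note v = split[OF this]
    have "l (map snd S) = 0" using v by (intro l_cnt_0)
    moreover have "l (0 # map snd (?x # ?y # T)) = 0"
      by (rule l_zero_entry) (use valid_C[OF v(2)] fG gG in \<open>auto simp: zero_prod_def\<close>)
    ultimately show "sg (e * deg S) (sg (d * deg S) (?F S (?x # ?y # T))) = 0" by simp
  qed
  have "jacobiator (?x # ?y # Q) = (0, sg (d + 1) X) + (0, sg ((d + 1) * e) U) + (0, sg d W)"
    unfolding jacobiator_def using 1 2 3 4 by (simp add: add.assoc)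
  also have "X = W - sg ((d + 1) * (e + 1)) U"
    unfolding X_def W_def U_def by (rule p_nest_br[OF fG(1) gG(1) Q(1)])
  finally show ?thesis
    by (cases "even d"; cases "even e") (simp_all add: sg_def zero_prod_def)
qed

text \<open>On arguments from \<open>H\<close> the unary operation vanishes by \<open>p\<close>, and
  the ternary one because all second components are 0. The three splits with two inner arguments
  remain and give the Jacobi identity of the bracket, up to the signs of the shift.\<close>

lemma jacobiator_three:
  assumes f: "f \<in> H (d + 1)" and g: "g \<in> H (e + 1)" and k: "k \<in> H (n + 1)"
  shows "jacobiator [(d, (f, 0)), (e, (g, 0)), (n, (k, 0))] = 0"
proof -
  have l1: "l [(u, 0)] = 0" if "u \<in> H a" for u a
    using l_single[OF H_G[OF that], of "[]"] p_H[OF that] by (simp add: zero_prod_def)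
  have l2: "l [(u, 0), (w, 0)] = (sg a (br u w), 0)" if "u \<in> H a" "w \<in> H b" for u w a b
  proof -
    have "u \<in> G a" "w \<in> G b" "u \<in> C" "w \<in> C" using that by (auto intro: H_G in_C[OF H_G])
    thus ?thesis by (simp add: l_def l_term_def tau_G br_sg parity parity_C foldl_C)
  qed
  have l0: "l (0 # xs) = 0" if "set xs \<subseteq> C \<times> C" for xs
    by (rule l_zero_entry) (use that in \<open>auto simp: zero_prod_def\<close>)
  have l3: "l [(f, 0), (g, 0), (k, 0)] = 0"
  proof -
    have "snd (l (map snd [(d, (f, 0)), (e, (g, 0)), (n, (k, 0))])) = 0"
      by (rule snd_l_eq_0) (use assms in \<open>auto simp: Cons_eq_append_conv V_def\<close>)
    thus ?thesis by (simp add: l_def prod_eq_iff)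
  qed
  have l00: "l [] = 0" by (simp add: l_def zero_prod_def)
  have CC: "f \<in> C" "g \<in> C" "k \<in> C" using assms by (auto intro: in_C[OF H_G])
  have ll: "l [(sg a (br u w), 0), (v, 0)] = (sg (a + b + a) (br (br u w) v), 0)"
    if "u \<in> H a" "w \<in> H b" "v \<in> H c" for u v w a b c
  proof -
    have "u \<in> C" "w \<in> C" "v \<in> C" using that by (auto intro: in_C[OF H_G])
    thus ?thesis
      using l2[of "sg a (br u w)" "a + b" v c] that br_H[of u a w b] sg_in(3)
      by (simp add: br_sg br_C sg_sg)
  qed
  \<comment> \<open>Antisymmetry rewrites \<open>[f, [g, k]]\<close> into the form
    \<open>[[g, k], f]\<close> in which it occurs.\<close>
  have J: "br (br f g) k = - sg ((d + 1) * ((e + 1) + (n + 1))) (br (br g k) f) +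
      sg ((e + 1) * (n + 1)) (br (br f k) g)"
    using jacobi[OF H_G[OF f] H_G[OF g] H_G[OF k]] antisym[OF H_G[OF f] br_G[OF H_G[OF g] H_G[OF k]]] by simp
  have "jacobiator [(d, (f, 0)), (e, (g, 0)), (n, (k, 0))] =
    (sg (e + 1) (br (br f g) k) + sg (e * n) (sg (n + 1) (br (br f k) g)) +
     sg (d * (e + n)) (sg (n + 1) (br (br g k) f)), 0)"
    using assms CC
    by (simp add: jacobiator_def l00 l1 l0 l2 ll l3) (simp add: sg_def)
  also have "\<dots> = 0"
    unfolding J by (cases "even d"; cases "even e"; cases "even n") (simp_all add: sg_def zero_prod_def)
  finally show ?thesis .
qed

text \<open>A nonzero inner value either comes from one argument in \<open>H\<close> and lies in
  \<open>A\<close>, or is the bracket of exactly two arguments from \<open>H\<close> and lies in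
  \<open>H\<close>. In the first case the outer operation needs exactly one more argument from
  \<open>H\<close>; in the second none, or one and nothing else. This leaves a total count of 2, or
  of 3 among three arguments.\<close>

lemma jacobiator_pure:
  assumes "valid xs" "pure xs"
  shows "jacobiator xs = 0"
proof -
  consider "cnt xs = 2" | "cnt xs = 3" "length xs = 3" | "cnt xs \<noteq> 2" "cnt xs \<noteq> 3 \<or> length xs \<noteq> 3"
    by blast
  thus ?thesis
  proof cases
    case 1
    let ?P = "\<lambda>z. fst (snd z) \<noteq> 0"
    have "length (filter ?P xs) = 2"
      using 1 unfolding cnt_def by (metis mset_filter size_mset)
    then obtain x y where xy: "filter ?P xs = [x, y]" by (auto simp: length_Suc_conv numeral_2_eq_2)
    define Q where "Q = filter (\<lambda>z. \<not> ?P z) xs"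
    have "mset xs = mset (filter ?P xs @ Q)"
      unfolding Q_def by (simp add: mset_filter flip: multiset_partition)
    hence m: "mset xs = mset (x # y # Q)" using xy by simp
    have "?P x" "?P y" "x \<in> set xs" "y \<in> set xs"
      using arg_cong[OF xy, of set] by auto
    moreover from this have "snd (snd x) = 0" "snd (snd y) = 0" using assms(2) by (auto simp: pure_def)
    ultimately obtain d e f g where x: "x = (d, (f, 0))" "y = (e, (g, 0))" "f \<in> H (d + 1)" "g \<in> H (e + 1)"
      using assms(1) by (auto simp: valid_def V_def) (metis prod.collapse mem_Sigma_iff)
    have Q: "valid Q" "cnt Q = 0" using assms(1) by (auto simp: Q_def valid_def cnt_eq_0)
    have "valid xs \<and> jacobiator xs = 0"
    \<comment> \<open>Vanishing of the jacobiator is invariant under adjacent transpositions, so the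
      two arguments from \<open>H\<close> may be moved to the front.\<close>
    proof (rule swap_closed_mset[where Z = "\<lambda>xs. valid xs \<and> jacobiator xs = 0" and xs = "x # y # Q"])
      fix P :: "(int \<times> 'v \<times> 'v) list" and u w R
      assume "valid (P @ u # w # R) \<and> jacobiator (P @ u # w # R) = 0"
      thus "valid (P @ w # u # R) \<and> jacobiator (P @ w # u # R) = 0"
        using jacobiator_swap[of P w u R] by auto
    qed (use m x Q jacobiator_two valid_mset[OF m] assms(1) in auto)
    thus ?thesis ..
  next
    case 2
    then obtain x y z where xs: "xs = [x, y, z]" by (auto simp: length_Suc_conv numeral_3_eq_3)
    have *: "w = (fst w, (fst (snd w), 0))" "fst (snd w) \<in> H (fst w + 1)" if "w \<in> set xs" for w
      using 2 that assms xs by (auto simp: pure_def valid_def V_def prod_eq_iff split: if_splits)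
    have "jacobiator [(fst x, (fst (snd x), 0)), (fst y, (fst (snd y), 0)), (fst z, (fst (snd z), 0))] = 0"
      by (intro jacobiator_three *(2)) (simp_all add: xs)
    thus ?thesis using *(1)[of x] *(1)[of y] *(1)[of z] xs by simp
  next
    case 3
    show ?thesis
      unfolding jacobiator_def
    proof (rule unshuffle_sum_eq_0)
      fix S T assume m: "mset S + mset T = mset xs"
      note v = unshuffle_valid[OF m assms(1)]
      have "set S \<union> set T = set xs" using arg_cong[OF m, of set_mset] by simp
      hence pure: "pure S" "pure T" using assms(2) by (auto simp: pure_def)
      have len: "length S + length T = length xs" using arg_cong[OF m, of size] by simp
      define u where "u = l (map snd S)"
      let ?z = "(deg S + 1, u)"
      have vz: "valid (?z # T)" using l_V[OF v(1)] v(2) by (simp add: u_def)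
      have lz: "l (u # map snd T) = 0" if "u = 0"
        unfolding that by (rule l_zero_entry) (use valid_C[OF v(2)] in \<open>auto simp: zero_prod_def\<close>)
      have pz: "pure (?z # T)" if "fst u = 0 \<or> snd u = 0" using that pure by (simp add: pure_def)
      have l_0: "l (u # map snd T) = 0" if "length T \<noteq> 1" "fst u = 0 \<or> snd u = 0" "cnt (?z # T) \<ge> 2"
        using fst_l_eq_0[OF vz] snd_l_cnt_ge_2[OF vz pz] that by (simp add: prod_eq_iff)
      have bounds: "cnt S \<le> length S" "cnt T \<le> length T" by (rule cnt_le_length)+
      consider "cnt S = 0" | "cnt S = 1" | "cnt S \<ge> 2" by linarith
      hence "l (u # map snd T) = 0"
      proof cases
        case 1
        thus ?thesis using l_cnt_0[OF v(1)] lz by (simp add: u_def)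
      next
        case S: 2
        hence u: "fst u = 0" using fst_l_eq_0[OF v(1)] by (simp add: u_def)
        show ?thesis
        proof (cases "cnt T = 0")
          case True
          thus ?thesis using l_cnt_0[OF vz] u by simp
        next
          case False
          hence "cnt T \<ge> 2" using 3(1) cnt_mset[OF m] S by linarith
          thus ?thesis using bounds u by (intro l_0) auto
        qed
      next
        case S: 3
        hence u: "snd u = 0" using snd_l_cnt_ge_2[OF v(1) pure(1)] by (simp add: u_def)
        show ?thesis
        proof (cases "length S = 2 \<and> fst u \<noteq> 0")
          case True
          hence "cnt S = 2" using S bounds by simp
          hence "cnt T \<ge> 1" "length T \<noteq> 1" using 3 cnt_mset[OF m] True bounds len by auto
          thus ?thesis using True u by (intro l_0) auto
        next
          case False
          hence "fst u = 0" using fst_l_eq_0[OF v(1)] by (auto simp: u_def)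
          thus ?thesis using lz u by (simp add: prod_eq_iff)
        qed
      qed
      thus "l (l (map snd S) # map snd T) = 0" by (simp add: u_def)
    qed
  qed
qed

text \<open>Entries are split into their components one at a time, \<open>P\<close> being the part
  that is already pure.\<close>

lemma jacobiator_eq_0:
  assumes "valid xs"
  shows "jacobiator xs = 0"
proof -
  have "jacobiator (P @ Q) = 0" if "valid (P @ Q)" "pure P" for P Q
    using that
  proof (induction Q arbitrary: P)
    case Nil
    thus ?case using jacobiator_pure by simp
  next
    case (Cons z Q)
    obtain d f h where z: "z = (d, (f, h))" by (cases z) auto
    have V': "(f, 0) \<in> V d" "(0, h) \<in> V d" using Cons.prems z by (auto simp: V_def)
    have "jacobiator ((P @ [(d, y)]) @ Q) = 0" if "y \<in> V d" "fst y = 0 \<or> snd y = 0" for y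
      by (rule Cons.IH) (use that Cons.prems in \<open>auto simp: pure_def\<close>)
    from this[OF V'(1)] this[OF V'(2)]
    have "jacobiator (P @ (d, (f, 0) + (0, h)) # Q) = 0"
      by (subst jacobiator_slot_add) (use Cons.prems V' in auto)
    thus ?case by (simp add: z)
  qed
  from this[of "[]" xs] assms show ?thesis by (simp add: pure_def)
qed

section \<open>The L-infinity structure in terms of degrees and permutations\<close>

abbreviation sc2 :: "'k \<Rightarrow> 'v \<times> 'v \<Rightarrow> 'v \<times> 'v" where
  "sc2 \<equiv> module_prod.scale sc sc"

lemma sc2_eq: "sc2 c x = (sc c (fst x), sc c (snd x))"
  using module_prod.scale_def[of sc sc] module_axioms by (simp add: module_prod_def module_pair_def)

lemma vector_space_sc2: "vector_space sc2"
  by unfold_locales (simp_all add: sc2_eq prod_eq_iff scale_right_distrib scale_left_distrib)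

lemma koszul_sign_sc2: "length ds = n \<Longrightarrow> sc2 (koszul_sign ds \<sigma>) x = sg (inversion_sum ((!) ds) (map \<sigma> [0..<n])) x"
  by (rule koszul_sign_scale[OF vector_space_sc2])

lemma graded_V: "graded_vector_space sc2 V"
proof -
  interpret P: vector_space sc2 by (rule vector_space_sc2)
  have "P.subspace (V d)" for d
    unfolding V_def P.subspace_def
    using H(1)[of "d + 1"] A(1)[of d] by (auto simp: subspace_def sc2_eq zero_prod_def)
  moreover have "x i = 0" if x: "finite I" "\<And>i. i \<in> I \<Longrightarrow> x i \<in> V i" "(\<Sum>i\<in>I. x i) = 0" "i \<in> I" for I x i
  proof -
    have "(\<Sum>i\<in>I. fst (x i)) = 0" "(\<Sum>i\<in>I. snd (x i)) = 0"
      using x(3) by (simp_all flip: fst_sum snd_sum)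
    \<comment> \<open>First components live in degree \<open>i + 1\<close>; the family is reindexed
      accordingly before the independence of the \<open>G i\<close> is applied.\<close>
    hence "(\<Sum>i\<in>(\<lambda>i. i + 1) ` I. fst (x (i - 1))) = 0"
      by (subst sum.reindex) (auto simp: inj_on_def)
    hence "fst (x (i + 1 - 1)) = 0"
      by (rule indep[rotated 2]) (use x(1,2,4) VD(3) in fastforce)+
    moreover have "snd (x i) = 0"
      by (rule indep[OF x(1) _ \<open>(\<Sum>i\<in>I. snd (x i)) = 0\<close> x(4)]) (use x(2) VD(4) in blast)
    ultimately show ?thesis by (simp add: prod_eq_iff)
  qed
  ultimately show ?thesis
    using vector_space_sc2 by (auto simp: graded_vector_space_def)
qed

text \<open>Multilinearity is demanded for non-homogeneous elements as well; inside
  \<open>C \<times> C\<close> it is given by \<open>l_lin\<close>.\<close>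

lemma total_V: "total_space sc2 V \<subseteq> C \<times> C"
proof -
  interpret P: vector_space sc2 by (rule vector_space_sc2)
  have "P.subspace (C \<times> C)"
    unfolding P.subspace_def using C by (auto simp: subspace_def sc2_eq zero_prod_def)
  moreover have "(\<Union>d. V d) \<subseteq> C \<times> C" using V_C by blast
  ultimately show ?thesis unfolding total_space_def by (metis P.span_minimal)
qed

lemma multilinear_l: "multilinear_on sc2 (total_space sc2 V) sc2 k l"
  unfolding multilinear_on_def
proof (intro allI impI)
  fix xs :: "('v \<times> 'v) list" and i
  assume *: "length xs = k \<and> set xs \<subseteq> total_space sc2 V \<and> i < k"
  have PQ: "set (take i xs) \<subseteq> C \<times> C" "set (drop (Suc i) xs) \<subseteq> C \<times> C"
    using * total_V set_take_subset[of i xs] set_drop_subset[of "Suc i" xs] by blast+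
  have upd: "xs[i := x] = take i xs @ x # drop (Suc i) xs" for x
    using * by (simp add: upd_conv_take_nth_drop)
  have lin: "l (xs[i := sc2 c x + y]) = sc2 c (l (xs[i := x])) + l (xs[i := y])"
    if "x \<in> C \<times> C" "y \<in> C \<times> C" for c x y
    using l_lin[OF PQ that, of c] unfolding upd by (simp add: sc2_eq plus_prod_def)
  have "(0, 0) \<in> C \<times> C" by simp
  hence C0: "0 \<in> C \<times> C" by (simp only: zero_prod_def)
  have l0: "l (xs[i := 0]) = 0"
    unfolding upd by (rule l_zero_entry) (use PQ C0 in auto)
  show "(\<forall>x\<in>total_space sc2 V. \<forall>y\<in>total_space sc2 V. l (xs[i := x + y]) = l (xs[i := x]) + l (xs[i := y])) \<and>
      (\<forall>c. \<forall>x\<in>total_space sc2 V. l (xs[i := sc2 c x]) = sc2 c (l (xs[i := x])))"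
  proof (intro conjI ballI allI)
    fix x y assume "x \<in> total_space sc2 V" "y \<in> total_space sc2 V"
    hence "x \<in> C \<times> C" "y \<in> C \<times> C" using total_V by auto
    from lin[OF this, of 1] show "l (xs[i := x + y]) = l (xs[i := x]) + l (xs[i := y])"
      by (simp add: sc2_eq)
  next
    fix c x assume "x \<in> total_space sc2 V"
    hence "x \<in> C \<times> C" using total_V by auto
    from lin[OF this C0, of c] show "l (xs[i := sc2 c x]) = sc2 c (l (xs[i := x]))"
      by (simp add: l0)
  qed
qed

lemma homogeneous_valid:
  assumes "homogeneous_list V ds xs"
  shows "valid (zip ds xs)" "map fst (zip ds xs) = ds" "map snd (zip ds xs) = xs" "length ds = length xs"
  using assms by (auto simp: homogeneous_list_def valid_def list_all2_iff)

lemma l_koszul: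
  assumes "homogeneous_list V ds xs" and \<sigma>: "\<sigma> permutes {..<length xs}"
  shows "l (permute_entries \<sigma> xs) = sc2 (koszul_sign ds \<sigma>) (l xs)"
proof -
  let ?n = "length xs" and ?zs = "zip ds xs"
  note h = homogeneous_valid[OF assms(1)]
  \<comment> \<open>Words of positions take the place of permutations, so that single adjacent swaps
    make sense. The value 0 on words with other letters makes the swap rule hold for all
    words.\<close>
  define F where "F w = (if set w \<subseteq> {..<?n} then l (map ((!) xs) w) else 0)" for w
  have "F (P @ a # b # Q) = sg (ds ! a * ds ! b) (F (P @ b # a # Q))" for P a b Q
  proof (cases "set (P @ a # b # Q) \<subseteq> {..<?n}")
    case True
    let ?g = "(!) ?zs"
    have g: "snd (?g i) = xs ! i" "fst (?g i) = ds ! i" if "i < ?n" for i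
      using that h(4) by simp_all
    have nthV: "snd (?g i) \<in> V (fst (?g i))" if "i < ?n" for i
      using bspec[OF h(1)[unfolded valid_def] nth_mem[of i ?zs]] h(4) that by simp
    have m: "map snd (map ?g w) = map ((!) xs) w" if "set w \<subseteq> {..<?n}" for w
      unfolding map_map comp_def by (rule map_cong) (use that g in auto)
    have True': "set (P @ b # a # Q) \<subseteq> {..<?n}" using True by auto
    have "F (P @ a # b # Q) = l (map snd (map ?g P @ ?g a # ?g b # map ?g Q))"
      using True m[OF True] by (simp only: F_def if_True map_append list.map)
    also have "\<dots> = sg (fst (?g a) * fst (?g b)) (l (map snd (map ?g P @ ?g b # ?g a # map ?g Q)))"
      by (rule l_swap) (use nthV True in \<open>auto simp: valid_def\<close>)
    also have "l (map snd (map ?g P @ ?g b # ?g a # map ?g Q)) = F (P @ b # a # Q)"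
      using True' m[OF True'] by (simp only: F_def if_True map_append list.map)
    finally show ?thesis using g True by simp
  next
    case False
    moreover have "\<not> set (P @ b # a # Q) \<subseteq> {..<?n}" using False by auto
    ultimately show ?thesis by (simp only: F_def if_False sg_zero)
  qed
  from swap_sorted[of F "(!) ds", OF this, of "map \<sigma> [0..<?n]"]
  have "F (map \<sigma> [0..<?n]) = sg (inversion_sum ((!) ds) (map \<sigma> [0..<?n])) (F (sort (map \<sigma> [0..<?n])))" .
  also have "sort (map \<sigma> [0..<?n]) = [0..<?n]"
  proof (rule sorted_distinct_set_unique)
    show "distinct (sort (map \<sigma> [0..<?n]))"
      using inj_on_subset[OF permutes_inj[OF \<sigma>]] by (simp add: distinct_map)
    show "set (sort (map \<sigma> [0..<?n])) = set [0..<?n]"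
      using permutes_image[OF \<sigma>] by (simp add: lessThan_atLeast0)
  qed simp_all
  also have "F [0..<?n] = l xs" by (simp add: F_def map_nth lessThan_atLeast0)
  also have "F (map \<sigma> [0..<?n]) = l (permute_entries \<sigma> xs)"
  proof -
    have "\<sigma> i < ?n" if "i < ?n" for i using permutes_in_image[OF \<sigma>, of i] that by simp
    hence "set (map \<sigma> [0..<?n]) \<subseteq> {..<?n}" by auto
    thus ?thesis unfolding F_def permute_entries_def by (simp add: comp_def)
  qed
  finally show ?thesis by (simp add: koszul_sign_sc2[OF h(4)])
qed

lemma l_jacobi:
  assumes "homogeneous_list V ds xs" "length xs = n"
  shows "(\<Sum>i = 1..n. \<Sum>\<sigma>\<in>shuffle_perms i n. sc2 (koszul_sign ds \<sigma>)
    (l (l (take i (permute_entries \<sigma> xs)) # drop i (permute_entries \<sigma> xs)))) = 0"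
proof -
  note h = homogeneous_valid[OF assms(1)]
  let ?zs = "zip ds xs"
  let ?t = "\<lambda>i \<sigma>. sc2 (koszul_sign ds \<sigma>) (l (l (take i (permute_entries \<sigma> xs)) # drop i (permute_entries \<sigma> xs)))"
  have trm: "?t i \<sigma> = sg (inversion_sum ((!) (map fst ?zs)) (map \<sigma> [0..<n]))
      (l (l (map snd (take i (permute_entries \<sigma> ?zs))) # map snd (drop i (permute_entries \<sigma> ?zs))))"
    if "\<sigma> \<in> shuffle_perms i n" for i \<sigma>
  proof -
    have "\<sigma> permutes {..<n}" using that by (simp add: shuffle_perms_def)
    hence "\<sigma> i < length xs" if "i < length xs" for i
      using permutes_in_image[of \<sigma> "{..<n}" i] that assms(2) by simp
    hence "permute_entries \<sigma> xs = map snd (permute_entries \<sigma> ?zs)"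
      using h(4) by (auto simp: permute_entries_def)
    thus ?thesis
      using koszul_sign_sc2[of ds n] h assms(2) by (simp add: take_map drop_map)
  qed
  \<comment> \<open>The summand for \<open>i = 0\<close> is added with value 0, since
    \<open>l [] = 0\<close>; this gives the range that \<open>unshuffle_sum\<close> covers.\<close>
  have "l (l (take 0 (permute_entries \<sigma> xs)) # drop 0 (permute_entries \<sigma> xs)) = 0"
    if "\<sigma> \<in> shuffle_perms 0 n" for \<sigma>
  proof -
    have "\<sigma> permutes {..<n}" using that by (simp add: shuffle_perms_def)
    hence "\<sigma> i < length xs" if "i < length xs" for i
      using permutes_in_image[of \<sigma> "{..<n}" i] that assms(2) by simp
    hence "set (permute_entries \<sigma> xs) \<subseteq> set xs"
      by (auto simp: permute_entries_def)
    moreover have "set xs \<subseteq> C \<times> C" using valid_C[OF h(1)] h(3) by simp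
    moreover have "l [] = 0" by (simp add: l_def zero_prod_def)
    ultimately show ?thesis by (intro l_zero_entry) (auto simp: zero_prod_def)
  qed
  hence t0: "?t 0 \<sigma> = 0" if "\<sigma> \<in> shuffle_perms 0 n" for \<sigma>
    using that koszul_sign_sc2[of ds n] h(4) assms(2) by simp
  have "{0..n} = insert 0 {1..n}" by auto
  hence "(\<Sum>i = 1..n. \<Sum>\<sigma>\<in>shuffle_perms i n. ?t i \<sigma>) = (\<Sum>i = 0..n. \<Sum>\<sigma>\<in>shuffle_perms i n. ?t i \<sigma>)"
    using t0 by simp
  also have "\<dots> = (\<Sum>i = 0..n. \<Sum>\<sigma>\<in>shuffle_perms i n. sg (inversion_sum ((!) (map fst ?zs)) (map \<sigma> [0..<n]))
      (l (l (map snd (take i (permute_entries \<sigma> ?zs))) # map snd (drop i (permute_entries \<sigma> ?zs)))))"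
    by (intro sum.cong refl trm)
  also have "\<dots> = jacobiator ?zs"
    unfolding jacobiator_def using h(4) assms(2)
    by (intro sum_shuffle_perms_eq_unshuffle_sum) simp
  also have "\<dots> = 0" by (rule jacobiator_eq_0) (rule h)
  finally show ?thesis .
qed

theorem L_infinity_algebra_l: "L_infinity_algebra sc2 V (\<lambda>k. l)"
  unfolding L_infinity_algebra_def
proof (intro conjI allI impI)
  fix k :: nat and ds xs
  assume *: "length xs = k \<and> homogeneous_list V ds xs"
  note h = homogeneous_valid[OF conjunct2[OF *]]
  show "l xs \<in> V (sum_list ds + 1)" using l_V[OF h(1)] by (simp add: deg_def h)
next
  fix k :: nat and ds xs \<sigma>
  assume "length xs = k \<and> homogeneous_list V ds xs \<and> \<sigma> permutes {..<k}"
  thus "l (permute_entries \<sigma> xs) = sc2 (koszul_sign ds \<sigma>) (l xs)" using l_koszul by blast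
next
  fix n :: nat and ds xs
  assume "length xs = n \<and> homogeneous_list V ds xs"
  thus "(\<Sum>i = 1..n. \<Sum>\<sigma>\<in>shuffle_perms i n. sc2 (koszul_sign ds \<sigma>)
    (l (l (take i (permute_entries \<sigma> xs)) # drop i (permute_entries \<sigma> xs)))) = 0"
    using l_jacobi by blast
qed (rule graded_V multilinear_l)+

lemma l_pair:
  assumes "f \<in> H a" "g \<in> H b"
  shows "l [(f, 0), (g, 0)] = (sg a (br f g), 0)"
proof -
  have "f \<in> G a" "g \<in> G b" "f \<in> C" "g \<in> C" using assms by (auto intro: H_G in_C[OF H_G])
  thus ?thesis by (simp add: l_def l_term_def tau_G br_sg parity parity_C foldl_C)
qed

text \<open>If \<open>S\<close> is empty, all heads vanish; if it has two or more elements, each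
  slot in \<open>S\<close> meets another zero second component. The only lists left with a single
  element in \<open>S\<close> have length one, and there \<open>p\<close> kills
  \<open>H\<close>.\<close>

lemma l_other:
  assumes S: "S \<subseteq> {..<length xs}"
    and "\<And>i. i \<in> S \<Longrightarrow> \<exists>d. xs ! i \<in> H d \<times> {0}"
    and "\<And>i. i \<in> {..<length xs} - S \<Longrightarrow> \<exists>d. xs ! i \<in> {0} \<times> A d"
    and "\<not> (length xs = 2 \<and> card S = 2)" "\<not> (length xs \<ge> 2 \<and> card S = 1)"
  shows "l xs = 0"
proof -
  have "\<exists>d. xs ! i \<in> V d" if "i < length xs" for i
  proof (cases "i \<in> S")
    case True
    obtain d where "xs ! i \<in> H d \<times> {0}" using assms(2)[OF True] ..
    hence "xs ! i \<in> V (d - 1)" by (auto simp: V_def)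
    thus ?thesis ..
  next
    case False
    have "i \<in> {..<length xs} - S" using False that by simp
    from assms(3)[OF this] obtain d where "xs ! i \<in> {0} \<times> A d" ..
    hence "xs ! i \<in> V d" by (auto simp: V_def)
    thus ?thesis ..
  qed
  then obtain d where d: "\<And>i. i < length xs \<Longrightarrow> xs ! i \<in> V (d i)" by metis
  define zs where "zs = zip (map d [0..<length xs]) xs"
  have valid: "valid zs" using d by (auto simp: zs_def valid_def set_zip)
  have zs: "map snd zs = xs" "length zs = length xs" by (simp_all add: zs_def)
  have fst0: "fst (xs ! i) = 0" if "i < length xs" "i \<notin> S" for i using assms(3)[of i] that by auto
  have snd0: "snd (xs ! i) = 0" if "i \<in> S" for i using assms(2)[of i] that by auto
  have 1: "fst (l xs) = 0"
  proof (cases "length xs = 2")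
    case True
    have "S \<noteq> {0, 1}" using assms(4) True by auto
    hence "0 \<notin> S \<or> 1 \<notin> S" using S True by (auto simp: less_2_cases_iff)
    hence "fst (xs ! 0) = 0 \<or> fst (xs ! 1) = 0" using fst0 True by auto
    moreover have "fst (xs ! 0) \<in> C" "fst (xs ! 1) \<in> C" using d True VD by (auto simp: VD(5)[OF d])
    ultimately show ?thesis using True by (auto simp: l_def tau_C)
  qed (simp add: l_def)
  moreover have "snd (l (map snd zs)) = 0"
  proof (cases "length xs = 1 \<and> card S = 1")
    case True
    then obtain x where x: "xs = [x]" by (auto simp: length_Suc_conv)
    have "S = {0}" using True S by (auto simp: card_1_singleton_iff)
    then obtain d where "x \<in> H d \<times> {0}" using assms(2)[of 0] x by auto
    thus ?thesis using x zs(1) l_single[of "fst x" d "[]"] p_H[of "fst x" d] by (auto simp: H_G)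
  next
    case False
    show ?thesis
    proof (rule snd_l_eq_0[OF valid])
      fix P x Q assume eq: "zs = P @ x # Q"
      hence xs: "xs = map snd P @ snd x # map snd Q" using zs by simp
      have xP: "xs ! length P = snd x" "length P < length xs" unfolding xs by (simp_all add: nth_append)
      show "fst (snd x) = 0 \<or> (\<exists>z\<in>set (P @ Q). snd (snd z) = 0)"
      proof (cases "length P \<in> S")
        case True
        have "card S \<noteq> 1" using assms(5) False S True by (cases "length xs") (auto simp: le_Suc_eq)
        hence "S \<noteq> {length P}" by auto
        then obtain j where j: "j \<in> S" "j \<noteq> length P" using True by auto
        hence "j < length xs" using S by auto
        hence "xs ! j \<in> set (map snd (P @ Q))"
          using j(2) unfolding xs by (auto simp: nth_append nth_Cons')
        then obtain z where "z \<in> set (P @ Q)" "snd z = xs ! j" by (metis imageE set_map)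
        thus ?thesis using snd0[OF j(1)] by metis
      next
        case False
        show ?thesis using fst0[OF xP(2) False] xP(1) by simp
      qed
    qed
  qed
  ultimately show ?thesis by (simp add: zs prod_eq_iff)
qed

end

section \<open>Restricting planar binary trees\<close>

definition restrict :: "nat set \<Rightarrow> unit tree \<Rightarrow> unit tree" where
  "restrict S y = the (delete_leaves S 0 y)"

text \<open>A rank function \<open>\<rho>\<close> gives the label of a surviving leaf after the deletion of \<open>S\<close>.\<close>

lemma delete_leaves_rank:
  assumes "\<And>x. \<rho> (Suc x) = (if x \<in> S then \<rho> x else Suc (\<rho> x))"
  shows "\<rho> (j + size1 y) = \<rho> j + (case delete_leaves S j y of None \<Rightarrow> 0 | Some t \<Rightarrow> size1 t)"
proof (induction y arbitrary: j)
  case (Node l u r)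
  have "\<rho> (j + size1 (Node l u r)) = \<rho> ((j + size1 l) + size1 r)" by (simp add: ac_simps)
  thus ?case by (simp add: Node split: option.split)
qed (simp add: assms)

text \<open>In terms of the original labels, the second deletion removes the leaves whose new label
  lies in \<open>S'\<close>. Identities between restricted trees thus become equalities of sets of
  deleted labels.\<close>

lemma delete_leaves_twice:
  assumes "\<And>x. \<rho> (Suc x) = (if x \<in> S then \<rho> x else Suc (\<rho> x))"
  shows "Option.bind (delete_leaves S j y) (delete_leaves S' (\<rho> j)) = delete_leaves (S \<union> {x. \<rho> x \<in> S'}) j y"
proof (induction y arbitrary: j)
  case (Node l u r)
  note rank = delete_leaves_rank[OF assms, of j l]
  show ?case
    using Node.IH(1)[of j] Node.IH(2)[of "j + size1 l"] rank
    by (cases "delete_leaves S j l"; cases "delete_leaves S (j + size1 l) r")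
       (auto split: option.splits)
qed simp

lemma delete_leaves_cong:
  "(\<And>x. j \<le> x \<Longrightarrow> x < j + size1 y \<Longrightarrow> x \<in> S \<longleftrightarrow> x \<in> S') \<Longrightarrow> delete_leaves S j y = delete_leaves S' j y"
proof (induction y arbitrary: j)
  case (Node l u r)
  have "delete_leaves S j l = delete_leaves S' j l" by (rule Node.IH(1)) (simp add: Node.prems)
  moreover have "delete_leaves S (j + size1 l) r = delete_leaves S' (j + size1 l) r"
    by (rule Node.IH(2)) (simp add: Node.prems)
  ultimately show ?case by simp
qed simp

lemma restrict_cong:
  "(\<And>x. x \<le> size y \<Longrightarrow> x \<in> S \<longleftrightarrow> x \<in> S') \<Longrightarrow> restrict S y = restrict S' y"
  unfolding restrict_def by (rule arg_cong[where f = the], rule delete_leaves_cong) (simp add: size1_size)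

text \<open>The last hypothesis says that \<open>m + 1\<close> leaves survive; in particular at
  least one does, so \<open>restrict\<close> does not fall back on \<open>the None\<close>.\<close>

lemma size_restrict:
  assumes "\<And>x. \<rho> (Suc x) = (if x \<in> S then \<rho> x else Suc (\<rho> x))" "\<rho> 0 = 0" "\<rho> (Suc (size y)) = Suc m"
  shows "delete_leaves S 0 y = Some (restrict S y)" "size (restrict S y) = m"
  using delete_leaves_rank[OF assms(1), of 0 y] assms(2,3)
  by (auto simp: restrict_def size1_size split: option.splits)

lemma restrict_restrict:
  assumes "\<And>x. \<rho> (Suc x) = (if x \<in> S then \<rho> x else Suc (\<rho> x))" "\<rho> 0 = 0" "\<rho> (Suc (size y)) = Suc m"
  shows "restrict S' (restrict S y) = restrict (S \<union> {x. \<rho> x \<in> S'}) y"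
proof -
  have "delete_leaves (S \<union> {x. \<rho> x \<in> S'}) 0 y = delete_leaves S' 0 (restrict S y)"
    using delete_leaves_twice[OF assms(1), of 0 y S'] assms(2) size_restrict(1)[OF assms] by simp
  thus ?thesis by (simp add: restrict_def)
qed

text \<open>\<open>outer i n y\<close> and \<open>inner i n y\<close> are \<open>R_outer m (i + 1) n y\<close> and \<open>R_inner m (i + 1) n y\<close>.\<close>

definition outer :: "nat \<Rightarrow> nat \<Rightarrow> unit tree \<Rightarrow> unit tree" where
  "outer i n = restrict {i<..<i + n}"

definition inner :: "nat \<Rightarrow> nat \<Rightarrow> unit tree \<Rightarrow> unit tree" where
  "inner i n = restrict ({..<i} \<union> {i + n<..})"

text \<open>The rank function for \<open>outer\<close>: a deleted leaf receives the label of the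
  next survivor.\<close>

definition outer_rank :: "nat \<Rightarrow> nat \<Rightarrow> nat \<Rightarrow> nat" where
  "outer_rank i n x = (if x \<le> i then x else if x < i + n then i + 1 else x + 1 - n)"

text \<open>The rank function for \<open>inner\<close>. Truncated subtraction sends everything on
  the left to 0, and the minimum sends everything on the right to \<open>n + 1\<close>, one more
  than the last label.\<close>

definition inner_rank :: "nat \<Rightarrow> nat \<Rightarrow> nat \<Rightarrow> nat" where
  "inner_rank i n x = min (x - i) (n + 1)"

lemma outer_rank: "1 \<le> n \<Longrightarrow> outer_rank i n (Suc x) = (if x \<in> {i<..<i + n} then outer_rank i n x else Suc (outer_rank i n x))"
  "outer_rank i n 0 = 0"
  by (auto simp: outer_rank_def)

lemma inner_rank: "inner_rank i n (Suc x) = (if x \<in> {..<i} \<union> {i + n<..} then inner_rank i n x else Suc (inner_rank i n x))"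
  "inner_rank i n 0 = 0"
  by (auto simp: inner_rank_def)

lemma outer_restrict:
  assumes "1 \<le> n" "i < m" "size y = m + n - 1"
  shows "size (outer i n y) = m"
    and "restrict S (outer i n y) = restrict ({i<..<i + n} \<union> {x. outer_rank i n x \<in> S}) y"
proof -
  have *: "outer_rank i n (Suc (size y)) = Suc m" using assms by (auto simp: outer_rank_def)
  show "size (outer i n y) = m"
    unfolding outer_def by (rule size_restrict(2)[OF outer_rank(1)[OF assms(1)] outer_rank(2) *])
  show "restrict S (outer i n y) = restrict ({i<..<i + n} \<union> {x. outer_rank i n x \<in> S}) y"
    unfolding outer_def by (rule restrict_restrict[OF outer_rank(1)[OF assms(1)] outer_rank(2) *])
qed

lemma inner_restrict:
  assumes "i < m" "size y = m + n - 1"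
  shows "size (inner i n y) = n"
    and "restrict S (inner i n y) = restrict ({..<i} \<union> {i + n<..} \<union> {x. inner_rank i n x \<in> S}) y"
proof -
  have *: "inner_rank i n (Suc (size y)) = Suc n" using assms by (auto simp: inner_rank_def)
  show "size (inner i n y) = n"
    unfolding inner_def by (rule size_restrict(2)[OF inner_rank *])
  show "restrict S (inner i n y) = restrict ({..<i} \<union> {i + n<..} \<union> {x. inner_rank i n x \<in> S}) y"
    unfolding inner_def by (rule restrict_restrict[OF inner_rank *])
qed

text \<open>\<open>m\<close>, \<open>n\<close> and \<open>k\<close> are the arities of three
  cochains to be composed, and \<open>y\<close> is a tree for the composite.\<close>

context
  fixes m n k i j :: nat and y :: "unit tree"
  assumes pos: "1 \<le> n" "1 \<le> k" and i: "i < m" and y: "size y = m + n + k - 2"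
begin

text \<open>Sequential composition: the third cochain goes into a slot of the second. Both sides
  delete the same leaves of \<open>y\<close>, which is a computation with the rank
  functions.\<close>

lemma nested_trees:
  assumes "i \<le> j" "j < i + n"
  shows "outer i n (outer j k y) = outer i (n + k - 1) y"
    and "inner i n (outer j k y) = outer (j - i) k (inner i (n + k - 1) y)"
    and "inner (j - i) k (inner i (n + k - 1) y) = inner j k y"
proof -
  have o: "1 \<le> k" "j < m + n - 1" "size y = (m + n - 1) + k - 1" using pos i y assms by auto
  have i': "i < m" "size y = m + (n + k - 1) - 1" using pos i y by auto
  show "outer i n (outer j k y) = outer i (n + k - 1) y"
    unfolding outer_def[of i n] outer_restrict(2)[OF o] outer_def[of i "n + k - 1"]
    by (rule restrict_cong) (use pos assms in \<open>auto simp: outer_rank_def split: if_splits\<close>)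
  show "inner i n (outer j k y) = outer (j - i) k (inner i (n + k - 1) y)"
    unfolding inner_def[of i n] outer_restrict(2)[OF o] outer_def[of "j - i" k] inner_restrict(2)[OF i']
    by (rule restrict_cong) (use pos assms in \<open>auto simp: outer_rank_def inner_rank_def split: if_splits\<close>)
  show "inner (j - i) k (inner i (n + k - 1) y) = inner j k y"
    unfolding inner_def[of "j - i" k] inner_restrict(2)[OF i'] inner_def[of j k]
    by (rule restrict_cong) (use pos assms in \<open>auto simp: inner_rank_def split: if_splits\<close>)
qed

text \<open>Parallel composition at slots \<open>i < j\<close> of the first cochain: once arity
  \<open>n\<close> has been inserted at \<open>i\<close>, the slot \<open>j\<close> has moved to
  \<open>j + n - 1\<close>.\<close>

lemma parallel_trees:
  assumes "i < j" "j < m"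
  shows "outer i n (outer (j + n - 1) k y) = outer j k (outer i n y)"
    and "inner i n (outer (j + n - 1) k y) = inner i n y"
    and "inner j k (outer i n y) = inner (j + n - 1) k y"
proof -
  have o: "1 \<le> k" "j + n - 1 < m + n - 1" "size y = (m + n - 1) + k - 1" using pos i y assms by auto
  have o': "1 \<le> n" "i < m + k - 1" "size y = (m + k - 1) + n - 1" using pos i y by auto
  show "outer i n (outer (j + n - 1) k y) = outer j k (outer i n y)"
    unfolding outer_def[of j k] outer_restrict(2)[OF o'] unfolding outer_def[of i n] outer_restrict(2)[OF o]
    by (rule restrict_cong) (use pos assms in \<open>auto simp: outer_rank_def split: if_splits\<close>)
  show "inner i n (outer (j + n - 1) k y) = inner i n y"
    unfolding inner_def[of i n] outer_restrict(2)[OF o]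
    by (rule restrict_cong) (use pos assms in \<open>auto simp: outer_rank_def split: if_splits\<close>)
  show "inner j k (outer i n y) = inner (j + n - 1) k y"
    unfolding inner_def[of j k] outer_restrict(2)[OF o'] inner_def[of "j + n - 1"]
    by (rule restrict_cong) (use pos assms in \<open>auto simp: outer_rank_def split: if_splits\<close>)
qed

end

section \<open>The pre-Lie product of cochains\<close>

text \<open>Slots count from 0, and the arity of \<open>f\<close> is not a parameter but fixed by
  the length of the argument list. This keeps the operation meaningful for sums of cochains of
  different arities.\<close>

definition circ_at :: "nat \<Rightarrow> nat \<Rightarrow> 'd::ab_group_add cochain \<Rightarrow> 'd cochain \<Rightarrow> 'd cochain" where
  "circ_at i n f g = (\<lambda>y as. if size y = length as \<and> i + n \<le> length as
    then f (outer i n y) (take i as @ g (inner i n y) (take n (drop i as)) # drop (i + n) as) else 0)"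

lemma circ_at_append:
  assumes "length P = i" "length W = n" "size y = length (P @ W @ Q)"
  shows "circ_at i n f g y (P @ W @ Q) = f (outer i n y) (P @ g (inner i n y) W # Q)"
  using assms by (simp add: circ_at_def)

lemma split_list_lengths:
  assumes "i + n \<le> length as"
  obtains P W Q where "as = P @ W @ Q" "length P = i" "length W = n"
proof
  show "as = take i as @ take n (drop i as) @ drop (i + n) as"
    by (metis append_take_drop_id add.commute drop_drop)
qed (use assms in simp_all)

lemma sizes:
  assumes "1 \<le> n" "i + n \<le> size y"
  shows "size (outer i n y) = size y + 1 - n" "size (inner i n y) = n"
  using outer_restrict(1)[of n i "size y + 1 - n" y] inner_restrict(1)[of i "size y + 1 - n" y n] assms by auto

text \<open>The sequential axiom of a nonsymmetric operad, written with degrees \<open>b\<close> and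
  \<open>c\<close> instead of arities so that no subtraction occurs.\<close>

lemma circ_at_nested:
  assumes "j \<le> b"
  shows "circ_at (i + j) (Suc c) (circ_at i (Suc b) f g) h = circ_at i (Suc (b + c)) f (circ_at j (Suc c) g h)"
proof (intro ext)
  fix y as
  show "circ_at (i + j) (Suc c) (circ_at i (Suc b) f g) h y as = circ_at i (Suc (b + c)) f (circ_at j (Suc c) g h) y as"
  proof (cases "size y = length as \<and> i + Suc (b + c) \<le> length as")
    case True
    then obtain P W Q where 1: "as = P @ W @ Q" "length P = i" "length W = Suc (b + c)"
      by (meson split_list_lengths)
    have "j + Suc c \<le> length W" using 1 assms by simp
    then obtain W1 X W2 where 2: "W = W1 @ X @ W2" "length W1 = j" "length X = Suc c"
      by (meson split_list_lengths)
    have W2: "length W2 = b - j" using 1 2 assms by simp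
    \<comment> \<open>The arity of \<open>f\<close>, recovered from the length of the argument
      list.\<close>
    define m where "m = length as - b - c"
    have tr: "1 \<le> Suc b" "1 \<le> Suc c" "i < m" "size y = m + Suc b + Suc c - 2" "i \<le> i + j" "i + j < i + Suc b"
      using True assms by (auto simp: m_def)
    note T = nested_trees[OF tr]
    have "circ_at (i + j) (Suc c) (circ_at i (Suc b) f g) h y ((P @ W1) @ X @ (W2 @ Q)) =
        circ_at i (Suc b) f g (outer (i + j) (Suc c) y) (P @ (W1 @ h (inner (i + j) (Suc c) y) X # W2) @ Q)"
      by (subst circ_at_append) (use True 1 2 in auto)
    also have "\<dots> = f (outer i (Suc b) (outer (i + j) (Suc c) y))
        (P @ g (inner i (Suc b) (outer (i + j) (Suc c) y)) (W1 @ h (inner (i + j) (Suc c) y) X # W2) # Q)"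
      by (rule circ_at_append) (use True 1 2 W2 assms sizes(1)[of "Suc c" "i + j" y] in auto)
    also have "\<dots> = f (outer i (Suc (b + c)) y)
        (P @ g (outer j (Suc c) (inner i (Suc (b + c)) y)) (W1 @ h (inner j (Suc c) (inner i (Suc (b + c)) y)) X # W2) # Q)"
      using T by simp
    also have "\<dots> = f (outer i (Suc (b + c)) y) (P @ circ_at j (Suc c) g h (inner i (Suc (b + c)) y) (W1 @ X @ W2) # Q)"
      by (subst circ_at_append) (use True 1 2 sizes(2)[of "Suc (b + c)" i y] in auto)
    also have "\<dots> = circ_at i (Suc (b + c)) f (circ_at j (Suc c) g h) y (P @ (W1 @ X @ W2) @ Q)"
      by (subst circ_at_append) (use True 1 2 in auto)
    finally show ?thesis using 1 2 by simp
  next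
    case False
    thus ?thesis using assms by (auto simp: circ_at_def)
  qed
qed

text \<open>The parallel axiom: slot \<open>j\<close> of \<open>f\<close> becomes slot
  \<open>j + b\<close> once a cochain of arity \<open>b + 1\<close> has been inserted further
  left.\<close>

lemma circ_at_parallel:
  assumes "i < j"
  shows "circ_at (j + b) (Suc c) (circ_at i (Suc b) f g) h = circ_at i (Suc b) (circ_at j (Suc c) f h) g"
proof (intro ext)
  fix y as
  show "circ_at (j + b) (Suc c) (circ_at i (Suc b) f g) h y as = circ_at i (Suc b) (circ_at j (Suc c) f h) g y as"
  proof (cases "size y = length as \<and> j + b + Suc c \<le> length as")
    case True
    then obtain R X Q where 1: "as = R @ X @ Q" "length R = j + b" "length X = Suc c"
      by (meson split_list_lengths)
    have "i + Suc b \<le> length R" using 1 assms by simp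
    then obtain P W S where 2: "R = P @ W @ S" "length P = i" "length W = Suc b"
      by (meson split_list_lengths)
    have S: "length S = j - i - 1" using 1 2 assms by simp
    define m where "m = length as - b - c"
    have tr: "1 \<le> Suc b" "1 \<le> Suc c" "i < m" "size y = m + Suc b + Suc c - 2" "i < j" "j < m"
      using True assms by (auto simp: m_def)
    note T = parallel_trees[OF tr]
    have "circ_at (j + b) (Suc c) (circ_at i (Suc b) f g) h y ((P @ W @ S) @ X @ Q) =
        circ_at i (Suc b) f g (outer (j + b) (Suc c) y) (P @ W @ (S @ h (inner (j + b) (Suc c) y) X # Q))"
      by (subst circ_at_append) (use True 1 2 in auto)
    also have "\<dots> = f (outer i (Suc b) (outer (j + b) (Suc c) y))
        (P @ g (inner i (Suc b) (outer (j + b) (Suc c) y)) W # (S @ h (inner (j + b) (Suc c) y) X # Q))"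
      by (rule circ_at_append) (use True 1 2 sizes(1)[of "Suc c" "j + b" y] in auto)
    also have "\<dots> = f (outer j (Suc c) (outer i (Suc b) y))
        ((P @ g (inner i (Suc b) y) W # S) @ h (inner j (Suc c) (outer i (Suc b) y)) X # Q)"
      using T by simp
    also have "\<dots> = circ_at j (Suc c) f h (outer i (Suc b) y) ((P @ g (inner i (Suc b) y) W # S) @ X @ Q)"
      by (rule circ_at_append[symmetric]) (use True 1 2 S assms sizes(1)[of "Suc b" i y] in auto)
    also have "\<dots> = circ_at i (Suc b) (circ_at j (Suc c) f h) g y (P @ W @ (S @ X @ Q))"
      by (subst circ_at_append) (use True 1 2 in auto)
    finally show ?thesis using 1 2 by simp
  next
    case False
    thus ?thesis using assms by (auto simp: circ_at_def)
  qed
qed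

lemma circ_at_0_left [simp]: "circ_at i n 0 g = 0"
  by (auto simp: circ_at_def fun_eq_iff)

lemma circ_at_add_left: "circ_at i n (f + f') g = circ_at i n f g + circ_at i n f' g"
  by (auto simp: circ_at_def fun_eq_iff)

lemma circ_at_uminus_left: "circ_at i n (- f) g = - circ_at i n f g"
  by (auto simp: circ_at_def fun_eq_iff)

lemma circ_at_sg_left: "circ_at i n (sg k f) g = sg k (circ_at i n f g)"
  by (simp add: sg_def circ_at_uminus_left)

lemma circ_at_sum_left: "circ_at i n (\<Sum>j\<in>J. f j) g = (\<Sum>j\<in>J. circ_at i n (f j) g)"
  using sum_comp_morphism[of "\<lambda>f. circ_at i n f g" f J, OF circ_at_0_left circ_at_add_left] by (simp only: comp_def)

locale cochain_space = vector_space s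
  for s :: "'k::field \<Rightarrow> 'b::ab_group_add \<Rightarrow> 'b"
begin

text \<open>Possibly infinite sums of cochains of all arities \<open>\<ge> 1\<close>.\<close>

definition cochains :: "'b cochain set" where
  "cochains = {f. (\<forall>y. multilinear_on s UNIV s (size y) (f y)) \<and>
    (\<forall>y as. size y \<noteq> length as \<or> as = [] \<longrightarrow> f y as = 0)}"

text \<open>A form by concatenation, suited to \<open>circ_at\<close>, which cuts its argument list
  into blocks.\<close>

lemma multilinear_on_UNIV_iff:
  "multilinear_on s UNIV s n F \<longleftrightarrow> (\<forall>P Q c x y. length P + length Q + 1 = n \<longrightarrow>
    F (P @ (s c x + y) # Q) = s c (F (P @ x # Q)) + F (P @ y # Q))" (is "?L \<longleftrightarrow> ?R")
proof
  assume L: ?L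
  show ?R
  proof (intro allI impI)
    fix P Q :: "'b list" and c and x y :: 'b assume n: "length P + length Q + 1 = n"
    have "length (P @ 0 # Q) = n" "length P < n" using n by simp_all
    hence "F ((P @ 0 # Q)[length P := s c x + y]) = F ((P @ 0 # Q)[length P := s c x]) + F ((P @ 0 # Q)[length P := y])"
      "F ((P @ 0 # Q)[length P := s c x]) = s c (F ((P @ 0 # Q)[length P := x]))"
      using L unfolding multilinear_on_def by blast+
    thus "F (P @ (s c x + y) # Q) = s c (F (P @ x # Q)) + F (P @ y # Q)" by simp
  qed
next
  assume R: ?R
  show ?L
    unfolding multilinear_on_def
  proof (intro allI impI)
    fix xs :: "'b list" and i
    assume *: "length xs = n \<and> set xs \<subseteq> UNIV \<and> i < n"
    have upd: "xs[i := x] = take i xs @ x # drop (Suc i) xs" for x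
      using * by (simp add: upd_conv_take_nth_drop)
    have lin: "F (xs[i := s c x + y]) = s c (F (xs[i := x])) + F (xs[i := y])" for c x y
      unfolding upd using R * by simp
    have add: "F (xs[i := x + y]) = F (xs[i := x]) + F (xs[i := y])" for x y
      using lin[of 1 x y] by simp
    have "F (xs[i := 0]) = 0" using add[of 0 0] by simp
    thus "(\<forall>x\<in>UNIV. \<forall>y\<in>UNIV. F (xs[i := x + y]) = F (xs[i := x]) + F (xs[i := y])) \<and>
      (\<forall>c. \<forall>x\<in>UNIV. F (xs[i := s c x]) = s c (F (xs[i := x])))"
      using add lin[of _ _ 0] by simp
  qed
qed

lemma cochains_iff:
  "f \<in> cochains \<longleftrightarrow>
    (\<forall>y P Q c x x'. length P + length Q + 1 = size y \<longrightarrow>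
      f y (P @ (s c x + x') # Q) = s c (f y (P @ x # Q)) + f y (P @ x' # Q)) \<and>
    (\<forall>y as. size y \<noteq> length as \<or> as = [] \<longrightarrow> f y as = 0)"
  unfolding cochains_def multilinear_on_UNIV_iff by auto

lemma cochains_lin:
  "f \<in> cochains \<Longrightarrow> length P + length Q + 1 = size y \<Longrightarrow>
    f y (P @ (s c x + x') # Q) = s c (f y (P @ x # Q)) + f y (P @ x' # Q)"
  unfolding cochains_iff by blast

lemma cochains_zero_entry:
  assumes "f \<in> cochains"
  shows "f y (P @ 0 # Q) = 0"
proof (cases "length P + length Q + 1 = size y")
  case True
  from cochains_lin[OF assms True, of 1 0 0] show ?thesis by simp
next
  case False
  thus ?thesis using assms unfolding cochains_iff by (metis add.commute add_Suc_right length_Cons length_append plus_1_eq_Suc)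
qed

lemma cochains_add:
  assumes "f \<in> cochains" "length P + length Q + 1 = size y"
  shows "f y (P @ (x + x') # Q) = f y (P @ x # Q) + f y (P @ x' # Q)"
  using cochains_lin[OF assms, of 1 x x'] by simp

text \<open>Membership may be tested one list length at a time. This serves the bracket, whose
  defining sum grows with the length of the list.\<close>

lemma cochains_local:
  assumes "\<And>N. \<exists>g\<in>cochains. \<forall>y as. length as = N \<longrightarrow> f y as = g y as"
  shows "f \<in> cochains"
  unfolding cochains_iff
proof (intro conjI allI impI)
  fix y :: "unit tree" and P Q :: "'b list" and c and x x' :: 'b
  assume n: "length P + length Q + 1 = size y"
  obtain g where g: "g \<in> cochains" "\<forall>y' as. length as = size y \<longrightarrow> f y' as = g y' as"
    using assms by blast
  show "f y (P @ (s c x + x') # Q) = s c (f y (P @ x # Q)) + f y (P @ x' # Q)"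
    using cochains_lin[OF g(1) n] g(2) n by simp
next
  fix y :: "unit tree" and as :: "'b list"
  assume "size y \<noteq> length as \<or> as = []"
  moreover obtain g where "g \<in> cochains" "\<forall>y' as'. length as' = length as \<longrightarrow> f y' as' = g y' as'"
    using assms by blast
  ultimately show "f y as = 0" unfolding cochains_iff by simp
qed

lemma vector_space_cochain_scale: "vector_space (cochain_scale s)"
  by unfold_locales (simp_all add: cochain_scale_def fun_eq_iff scale_right_distrib scale_left_distrib)

sublocale cochain: vector_space "cochain_scale s"
  by (rule vector_space_cochain_scale)

lemma subspace_cochains: "cochain.subspace cochains"
proof (rule cochain.subspaceI)
  fix f g assume "f \<in> cochains" "g \<in> cochains"
  thus "f + g \<in> cochains"
    unfolding cochains_iff by (simp add: scale_right_distrib) (simp add: ac_simps)?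
next
  fix c f assume "f \<in> cochains"
  thus "cochain_scale s c f \<in> cochains"
    unfolding cochains_iff by (simp add: cochain_scale_def scale_right_distrib mult.commute)
qed (simp add: cochains_iff)

lemma cochains_closed:
  "0 \<in> cochains" "f \<in> cochains \<Longrightarrow> g \<in> cochains \<Longrightarrow> f + g \<in> cochains"
  "f \<in> cochains \<Longrightarrow> g \<in> cochains \<Longrightarrow> f - g \<in> cochains"
  "f \<in> cochains \<Longrightarrow> sg k f \<in> cochains" "(\<And>i. i \<in> I \<Longrightarrow> F i \<in> cochains) \<Longrightarrow> sum F I \<in> cochains"
  using subspace_cochains
  by (auto simp: sg_def intro: cochain.subspace_0 cochain.subspace_add cochain.subspace_diff
    cochain.subspace_neg cochain.subspace_sum)

lemma circ_at_lin_left: "circ_at i n (cochain_scale s c f + f') g =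
    cochain_scale s c (circ_at i n f g) + circ_at i n f' g"
  by (auto simp: circ_at_def fun_eq_iff cochain_scale_def)

lemma circ_at_lin_right:
  assumes "f \<in> cochains" "1 \<le> n"
  shows "circ_at i n f (cochain_scale s c g + g') = cochain_scale s c (circ_at i n f g) + circ_at i n f g'"
proof (intro ext)
  fix y as
  show "circ_at i n f (cochain_scale s c g + g') y as = (cochain_scale s c (circ_at i n f g) + circ_at i n f g') y as"
  proof (cases "size y = length as \<and> i + n \<le> length as")
    case True
    have "length (take i as) + length (drop (i + n) as) + 1 = size (outer i n y)"
      using True sizes(1)[OF assms(2), of i y] assms(2) by (simp add: Suc_diff_le[of n "length as"])
    from cochains_lin[OF assms(1) this] show ?thesis
      using True by (simp add: circ_at_def cochain_scale_def)
  qed (auto simp: circ_at_def cochain_scale_def)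
qed

lemma circ_at_add_right: "f \<in> cochains \<Longrightarrow> 1 \<le> n \<Longrightarrow> circ_at i n f (g + g') = circ_at i n f g + circ_at i n f g'"
  using circ_at_lin_right[of f n i 1 g g'] by simp

lemma circ_at_0_right: "f \<in> cochains \<Longrightarrow> 1 \<le> n \<Longrightarrow> circ_at i n f 0 = 0"
  using circ_at_add_right[of f n i 0 0] by simp

lemma circ_at_sg_right: "f \<in> cochains \<Longrightarrow> 1 \<le> n \<Longrightarrow> circ_at i n f (sg k g) = sg k (circ_at i n f g)"
  using circ_at_lin_right[of f n i "-1" g 0] by (simp add: sg_def circ_at_0_right)

lemma circ_at_sum_right:
  "f \<in> cochains \<Longrightarrow> 1 \<le> n \<Longrightarrow> circ_at i n f (\<Sum>j\<in>J. g j) = (\<Sum>j\<in>J. circ_at i n f (g j))"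
  using sum_comp_morphism[of "circ_at i n f" g J, OF circ_at_0_right circ_at_add_right] by (simp only: comp_def)

lemma circ_at_cochains:
  assumes f: "f \<in> cochains" and g: "g \<in> cochains" and n: "1 \<le> n"
  shows "circ_at i n f g \<in> cochains"
  unfolding cochains_iff
proof (intro conjI allI impI)
  fix y :: "unit tree" and P Q :: "'b list" and c and x x' :: 'b
  assume len: "length P + length Q + 1 = size y"
  show "circ_at i n f g y (P @ (s c x + x') # Q) =
      s c (circ_at i n f g y (P @ x # Q)) + circ_at i n f g y (P @ x' # Q)"
  proof (cases "i + n \<le> size y")
    case True
    note sz = sizes[OF n True]
    have ev: "circ_at i n f g y (P @ z # Q) = f (outer i n y)
      (take i (P @ z # Q) @ g (inner i n y) (take n (drop i (P @ z # Q))) # drop (i + n) (P @ z # Q))" for z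
      using len True by (simp add: circ_at_def)
    \<comment> \<open>The varied entry stands before, inside or behind the block handed to
      \<open>g\<close>.\<close>
    consider "length P < i" | "i \<le> length P" "length P < i + n" | "i + n \<le> length P" by linarith
    thus ?thesis
    proof cases
      case 1
      then obtain k where k: "i = length P + Suc k" by (metis less_iff_Suc_add add_Suc_right)
      let ?W = "g (inner i n y) (take n (drop k Q)) # drop (k + n) Q"
      have "circ_at i n f g y (P @ z # Q) = f (outer i n y) (P @ z # take k Q @ ?W)" for z
        unfolding ev using 1 k by simp
      moreover have "length P + length (take k Q @ ?W) + 1 = size (outer i n y)"
        using sz len k n True by simp
      ultimately show ?thesis using cochains_lin[OF f] by simp
    next
      case 2
      define P1 P2 Q1 Q2 where "P1 = take i P" "P2 = drop i P" "Q1 = take (i + n - length P - 1) Q" "Q2 = drop (i + n - length P - 1) Q"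
      have PQ: "P = P1 @ P2" "Q = Q1 @ Q2" "length P1 = i" "length P2 = length P - i"
          "length Q1 = i + n - length P - 1"
        using 2 len True by (auto simp: P1_P2_Q1_Q2_def)
      have "circ_at i n f g y (P1 @ (P2 @ z # Q1) @ Q2) = f (outer i n y) (P1 @ g (inner i n y) (P2 @ z # Q1) # Q2)" for z
        by (rule circ_at_append) (use PQ 2 len in auto)
      hence "circ_at i n f g y (P @ z # Q) = f (outer i n y) (P1 @ g (inner i n y) (P2 @ z # Q1) # Q2)" for z
        using PQ by simp
      moreover have "length P2 + length Q1 + 1 = size (inner i n y)" "length P1 + length Q2 + 1 = size (outer i n y)"
        using PQ 2 len sz True by (auto simp: P1_P2_Q1_Q2_def)
      ultimately show ?thesis by (simp only: cochains_lin[OF f] cochains_lin[OF g])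
    next
      case 3
      let ?W = "take i P @ g (inner i n y) (take n (drop i P)) # drop (i + n) P"
      have W: "circ_at i n f g y (P @ z # Q) = f (outer i n y) (?W @ z # Q)" for z
        unfolding ev using 3 by simp
      have "length ?W + length Q + 1 = size (outer i n y)"
        using sz len n True 3 by simp
      thus ?thesis unfolding W by (rule cochains_lin[OF f])
    qed
  qed (use len in \<open>simp add: circ_at_def\<close>)
next
  fix y :: "unit tree" and as :: "'b list"
  assume "size y \<noteq> length as \<or> as = []"
  thus "circ_at i n f g y as = 0" using n by (auto simp: circ_at_def)
qed

end

text \<open>\<open>a\<close> and \<open>b\<close> are degrees, one less than the arities, and slots
  count from 0; hence \<open>i * b\<close> for the usual exponent
  \<open>(i - 1)(n - 1)\<close>.\<close>

definition pre_lie :: "nat \<Rightarrow> nat \<Rightarrow> 'd::ab_group_add cochain \<Rightarrow> 'd cochain \<Rightarrow> 'd cochain" where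
  "pre_lie a b f g = (\<Sum>i<Suc a. sg (int (i * b)) (circ_at i (Suc b) f g))"

lemma MM_circ_eq:
  assumes "1 \<le> n" "i < m" "length as = m + n - 1"
  shows "MM_circ m n (Suc i) f g y as = circ_at i n f g y as"
proof (cases "size y = length as")
  case True
  \<comment> \<open>\<open>inner\<close> deletes an unbounded set of labels, \<open>R_inner\<close>
    a bounded one; a tree of this size has no labels in the difference.\<close>
  have "delete_leaves ({0..<i} \<union> {Suc i + n..m + n - 1}) 0 y = delete_leaves ({..<i} \<union> {i + n<..}) 0 y"
    by (rule delete_leaves_cong) (use True assms in \<open>auto simp: size1_size\<close>)
  moreover have "{Suc i..<Suc i + n - 1} = {i<..<i + n}" by auto
  ultimately have "R_inner m (Suc i) n y = inner i n y" "R_outer m (Suc i) n y = outer i n y"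
    by (simp_all add: R_inner_def R_outer_def inner_def outer_def restrict_def)
  moreover have "i + n \<le> length as" using assms by linarith
  ultimately show ?thesis using True assms by (simp add: MM_circ_def circ_at_def Y_def)
qed (use assms in \<open>auto simp: MM_circ_def circ_at_def Y_def\<close>)

lemma sum_apply2: "(\<Sum>i\<in>I. F i) y as = (\<Sum>i\<in>I. F i y as)"
  by (induction I rule: infinite_finite_induct) simp_all

lemma sg_apply2: "sg k f y as = sg k (f y as)"
  by (simp add: sg_def)

lemma MM_bracket_hom_eq:
  assumes "vector_space s" "length as = a + b + 1"
  shows "MM_bracket_hom s (Suc a) (Suc b) f g y as =
    pre_lie a b f g y as - sg (int (a * b)) (pre_lie b a g f y as)"
proof -
  have *: "(\<Sum>i = 1..Suc a. cochain_scale s ((-1) ^ ((i - 1) * (Suc b - 1))) (MM_circ (Suc a) (Suc b) i f g)) y as =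
    pre_lie a b f g y as" if "length as = a + b + 1" for a b f g
  proof -
    have "(\<Sum>i = 1..Suc a. cochain_scale s ((-1) ^ ((i - 1) * (Suc b - 1))) (MM_circ (Suc a) (Suc b) i f g)) y as =
      (\<Sum>i = Suc 0..Suc a. sg (int ((i - 1) * b)) (MM_circ (Suc a) (Suc b) i f g y as))"
      by (simp only: sum_apply2 cochain_scale_def sg_eq_scale(1)[OF assms(1)] diff_Suc_Suc diff_zero One_nat_def)
    also have "\<dots> = (\<Sum>i<Suc a. sg (int (i * b)) (MM_circ (Suc a) (Suc b) (Suc i) f g y as))"
      by (subst sum.shift_bounds_cl_Suc_ivl) (simp add: atLeast0AtMost lessThan_Suc_atMost del: sum.lessThan_Suc sum.atMost_Suc)
    also have "\<dots> = pre_lie a b f g y as"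
      unfolding pre_lie_def sum_apply2 sg_apply2
      by (rule sum.cong) (use that in \<open>simp_all add: MM_circ_eq\<close>)
    finally show ?thesis .
  qed
  have "length as = b + a + 1" using assms by simp
  from *[OF assms(2), of f g] *[OF this, of g f] show ?thesis
    by (simp add: MM_bracket_hom_def cochain_scale_def sg_eq_scale(1)[OF assms(1), symmetric]
        del: sum.cl_ivl_Suc)
qed

lemma MM_bracket_eq:
  assumes "vector_space s"
  shows "MM_bracket s f g y as = (\<Sum>a<length as. pre_lie a (length as - 1 - a) f g y as -
    sg (int (a * (length as - 1 - a))) (pre_lie (length as - 1 - a) a g f y as))"
proof -
  have "MM_bracket s f g y as = (\<Sum>m = Suc 0..length as. MM_bracket_hom s m (length as + 1 - m) f g y as)"
    by (simp add: MM_bracket_def)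
  also have "\<dots> = (\<Sum>a<length as. MM_bracket_hom s (Suc a) (length as + 1 - Suc a) f g y as)"
    by (rule sum.reindex_bij_witness[of _ Suc "\<lambda>m. m - 1"]) auto
  also have "\<dots> = (\<Sum>a<length as. pre_lie a (length as - 1 - a) f g y as -
    sg (int (a * (length as - 1 - a))) (pre_lie (length as - 1 - a) a g f y as))"
  proof (rule sum.cong)
    fix a assume "a \<in> {..<length as}"
    hence "length as + 1 - Suc a = Suc (length as - 1 - a)" "length as = a + (length as - 1 - a) + 1" by auto
    thus "MM_bracket_hom s (Suc a) (length as + 1 - Suc a) f g y as = pre_lie a (length as - 1 - a) f g y as -
        sg (int (a * (length as - 1 - a))) (pre_lie (length as - 1 - a) a g f y as)"
      by (metis MM_bracket_hom_eq[OF assms])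
  qed simp
  finally show ?thesis .
qed

lemma pre_lie_add_left: "pre_lie a b (f + f') g = pre_lie a b f g + pre_lie a b f' g"
  unfolding pre_lie_def circ_at_add_left sg_add sum.distrib ..

lemma pre_lie_sg_left: "pre_lie a b (sg k f) g = sg k (pre_lie a b f g)"
  unfolding pre_lie_def circ_at_sg_left sg_sum by (simp only: sg_sg add.commute)

context cochain_space
begin

lemma pre_lie_add_right: "f \<in> cochains \<Longrightarrow> pre_lie a b f (g + g') = pre_lie a b f g + pre_lie a b f g'"
  unfolding pre_lie_def by (simp only: circ_at_add_right le_add1 plus_1_eq_Suc sg_add sum.distrib)

lemma pre_lie_sg_right: "f \<in> cochains \<Longrightarrow> pre_lie a b f (sg k g) = sg k (pre_lie a b f g)"
  unfolding pre_lie_def sg_sum by (simp only: circ_at_sg_right le_add1 plus_1_eq_Suc sg_sg add.commute)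

lemma pre_lie_cochains: "f \<in> cochains \<Longrightarrow> g \<in> cochains \<Longrightarrow> pre_lie a b f g \<in> cochains"
  unfolding pre_lie_def by (intro cochains_closed circ_at_cochains) auto

text \<open>The associator is a sum over pairs of distinct slots of \<open>f\<close>, hence graded symmetric in the
  two cochains inserted there.\<close>

definition parallel_sum :: "nat \<Rightarrow> nat \<Rightarrow> nat \<Rightarrow> 'b cochain \<Rightarrow> 'b cochain \<Rightarrow> 'b cochain \<Rightarrow> 'b cochain" where
  "parallel_sum a b c f g h = (\<Sum>i<Suc a. \<Sum>j=Suc i..<Suc a.
    sg (int (i * b + j * c)) (circ_at (j + b) (Suc c) (circ_at i (Suc b) f g) h))"

lemma associator:
  assumes f: "f \<in> cochains"
  shows "pre_lie (a + b) c (pre_lie a b f g) h =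
    pre_lie a (b + c) f (pre_lie b c g h) + sg (int (b * c)) (parallel_sum a b c f g h) + parallel_sum a c b f h g"
proof -
  define T where "T i j = sg (int (i * b + j * c)) (circ_at j (Suc c) (circ_at i (Suc b) f g) h)" for i j
  have "pre_lie (a + b) c (pre_lie a b f g) h = (\<Sum>j<Suc (a + b). \<Sum>i<Suc a. T i j)"
    unfolding pre_lie_def T_def
    by (simp only: circ_at_sum_left circ_at_sg_left sg_sum sg_sg of_nat_add add.commute)
  also have "\<dots> = (\<Sum>i<Suc a. \<Sum>j\<in>{0..<Suc (a + b)}. T i j)"
    by (subst sum.swap) (simp only: lessThan_atLeast0)
  \<comment> \<open>Relative to \<open>g\<close> sitting at slot \<open>i\<close>, the slot
    \<open>j\<close> of \<open>h\<close> lies to the left of \<open>g\<close>, inside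
    \<open>g\<close>, or to the right. The middle part gives the reassociated product.\<close>
  also have "\<dots> = (\<Sum>i<Suc a. (\<Sum>j\<in>{0..<i}. T i j) + (\<Sum>j\<in>{i..<i + Suc b}. T i j) + (\<Sum>j\<in>{i + Suc b..<Suc (a + b)}. T i j))"
  proof (rule sum.cong[OF refl])
    fix i assume "i \<in> {..<Suc a}"
    hence "i + Suc b \<le> Suc (a + b)" by simp
    thus "(\<Sum>j\<in>{0..<Suc (a + b)}. T i j) =
      (\<Sum>j\<in>{0..<i}. T i j) + (\<Sum>j\<in>{i..<i + Suc b}. T i j) + (\<Sum>j\<in>{i + Suc b..<Suc (a + b)}. T i j)"
      by (simp only: sum.atLeastLessThan_concat zero_le le_add1)
  qed
  also have "\<dots> = (\<Sum>i<Suc a. \<Sum>j\<in>{0..<i}. T i j) + (\<Sum>i<Suc a. \<Sum>j\<in>{i..<i + Suc b}. T i j) +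
      (\<Sum>i<Suc a. \<Sum>j\<in>{i + Suc b..<Suc (a + b)}. T i j)"
    by (simp only: sum.distrib)
  also have "(\<Sum>i<Suc a. \<Sum>j\<in>{i..<i + Suc b}. T i j) = pre_lie a (b + c) f (pre_lie b c g h)"
  proof -
    have "(\<Sum>j\<in>{i..<i + Suc b}. T i j) = sg (int (i * (b + c))) (circ_at i (Suc (b + c)) f (pre_lie b c g h))" for i
    proof -
      have "(\<Sum>j\<in>{i..<i + Suc b}. T i j) = (\<Sum>j<Suc b. T i (i + j))"
        using sum.shift_bounds_nat_ivl[of "T i" 0 i "Suc b"] by (simp add: lessThan_atLeast0 add.commute)
      also have "\<dots> = (\<Sum>j<Suc b. sg (int (i * (b + c))) (sg (int (j * c)) (circ_at i (Suc (b + c)) f (circ_at j (Suc c) g h))))"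
      proof (rule sum.cong[OF refl])
        fix j assume "j \<in> {..<Suc b}"
        hence "j \<le> b" by simp
        thus "T i (i + j) = sg (int (i * (b + c))) (sg (int (j * c)) (circ_at i (Suc (b + c)) f (circ_at j (Suc c) g h)))"
          by (simp add: T_def circ_at_nested sg_sg algebra_simps)
      qed
      also have "\<dots> = sg (int (i * (b + c))) (circ_at i (Suc (b + c)) f (pre_lie b c g h))"
        unfolding pre_lie_def using f
        by (simp only: circ_at_sum_right circ_at_sg_right le_add1 plus_1_eq_Suc sg_sum)
      finally show ?thesis .
    qed
    thus ?thesis by (simp only: pre_lie_def[of a])
  qed
  \<comment> \<open>Slots to the right are shifted back by \<open>b\<close>, the number of extra
    slots that \<open>g\<close> creates; this produces the sign with exponent
    \<open>b * c\<close>.\<close>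
  also have "(\<Sum>i<Suc a. \<Sum>j\<in>{i + Suc b..<Suc (a + b)}. T i j) = sg (int (b * c)) (parallel_sum a b c f g h)"
  proof -
    have "(\<Sum>j\<in>{i + Suc b..<Suc (a + b)}. T i j) = (\<Sum>j\<in>{Suc i..<Suc a}. T i (j + b))" for i
      using sum.shift_bounds_nat_ivl[of "T i" "Suc i" b "Suc a"] by simp
    moreover have "T i (j + b) = sg (int (b * c)) (sg (int (i * b + j * c)) (circ_at (j + b) (Suc c) (circ_at i (Suc b) f g) h))" for i j
      by (simp add: T_def sg_sg algebra_simps)
    ultimately show ?thesis by (simp only: parallel_sum_def sg_sum)
  qed
  \<comment> \<open>On the left, the parallel axiom lets \<open>h\<close> be inserted first, and the
    two slots are then named in the other order.\<close>
  also have "(\<Sum>i<Suc a. \<Sum>j\<in>{0..<i}. T i j) = parallel_sum a c b f h g"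
  proof -
    have "(\<Sum>i<Suc a. \<Sum>j\<in>{0..<i}. T i j) = (\<Sum>(i, j)\<in>Sigma {..<Suc a} (\<lambda>i. {0..<i}). T i j)"
      by (rule sum.Sigma) auto
    also have "\<dots> = (\<Sum>(j, i)\<in>Sigma {..<Suc a} (\<lambda>j. {Suc j..<Suc a}). T i j)"
      by (rule sum.reindex_bij_witness[of _ "\<lambda>(j, i). (i, j)" "\<lambda>(i, j). (j, i)"]) auto
    also have "\<dots> = (\<Sum>j<Suc a. \<Sum>i\<in>{Suc j..<Suc a}. T i j)"
      by (rule sum.Sigma[symmetric]) auto
    also have "\<dots> = parallel_sum a c b f h g"
      unfolding parallel_sum_def T_def
      by (intro sum.cong refl) (simp add: circ_at_parallel add.commute)
    finally show ?thesis .
  qed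
  finally show ?thesis by (simp only: ac_simps)
qed

text \<open>Exchanging \<open>(b, g)\<close> with \<open>(c, h)\<close> interchanges the two
  parallel sums, up to the sign with exponent \<open>b * c\<close>.\<close>

lemma pre_lie_identity:
  assumes "f \<in> cochains"
  shows "pre_lie (a + b) c (pre_lie a b f g) h - pre_lie a (b + c) f (pre_lie b c g h) =
    sg (int (b * c)) (pre_lie (a + c) b (pre_lie a c f h) g - pre_lie a (c + b) f (pre_lie c b h g))"
  unfolding associator[OF assms] by (simp add: sg_add sg_sg mult.commute) (simp add: sg_def)

definition bracket :: "nat \<Rightarrow> nat \<Rightarrow> 'b cochain \<Rightarrow> 'b cochain \<Rightarrow> 'b cochain" where
  "bracket a b f g = pre_lie a b f g - sg (int (a * b)) (pre_lie b a g f)"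

lemma bracket_antisym: "bracket a b f g = - sg (int (a * b)) (bracket b a g f)"
  by (simp add: bracket_def sg_def mult.commute)

text \<open>The three double brackets expand into twelve iterated products, which cancel by three
  instances of the pre-Lie identity, with \<open>f\<close>, \<open>g\<close> and \<open>h\<close> in
  turn as the first factor.\<close>

lemma bracket_jacobi:
  assumes f: "f \<in> cochains" and g: "g \<in> cochains" and h: "h \<in> cochains"
  shows "bracket (a + b) c (bracket a b f g) h =
    bracket a (b + c) f (bracket b c g h) + sg (int (b * c)) (bracket (a + c) b (bracket a c f h) g)"
proof -
  note rules = pre_lie_cochains f g h
  have lin: "pre_lie m n (x - sg k y) z = pre_lie m n x z - sg k (pre_lie m n y z)" for m n k x y z
    using pre_lie_add_left[of m n x "- sg k y" z] pre_lie_sg_left[of m n "k + 1" y z]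
    by (simp add: sg_def split: if_splits)
  have lin': "pre_lie m n z (x - sg k y) = pre_lie m n z x - sg k (pre_lie m n z y)" if "z \<in> cochains" for m n k x y z
    using pre_lie_add_right[OF that, of m n x "- sg k y"] pre_lie_sg_right[OF that, of m n "k + 1" y]
    by (simp add: sg_def split: if_splits)
  note ids = pre_lie_identity[OF f, of a b c g h] pre_lie_identity[OF g, of b a c f h] pre_lie_identity[OF h, of c a b f g]
  show ?thesis
    using ids
    by (simp add: bracket_def lin lin' rules) (simp add: sg_def algebra_simps split: if_splits)
qed

end

section \<open>The graded Lie algebra of cochains\<close>

lemma int_graded_cases:
  assumes "x \<in> int_graded W n"
  obtains k where "n = int k" "x \<in> W k" | "x = 0"
  using assms by (cases "n \<ge> 0") (auto simp: int_graded_def intro: nonneg_int_cases)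

context cochain_space
begin

lemma CY_iff: "f \<in> CY s (Suc n) \<longleftrightarrow> f \<in> cochains \<and> (\<forall>y as. length as \<noteq> Suc n \<longrightarrow> f y as = 0)"
proof
  assume f: "f \<in> CY s (Suc n)"
  have "multilinear_on s UNIV s (size y) (f y)" for y
  proof (cases "size y = Suc n")
    case False
    hence "f y = (\<lambda>as. 0)" using f by (auto simp: CY_def Y_def)
    thus ?thesis by (simp add: multilinear_on_def)
  qed (use f in \<open>auto simp: CY_def Y_def\<close>)
  moreover have "f y as = 0" if "size y \<noteq> length as \<or> as = []" for y as
    using f that by (cases "size y = Suc n") (auto simp: CY_def Y_def)
  ultimately show "f \<in> cochains \<and> (\<forall>y as. length as \<noteq> Suc n \<longrightarrow> f y as = 0)"
    using f by (auto simp: cochains_def CY_def)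
next
  assume "f \<in> cochains \<and> (\<forall>y as. length as \<noteq> Suc n \<longrightarrow> f y as = 0)"
  hence f: "\<And>y. multilinear_on s UNIV s (size y) (f y)" "\<And>y as. size y \<noteq> length as \<Longrightarrow> f y as = 0"
    "\<And>y as. length as \<noteq> Suc n \<Longrightarrow> f y as = 0"
    by (auto simp: cochains_def)
  have "f y as = 0" if "size y \<noteq> Suc n \<or> length as \<noteq> Suc n" for y as
    using f(2)[of y as] f(3)[of as y] that by linarith
  moreover have "multilinear_on s UNIV s (Suc n) (f y)" if "size y = Suc n" for y
    using f(1)[of y] that by simp
  ultimately show "f \<in> CY s (Suc n)" by (simp add: CY_def Y_def)
qed

lemma CY_cochains: "f \<in> CY s (Suc n) \<Longrightarrow> f \<in> cochains"
  by (simp add: CY_iff)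

lemma CY_length: "f \<in> CY s (Suc n) \<Longrightarrow> length as \<noteq> Suc n \<Longrightarrow> f y as = 0"
  by (simp add: CY_iff)

lemma subspace_CY: "cochain.subspace (CY s (Suc n))"
  using cochain.subspace_add[OF subspace_cochains] cochain.subspace_scale[OF subspace_cochains]
    cochain.subspace_0[OF subspace_cochains]
  by (auto simp: cochain.subspace_def CY_iff cochain_scale_def)

text \<open>If \<open>g\<close> is handed a block of the wrong length, it returns 0, and
  \<open>f\<close> vanishes on a list with an entry 0. If the block fits, it is \<open>f\<close>
  that sees a list of the wrong length.\<close>

lemma circ_at_CY:
  assumes f: "f \<in> CY s (Suc a)" and g: "g \<in> CY s (Suc b)" and "b' \<noteq> b \<or> length as \<noteq> a + b + 1"
  shows "circ_at i (Suc b') f g y as = 0"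
proof (cases "b' = b")
  case True
  hence "length as \<noteq> a + b + 1" using assms by simp
  thus ?thesis using True by (auto simp: circ_at_def intro!: CY_length[OF f])
next
  case False
  hence "i + Suc b' \<le> length as \<Longrightarrow> g (inner i (Suc b') y) (take (Suc b') (drop i as)) = 0"
    by (intro CY_length[OF g]) auto
  thus ?thesis using cochains_zero_entry[OF CY_cochains[OF f]] by (simp add: circ_at_def)
qed

lemma pre_lie_CY:
  assumes "f \<in> CY s (Suc a)" "g \<in> CY s (Suc b)" "b' \<noteq> b \<or> length as \<noteq> a + b + 1"
  shows "pre_lie a' b' f g y as = 0"
  unfolding pre_lie_def sum_apply2 sg_apply2 by (simp only: circ_at_CY[OF assms] sg_zero sum.neutral_const)

lemma bracket_CY:
  assumes f: "f \<in> CY s (Suc a)" and g: "g \<in> CY s (Suc b)"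
  shows "bracket a b f g \<in> CY s (Suc (a + b))"
  unfolding CY_iff
proof (intro conjI allI impI)
  show "bracket a b f g \<in> cochains"
    unfolding bracket_def
    by (intro cochains_closed(3) cochains_closed(4) pre_lie_cochains CY_cochains[OF f] CY_cochains[OF g])
  fix y and as :: "'b list" assume "length as \<noteq> Suc (a + b)"
  thus "bracket a b f g y as = 0"
    by (simp add: bracket_def sg_apply2 pre_lie_CY[OF f g] pre_lie_CY[OF g f])
qed

text \<open>Among the decompositions of the list length into two arities, only the one by the
  arities of \<open>f\<close> and \<open>g\<close> contributes.\<close>

lemma MM_bracket_CY:
  assumes f: "f \<in> CY s (Suc a)" and g: "g \<in> CY s (Suc b)"
  shows "MM_bracket s f g = bracket a b f g"
proof (intro ext)
  fix y as
  let ?t = "\<lambda>a'. pre_lie a' (length as - 1 - a') f g y as -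
    sg (int (a' * (length as - 1 - a'))) (pre_lie (length as - 1 - a') a' g f y as)"
  have t0: "?t a' = 0" if "a' \<in> {..<length as}" "a' \<noteq> a \<or> length as \<noteq> a + b + 1" for a'
  proof -
    have "length as - 1 - a' \<noteq> b \<or> length as \<noteq> a + b + 1" "a' \<noteq> a \<or> length as \<noteq> b + a + 1" using that by auto
    thus ?thesis by (simp only: pre_lie_CY[OF f g] pre_lie_CY[OF g f] sg_zero diff_self)
  qed
  show "MM_bracket s f g y as = bracket a b f g y as"
  proof (cases "length as = a + b + 1")
    case True
    have "MM_bracket s f g y as = (\<Sum>a'\<in>{a}. ?t a')"
      unfolding MM_bracket_eq[OF vector_space_axioms]
      by (rule sum.mono_neutral_right) (use t0 True in auto)
    thus ?thesis using True by (simp add: bracket_def sg_apply2)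
  next
    case False
    have "MM_bracket s f g y as = 0"
      unfolding MM_bracket_eq[OF vector_space_axioms] by (rule sum.neutral) (use t0 False in blast)
    thus ?thesis using CY_length[OF bracket_CY[OF f g], of as y] False by simp
  qed
qed

lemma pre_lie_lin:
  "pre_lie a b (cochain_scale s c f + f') g = cochain_scale s c (pre_lie a b f g) + pre_lie a b f' g"
  "f \<in> cochains \<Longrightarrow> pre_lie a b f (cochain_scale s c g + g') = cochain_scale s c (pre_lie a b f g) + pre_lie a b f g'"
proof -
  have sc: "sg k (cochain_scale s c x) = cochain_scale s c (sg k x)" for k x
    by (simp add: sg_def)
  show "pre_lie a b (cochain_scale s c f + f') g = cochain_scale s c (pre_lie a b f g) + pre_lie a b f' g"
    unfolding pre_lie_def by (simp only: circ_at_lin_left sg_add sum.distrib sc cochain.scale_sum_right)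
  assume "f \<in> cochains"
  thus "pre_lie a b f (cochain_scale s c g + g') = cochain_scale s c (pre_lie a b f g) + pre_lie a b f g'"
    unfolding pre_lie_def
    by (simp only: circ_at_lin_right le_add1 plus_1_eq_Suc sg_add sum.distrib sc cochain.scale_sum_right)
qed

lemma MM_bracket_cochains:
  assumes "f \<in> cochains" "g \<in> cochains"
  shows "MM_bracket s f g \<in> cochains"
proof (rule cochains_local)
  fix N
  let ?G = "\<Sum>a<N. bracket a (N - 1 - a) f g"
  have "?G \<in> cochains"
    using assms by (auto intro!: cochains_closed(5) cochains_closed(3) cochains_closed(4) pre_lie_cochains simp: bracket_def)
  moreover have "MM_bracket s f g y as = ?G y as" if "length as = N" for y as
    using that unfolding MM_bracket_eq[OF vector_space_axioms] sum_apply2 by (simp add: bracket_def sg_apply2)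
  ultimately show "\<exists>G\<in>cochains. \<forall>y as. length as = N \<longrightarrow> MM_bracket s f g y as = G y as" by blast
qed

lemma MM_bracket_lin:
  assumes "f \<in> cochains" "f' \<in> cochains" "g \<in> cochains"
  shows "MM_bracket s (cochain_scale s c f + f') g = cochain_scale s c (MM_bracket s f g) + MM_bracket s f' g"
    and "MM_bracket s g (cochain_scale s c f + f') = cochain_scale s c (MM_bracket s g f) + MM_bracket s g f'"
proof -
  have sc: "sg k (s c x) = s c (sg k x)" for k x by (simp add: sg_def)
  have l1: "pre_lie a b (cochain_scale s c f + f') g y as = s c (pre_lie a b f g y as) + pre_lie a b f' g y as" for a b y as
    unfolding pre_lie_lin(1) by (simp add: cochain_scale_def)
  have l2: "pre_lie a b g (cochain_scale s c f + f') y as = s c (pre_lie a b g f y as) + pre_lie a b g f' y as" for a b y as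
    unfolding pre_lie_lin(2)[OF assms(3)] by (simp add: cochain_scale_def)
  have "MM_bracket s (cochain_scale s c f + f') g y as = s c (MM_bracket s f g y as) + MM_bracket s f' g y as" for y as
    unfolding MM_bracket_eq[OF vector_space_axioms] scale_sum_right sum.distrib[symmetric]
    by (rule sum.cong) (simp_all add: l1 l2 sg_add sc scale_right_diff_distrib)
  thus "MM_bracket s (cochain_scale s c f + f') g = cochain_scale s c (MM_bracket s f g) + MM_bracket s f' g"
    by (intro ext) (simp add: cochain_scale_def)
  have "MM_bracket s g (cochain_scale s c f + f') y as = s c (MM_bracket s g f y as) + MM_bracket s g f' y as" for y as
    unfolding MM_bracket_eq[OF vector_space_axioms] scale_sum_right sum.distrib[symmetric]
    by (rule sum.cong) (simp_all add: l1 l2 sg_add sc scale_right_diff_distrib)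
  thus "MM_bracket s g (cochain_scale s c f + f') = cochain_scale s c (MM_bracket s g f) + MM_bracket s g f'"
    by (intro ext) (simp add: cochain_scale_def)
qed

lemma MM_bracket_0:
  assumes "f \<in> cochains"
  shows "MM_bracket s 0 f = 0" "MM_bracket s f 0 = 0"
  using MM_bracket_lin[of 0 0 f 1] assms cochains_closed(1) by simp_all

definition cochain_deg :: "int \<Rightarrow> 'b cochain set" where
  "cochain_deg = int_graded (\<lambda>n. CY s (Suc n))"

lemma cochain_degE:
  assumes "f \<in> cochain_deg n"
  obtains k where "n = int k" "f \<in> CY s (Suc k)" | "f = 0"
  using assms unfolding cochain_deg_def by (rule int_graded_cases)

lemma cochain_deg_cochains: "f \<in> cochain_deg n \<Longrightarrow> f \<in> cochains"
  by (erule cochain_degE) (auto simp: CY_cochains cochains_closed(1))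

lemma subspace_cochain_deg: "cochain.subspace (cochain_deg n)"
  by (auto simp: cochain_deg_def int_graded_def subspace_CY cochain.subspace_single_0)

lemma zero_cochain_deg: "0 \<in> cochain_deg n"
  using subspace_cochain_deg by (rule cochain.subspace_0)

lemma cochain_deg_length:
  "f \<in> cochain_deg n \<Longrightarrow> int (length as) \<noteq> n + 1 \<Longrightarrow> f y as = 0"
  by (erule cochain_degE) (auto simp: CY_length)

text \<open>Cochains of different degrees are supported on lists of different lengths.\<close>

lemma cochain_deg_indep:
  assumes "finite I" "\<And>i. i \<in> I \<Longrightarrow> f i \<in> cochain_deg i" "(\<Sum>i\<in>I. f i) = 0" "i \<in> I"
  shows "f i = 0"
proof (intro ext)
  fix y as
  show "f i y as = 0 y as"
  proof (cases "int (length as) = i + 1")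
    case True
    have "(\<Sum>j\<in>I. f j) y as = (\<Sum>j\<in>I. f j y as)" by (rule sum_apply2)
    also have "\<dots> = (\<Sum>j\<in>{i}. f j y as)"
    proof (rule sum.mono_neutral_right)
      show "\<forall>j\<in>I - {i}. f j y as = 0"
        using True cochain_deg_length[OF assms(2)] by force
    qed (use assms in auto)
    finally show ?thesis using assms(3) by simp
  qed (use cochain_deg_length[OF assms(2)[OF assms(4)]] in simp)
qed

lemma MM_bracket_deg:
  assumes "f \<in> cochain_deg a" "g \<in> cochain_deg b"
  shows "MM_bracket s f g \<in> cochain_deg (a + b)"
  using assms(1)
proof (cases rule: cochain_degE)
  case f: (1 k)
  from assms(2) show ?thesis
  proof (cases rule: cochain_degE)
    case g: (1 m)
    thus ?thesis using f bracket_CY[of f k g m] MM_bracket_CY[of f k g m]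
      by (simp add: cochain_deg_def int_graded_def nat_add_distrib)
  qed (use assms in \<open>simp add: MM_bracket_0 cochain_deg_cochains zero_cochain_deg\<close>)
qed (use assms in \<open>simp add: MM_bracket_0 cochain_deg_cochains zero_cochain_deg\<close>)

lemma MM_bracket_antisym:
  assumes "f \<in> cochain_deg a" "g \<in> cochain_deg b"
  shows "MM_bracket s f g = - sg (a * b) (MM_bracket s g f)"
  using assms(1)
proof (cases rule: cochain_degE)
  case f: (1 k)
  from assms(2) show ?thesis
  proof (cases rule: cochain_degE)
    case g: (1 m)
    show ?thesis using bracket_antisym[of k m f g] f g MM_bracket_CY[of f k g m] MM_bracket_CY[of g m f k] by simp
  qed (use assms in \<open>simp add: MM_bracket_0 cochain_deg_cochains\<close>)
qed (use assms in \<open>simp add: MM_bracket_0 cochain_deg_cochains\<close>)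

lemma MM_bracket_jacobi:
  assumes "f \<in> cochain_deg a" "g \<in> cochain_deg b" "h \<in> cochain_deg c"
  shows "MM_bracket s (MM_bracket s f g) h = MM_bracket s f (MM_bracket s g h) + sg (b * c) (MM_bracket s (MM_bracket s f h) g)"
proof -
  have C: "f \<in> cochains" "g \<in> cochains" "h \<in> cochains" using assms cochain_deg_cochains by auto
  note zero = MM_bracket_0 MM_bracket_cochains C cochains_closed(1)
  consider "f = 0 \<or> g = 0 \<or> h = 0" | i j k where "a = int i" "b = int j" "c = int k"
    "f \<in> CY s (Suc i)" "g \<in> CY s (Suc j)" "h \<in> CY s (Suc k)"
    using assms by (metis cochain_degE)
  thus ?thesis
  proof cases
    case 1
    thus ?thesis by (elim disjE) (simp_all add: zero)
  next
    case 2
    note B = bracket_CY[OF 2(4,5)] bracket_CY[OF 2(5,6)] bracket_CY[OF 2(4,6)]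
    note M = MM_bracket_CY[OF 2(4,5)] MM_bracket_CY[OF 2(5,6)] MM_bracket_CY[OF 2(4,6)]
      MM_bracket_CY[OF B(1) 2(6)] MM_bracket_CY[OF 2(4) B(2)] MM_bracket_CY[OF B(3) 2(5)]
    show ?thesis unfolding M using bracket_jacobi[OF C, of i j k] by (simp add: 2)
  qed
qed

text \<open>Expanding each entry as \<open>\<phi> x + \<psi> x\<close>, one after the other, reduces
  a multilinear map to its values on lists of pure entries.\<close>

lemma cochain_eq_0:
  assumes f: "f \<in> cochains" and \<phi>: "\<And>x. x = \<phi> x + \<psi> x"
    and pure: "\<And>y as. size y = length as \<Longrightarrow> set as \<subseteq> range \<phi> \<union> range \<psi> \<Longrightarrow> f y as = 0"
  shows "f = 0"
proof -
  have "f y (P @ Q) = 0" if "set P \<subseteq> range \<phi> \<union> range \<psi>" "size y = length (P @ Q)" for y P Q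
    using that
  proof (induction Q arbitrary: P)
    case Nil
    thus ?case using pure[of y P] by simp
  next
    case (Cons x Q)
    have "f y (P @ z # Q) = 0" if "z \<in> range \<phi> \<union> range \<psi>" for z
      using Cons.IH[of "P @ [z]"] Cons.prems that by simp
    hence "f y (P @ \<phi> x # Q) = 0" "f y (P @ \<psi> x # Q) = 0" by auto
    hence "f y (P @ (\<phi> x + \<psi> x) # Q) = 0"
      using cochains_add[OF f, of P Q y "\<phi> x" "\<psi> x"] Cons.prems by simp
    thus ?case using \<phi>[of x] by simp
  qed
  from this[of "[]"] have "f y as = 0" for y as
    using f unfolding cochains_iff by (cases "size y = length as") auto
  thus ?thesis by (intro ext) simp
qed

end

section \<open>The direct sum\<close>

locale direct_sum = A: vector_space sA + M: vector_space sM
  for sA :: "'k::field_char_0 \<Rightarrow> 'a::ab_group_add \<Rightarrow> 'a" and sM :: "'k \<Rightarrow> 'm::ab_group_add \<Rightarrow> 'm"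
begin

abbreviation sD :: "'k \<Rightarrow> 'a \<times> 'm \<Rightarrow> 'a \<times> 'm" where
  "sD \<equiv> module_prod.scale sA sM"

lemma sD_eq: "sD c x = (sA c (fst x), sM c (snd x))"
  using module_prod.scale_def[of sA sM] A.module_axioms M.module_axioms
  by (simp add: module_prod_def module_pair_def)

sublocale D: cochain_space sD
  by unfold_locales
    (simp_all add: sD_eq prod_eq_iff A.scale_right_distrib A.scale_left_distrib M.scale_right_distrib M.scale_left_distrib)

abbreviation brD :: "('a \<times> 'm) cochain \<Rightarrow> ('a \<times> 'm) cochain \<Rightarrow> ('a \<times> 'm) cochain" where
  "brD \<equiv> MM_bracket sD"

section \<open>Bidegrees and the projection onto \<open>a\<close>\<close>

definition pure_at :: "nat set \<Rightarrow> ('a \<times> 'm) list \<Rightarrow> bool" where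
  "pure_at S as \<longleftrightarrow> S \<subseteq> {..<length as} \<and> (\<forall>i\<in>S. snd (as ! i) = 0) \<and> (\<forall>i\<in>{..<length as} - S. fst (as ! i) = 0)"

text \<open>The values allowed to a cochain of bidegree \<open>k|l\<close> on a summand with
  \<open>c\<close> factors \<open>A\<close>; here \<open>l\<close> is determined by the
  arity.\<close>

definition bideg_values :: "int \<Rightarrow> nat \<Rightarrow> ('a \<times> 'm) set" where
  "bideg_values k c = {x. if int c = k + 1 then snd x = 0 else if int c = k then fst x = 0 else x = 0}"

lemma bideg_values_closed: "0 \<in> bideg_values k c" "x \<in> bideg_values k c \<Longrightarrow> x' \<in> bideg_values k c \<Longrightarrow> x + x' \<in> bideg_values k c"
  "x \<in> bideg_values k c \<Longrightarrow> sD a x \<in> bideg_values k c"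
  by (auto simp: bideg_values_def sD_eq zero_prod_def split: if_splits)

text \<open>A cochain vanishes outside its arity and 0 is always an allowed value, which leaves a
  condition on pure lists alone. The premise covers the bidegrees \<open>n|0\<close> and
  \<open>-1|n+1\<close> alike.\<close>

lemma CY_bideg_iff:
  assumes "nat (k + l + 1) = Suc n"
  shows "f \<in> CY_bideg sA sM k l \<longleftrightarrow>
    f \<in> CY sD (Suc n) \<and> (\<forall>y as S. pure_at S as \<longrightarrow> f y as \<in> bideg_values k (card S))" (is "_ \<longleftrightarrow> ?R")
proof
  assume f: "f \<in> CY_bideg sA sM k l"
  hence CY: "f \<in> CY sD (Suc n)" using assms by (simp add: CY_bideg_def)
  have "f y as \<in> bideg_values k (card S)" if "pure_at S as" for y as S
  proof (cases "y \<in> Y (Suc n) \<and> length as = Suc n")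
    case True
    have "\<forall>y as S. y \<in> Y (Suc n) \<and> length as = Suc n \<and> S \<subseteq> {..<length as} \<and>
        (\<forall>i\<in>S. snd (as ! i) = 0) \<and> (\<forall>i\<in>{..<length as} - S. fst (as ! i) = 0) \<longrightarrow>
        (if int (card S) = k + 1 then snd (f y as) = 0
         else if int (card S) = k then fst (f y as) = 0
         else f y as = 0)"
      using f unfolding CY_bideg_def mem_Collect_eq assms by (rule conjunct2)
    from mp[OF spec[OF spec[OF spec[OF this, of y], of as], of S]] show ?thesis
      using True that unfolding bideg_values_def pure_at_def mem_Collect_eq by blast
  next
    case False
    hence "f y as = 0" using CY unfolding CY_def by auto
    thus ?thesis by (simp add: bideg_values_closed)
  qed
  thus ?R using CY by blast
next
  assume R: ?R
  show "f \<in> CY_bideg sA sM k l"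
    unfolding CY_bideg_def mem_Collect_eq assms
  proof (intro conjI allI impI)
    fix y and as :: "('a \<times> 'm) list" and S
    assume "y \<in> Y (Suc n) \<and> length as = Suc n \<and> S \<subseteq> {..<length as} \<and>
        (\<forall>i\<in>S. snd (as ! i) = 0) \<and> (\<forall>i\<in>{..<length as} - S. fst (as ! i) = 0)"
    hence "f y as \<in> bideg_values k (card S)" using R unfolding pure_at_def by blast
    thus "if int (card S) = k + 1 then snd (f y as) = 0
         else if int (card S) = k then fst (f y as) = 0 else f y as = 0"
      unfolding bideg_values_def mem_Collect_eq .
  qed (use R in blast)
qed

lemma a_deg_iff: "f \<in> a_deg sA sM n \<longleftrightarrow>
    f \<in> CY sD (Suc n) \<and> (\<forall>y as S. pure_at S as \<longrightarrow> f y as \<in> bideg_values (- 1) (card S))"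
  unfolding a_deg_def by (rule CY_bideg_iff) arith

lemma h_deg_iff: "f \<in> h_deg sA sM n \<longleftrightarrow>
    f \<in> CY sD (Suc n) \<and> (\<forall>y as S. pure_at S as \<longrightarrow> f y as \<in> bideg_values (int n) (card S))"
  unfolding h_deg_def by (rule CY_bideg_iff) arith

lemma subspace_bideg:
  assumes "\<And>f. f \<in> W \<longleftrightarrow> f \<in> CY sD (Suc n) \<and> (\<forall>y as S. pure_at S as \<longrightarrow> f y as \<in> bideg_values k (card S))"
  shows "D.cochain.subspace W"
proof (rule D.cochain.subspaceI)
  note sub = D.subspace_CY[of n]
  show "0 \<in> W"
    using D.cochain.subspace_0[OF sub] by (simp add: assms bideg_values_closed)
  show "cochain_scale sD c f \<in> W" if "f \<in> W" for c f
    using D.cochain.subspace_scale[OF sub, of f c] that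
    unfolding assms by (simp add: bideg_values_closed cochain_scale_def[of sD c f])
  show "f + g \<in> W" if "f \<in> W" "g \<in> W" for f g
    using D.cochain.subspace_add[OF sub, of f g] that
    unfolding assms by (simp add: bideg_values_closed)
qed

lemma a_deg_CY: "f \<in> a_deg sA sM n \<Longrightarrow> f \<in> CY sD (Suc n)"
  by (simp add: a_deg_iff)

lemma h_deg_CY: "f \<in> h_deg sA sM n \<Longrightarrow> f \<in> CY sD (Suc n)"
  by (simp add: h_deg_iff)

lemma cochain_eq_0_pure:
  assumes f: "f \<in> D.cochains"
    and pure: "\<And>y as S. size y = length as \<Longrightarrow> pure_at S as \<Longrightarrow> f y as = 0"
  shows "f = 0"
proof (rule D.cochain_eq_0[OF f, where \<phi> = "\<lambda>x. (fst x, 0)" and \<psi> = "\<lambda>x. (0, snd x)"])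
  fix y :: "unit tree" and as :: "('a \<times> 'm) list"
  assume len: "size y = length as" and as: "set as \<subseteq> range (\<lambda>x. (fst x, 0)) \<union> range (\<lambda>x. (0, snd x))"
  have "fst (as ! i) = 0 \<or> snd (as ! i) = 0" if "i < length as" for i
    using as nth_mem[OF that] by auto
  \<comment> \<open>An entry 0 belongs to both summands; here it is counted as a factor
    \<open>A\<close>.\<close>
  hence "pure_at {i. i < length as \<and> snd (as ! i) = 0} as" by (auto simp: pure_at_def)
  with len show "f y as = 0" by (rule pure)
qed simp

lemma proj_a_append: "proj_a f y (P @ x # Q) =
    (fst (f y (map (\<lambda>x. (0, snd x)) P @ (0, snd x) # map (\<lambda>x. (0, snd x)) Q)), 0)"
  by (simp add: proj_a_def)

lemma proj_a_lin: "proj_a (cochain_scale sD c f + g) = cochain_scale sD c (proj_a f) + proj_a g"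
  by (intro ext) (simp add: proj_a_def cochain_scale_def sD_eq)

lemma proj_a_cochains:
  assumes "f \<in> D.cochains"
  shows "proj_a f \<in> D.cochains"
  unfolding D.cochains_iff
proof (intro conjI allI impI)
  fix y :: "unit tree" and P Q :: "('a \<times> 'm) list" and c and x x' :: "'a \<times> 'm"
  assume len: "length P + length Q + 1 = size y"
  let ?m = "map (\<lambda>x. (0, snd x))"
  have "f y (?m P @ (sD c (0, snd x) + (0, snd x')) # ?m Q) =
      sD c (f y (?m P @ (0, snd x) # ?m Q)) + f y (?m P @ (0, snd x') # ?m Q)"
    by (rule D.cochains_lin[OF assms]) (use len in simp)
  moreover have "sD c (0, snd x) + (0, snd x') = (0, snd (sD c x + x'))" by (simp add: sD_eq)
  ultimately show "proj_a f y (P @ (sD c x + x') # Q) = sD c (proj_a f y (P @ x # Q)) + proj_a f y (P @ x' # Q)"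
    unfolding proj_a_append by (simp add: sD_eq)
next
  fix y :: "unit tree" and as :: "('a \<times> 'm) list"
  assume "size y \<noteq> length as \<or> as = []"
  thus "proj_a f y as = 0" using assms unfolding D.cochains_iff by (simp add: proj_a_def zero_prod_def)
qed

lemma proj_a_a_deg:
  assumes "f \<in> CY sD (Suc n)"
  shows "proj_a f \<in> a_deg sA sM n"
proof -
  have f: "f \<in> D.cochains" using assms by (rule D.CY_cochains)
  have "proj_a f \<in> CY sD (Suc n)"
    unfolding D.CY_iff using proj_a_cochains[OF f] D.CY_length[OF assms] by (simp add: proj_a_def zero_prod_def)
  moreover have "proj_a f y as \<in> bideg_values (- 1) (card S)" if "pure_at S as" for y S as
  proof (cases "S = {}")
    case False
    then obtain i where "i \<in> S" by blast
    hence i: "i < length as" "snd (as ! i) = 0" using that by (auto simp: pure_at_def)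
    have "as = take i as @ as ! i # drop (Suc i) as" using i by (simp add: id_take_nth_drop)
    \<comment> \<open>Dropping the \<open>A\<close> parts turns an entry from \<open>A\<close> into
      0, so the value is 0 as soon as \<open>S\<close> is nonempty.\<close>
    hence "proj_a f y as = (fst (f y (map (\<lambda>x. (0, snd x)) (take i as) @ 0 # map (\<lambda>x. (0, snd x)) (drop (Suc i) as))), 0)"
      using proj_a_append[of f y "take i as" "as ! i" "drop (Suc i) as"] i by (simp add: zero_prod_def)
    hence "proj_a f y as = (0, 0)" by (simp only: D.cochains_zero_entry[OF f] fst_zero)
    thus ?thesis by (simp add: bideg_values_closed flip: zero_prod_def)
  qed (simp add: bideg_values_def proj_a_def)
  ultimately show ?thesis by (simp add: a_deg_iff)
qed

text \<open>The two sides are compared on pure lists. In bidegree \<open>-1|n+1\<close> only lists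
  from \<open>M\<close> give nonzero values, and dropping \<open>A\<close> parts leaves such lists
  unchanged.\<close>

lemma proj_a_id:
  assumes "f \<in> a_deg sA sM n"
  shows "proj_a f = f"
proof -
  have fCY: "f \<in> CY sD (Suc n)" using assms by (rule a_deg_CY)
  have "f - proj_a f = 0"
  proof (rule cochain_eq_0_pure)
    show "f - proj_a f \<in> D.cochains"
      using fCY by (intro D.cochains_closed(3) proj_a_cochains D.CY_cochains)
  next
    fix y :: "unit tree" and as :: "('a \<times> 'm) list" and S
    assume S: "pure_at S as"
    have v: "f y as \<in> bideg_values (- 1) (card S)" "proj_a f y as \<in> bideg_values (- 1) (card S)"
      using assms proj_a_a_deg[OF fCY] S unfolding a_deg_iff by blast+
    have fin: "finite S" using S finite_subset by (auto simp: pure_at_def)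
    show "(f - proj_a f) y as = 0"
    proof (cases "S = {}")
      case True
      hence "map (\<lambda>x. (0, snd x)) as = as"
        using S by (intro nth_equalityI) (auto simp: prod_eq_iff pure_at_def)
      thus ?thesis using v(1) True by (simp add: proj_a_def prod_eq_iff bideg_values_def)
    next
      case False
      thus ?thesis using v fin by (simp add: bideg_values_def)
    qed
  qed
  thus ?thesis by simp
qed

lemma proj_a_h_deg:
  assumes "f \<in> h_deg sA sM n"
  shows "proj_a f = 0"
proof (intro ext)
  fix y :: "unit tree" and as :: "('a \<times> 'm) list"
  have "pure_at {} (map (\<lambda>x. (0, snd x)) as)" by (simp add: pure_at_def)
  hence "f y (map (\<lambda>x. (0, snd x)) as) \<in> bideg_values (int n) (card ({} :: nat set))"
    using assms unfolding h_deg_iff by blast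
  hence "fst (f y (map (\<lambda>x. (0, snd x)) as)) = 0"
    by (simp add: bideg_values_def split: if_splits)
  thus "proj_a f y as = 0 y as" by (simp add: proj_a_def zero_prod_def)
qed

lemma proj_a_sum_pre_lie:
  fixes f g :: "('a \<times> 'm) cochain"
  assumes "\<And>i n. 1 \<le> n \<Longrightarrow> fst (circ_at i n f g y as) = 0"
  shows "fst (pre_lie a b f g y as) = 0"
proof -
  have "fst (sg k x) = sg k (fst x)" for k and x :: "'a \<times> 'm" by (simp add: sg_def)
  thus ?thesis unfolding pre_lie_def sum_apply2 sg_apply2 fst_sum
    by (intro sum.neutral ballI) (simp add: assms)
qed

text \<open>The kernel of the projection consists of the maps that send lists from \<open>M\<close>
  into \<open>M\<close>, a property preserved by insertion.\<close>

lemma proj_a_kernel: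
  fixes f g :: "('a \<times> 'm) cochain"
  assumes f: "proj_a f = 0" and g: "proj_a g = 0"
  shows "proj_a (brD f g) = 0"
proof (intro ext)
  fix y :: "unit tree" and as :: "('a \<times> 'm) list"
  have 0: "fst (f y (map (\<lambda>x. (0, snd x)) as)) = 0" if "proj_a f = 0" for f :: "('a \<times> 'm) cochain" and y and as :: "('a \<times> 'm) list"
    using fun_cong[OF fun_cong[OF that], of y as] by (simp add: proj_a_def zero_prod_def)
  have circ: "fst (circ_at i n f g y (map (\<lambda>x. (0, snd x)) as)) = 0" if "proj_a f = 0" "proj_a g = 0" for i n and f g :: "('a \<times> 'm) cochain"
  proof -
    let ?m = "map (\<lambda>x :: 'a \<times> 'm. (0 :: 'a, snd x))"
    let ?u = "g (inner i n y) (?m (take n (drop i as)))"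
    have "?u = (0, snd ?u)" using 0[OF that(2), of "inner i n y" "take n (drop i as)"] by (simp add: prod_eq_iff)
    hence "?m (take i as @ ?u # drop (i + n) as) = ?m (take i as) @ ?u # ?m (drop (i + n) as)" by simp
    thus ?thesis
      using 0[OF that(1), of "outer i n y" "take i as @ ?u # drop (i + n) as"]
      by (simp add: circ_at_def take_map drop_map)
  qed
  have "fst (sg k x) = sg k (fst x)" for k and x :: "'a \<times> 'm" by (simp add: sg_def)
  hence "fst (brD f g y (map (\<lambda>x. (0, snd x)) as)) = 0"
    unfolding MM_bracket_eq[OF D.vector_space_axioms] fst_sum fst_diff
    by (simp add: proj_a_sum_pre_lie circ f g)
  thus "proj_a (brD f g) y as = 0 y as" by (simp add: proj_a_def zero_prod_def)
qed

text \<open>The inserted value lies in \<open>A\<close>, and the outer cochain drops the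
  \<open>A\<close> parts of its entries, hence sees a 0.\<close>

lemma circ_at_proj_a:
  assumes "f \<in> D.cochains"
  shows "circ_at i n (proj_a f) (proj_a g) = 0"
proof (intro ext)
  fix y :: "unit tree" and as :: "('a \<times> 'm) list"
  have "proj_a f y' (P @ (a, 0) # Q) = 0" for y' P a Q
    using D.cochains_zero_entry[OF assms] unfolding proj_a_append by (simp add: zero_prod_def)
  thus "circ_at i n (proj_a f) (proj_a g) y as = 0 y as"
    by (simp add: circ_at_def proj_a_def[of g])
qed

lemma br_a_deg:
  assumes "f \<in> a_deg sA sM a" "g \<in> a_deg sA sM b"
  shows "brD f g = 0"
proof -
  have CY: "f \<in> CY sD (Suc a)" "g \<in> CY sD (Suc b)" using assms by (simp_all add: a_deg_CY)
  have "circ_at i n f g = 0" "circ_at i n g f = 0" for i n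
    using circ_at_proj_a[OF D.CY_cochains[OF CY(1)], of i n g] circ_at_proj_a[OF D.CY_cochains[OF CY(2)], of i n f]
    by (simp_all add: proj_a_id[OF assms(1)] proj_a_id[OF assms(2)])
  thus ?thesis using D.MM_bracket_CY[OF CY] by (simp add: D.bracket_def pre_lie_def)
qed

end

section \<open>Closure of \<open>h\<close> under the bracket\<close>

lemma restrict_id:
  assumes "\<And>x. x \<le> size y \<Longrightarrow> x \<notin> S"
  shows "restrict S y = y"
proof -
  have "delete_leaves {} j y = Some y" for j by (induction y arbitrary: j) simp_all
  hence "restrict {} y = y" by (simp add: restrict_def)
  thus ?thesis using restrict_cong[of y S "{}"] assms by simp
qed

context direct_sum
begin

text \<open>The unary cochain projecting to the first summand.  Its adjoint action has \<open>h_deg sA sM n\<close> as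
  the eigenspace for the eigenvalue \<open>n\<close> in arity \<open>n + 1\<close>, hence the Jacobi identity shows that the
  \<open>h_deg sA sM n\<close> are closed under the bracket.\<close>

definition piA :: "('a \<times> 'm) cochain" where
  "piA = (\<lambda>y as. if size y = 1 \<and> length as = 1 then (fst (as ! 0), 0) else 0)"

lemma piA_CY: "piA \<in> CY sD (Suc 0)"
proof -
  have "piA \<in> D.cochains"
    unfolding D.cochains_iff
    by (auto simp: piA_def sD_eq zero_prod_def)
  thus ?thesis by (simp add: D.CY_iff piA_def)
qed

text \<open>Insertion of a unary cochain deletes no leaves of the outer tree, so \<open>piA\<close>
  just replaces one entry by its \<open>A\<close> part; inserting \<open>f\<close> into
  \<open>piA\<close> projects the value. All signs are trivial because \<open>piA\<close> has degree
  0.\<close>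

lemma bracket_piA:
  assumes f: "f \<in> CY sD (Suc n)" and len: "size y = Suc n" "length as = Suc n"
  shows "brD f piA y as = (\<Sum>i<Suc n. f y (as[i := (fst (as ! i), 0)])) - (fst (f y as), 0)"
proof -
  have "circ_at i (Suc 0) f piA y as = f y (as[i := (fst (as ! i), 0)])" if "i < Suc n" for i
  proof -
    have "outer i (Suc 0) y = y" unfolding outer_def by (rule restrict_id) auto
    moreover have "size (inner i (Suc 0) y) = 1" using sizes(2)[of "Suc 0" i y] that len by simp
    moreover have "take (Suc 0) (drop i as) = [as ! i]" using that len by (simp add: take_Suc_conv_app_nth hd_drop_conv_nth take_Suc)
    ultimately show ?thesis using that len by (simp add: circ_at_def piA_def upd_conv_take_nth_drop)
  qed
  hence 1: "pre_lie n 0 f piA y as = (\<Sum>i<Suc n. f y (as[i := (fst (as ! i), 0)]))"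
    unfolding pre_lie_def sum_apply2 sg_apply2 by (intro sum.cong) simp_all
  have "inner 0 (Suc n) y = y" unfolding inner_def by (rule restrict_id) (use len in auto)
  moreover have "size (outer 0 (Suc n) y) = 1" using sizes(1)[of "Suc n" 0 y] len by simp
  ultimately have "circ_at 0 (Suc n) piA f y as = (fst (f y as), 0)"
    using len by (simp add: circ_at_def piA_def)
  hence 2: "pre_lie 0 n piA f y as = (fst (f y as), 0)"
    by (simp add: pre_lie_def)
  show ?thesis unfolding D.MM_bracket_CY[OF f piA_CY] using 1 2 by (simp add: D.bracket_def)
qed

text \<open>Each position in \<open>S\<close> reproduces the value and every other one yields 0, so
  the sum counts the factors \<open>A\<close>; the last term subtracts 1 from this count on the
  \<open>A\<close> part of the value.\<close>

lemma bracket_piA_pure: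
  assumes f: "f \<in> CY sD (Suc n)" and len: "size y = Suc n" "length as = Suc n" and S: "pure_at S as"
  shows "brD f piA y as = sD (of_nat (card S)) (f y as) - (fst (f y as), 0)"
proof -
  have "f y (as[i := (fst (as ! i), 0)]) = (if i \<in> S then f y as else 0)" if "i < Suc n" for i
  proof (cases "i \<in> S")
    case True
    hence "(fst (as ! i), 0) = as ! i" using S by (auto simp: pure_at_def prod_eq_iff)
    thus ?thesis using True by simp
  next
    case False
    hence "(fst (as ! i), 0) = (0 :: 'a \<times> 'm)" using S that len by (auto simp: pure_at_def zero_prod_def)
    hence "as[i := (fst (as ! i), 0)] = take i as @ 0 # drop (Suc i) as"
      using that len by (simp only: upd_conv_take_nth_drop)
    thus ?thesis by (simp only: False if_False D.cochains_zero_entry[OF D.CY_cochains[OF f]])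
  qed
  hence "(\<Sum>i<Suc n. f y (as[i := (fst (as ! i), 0)])) = (\<Sum>i<Suc n. if i \<in> S then f y as else 0)"
    by (intro sum.cong) simp_all
  also have "\<dots> = (\<Sum>i\<in>S. f y as)"
    using S len by (subst sum.inter_restrict[symmetric]) (auto simp: pure_at_def Int_absorb1)
  finally show ?thesis using bracket_piA[OF f len] by (simp only: D.sum_constant_scale)
qed

text \<open>The eigenvalue is \<open>card S - 1\<close> on values in \<open>A\<close> and
  \<open>card S\<close> on values in \<open>M\<close>. It equals \<open>n\<close> exactly for
  \<open>card S = n + 1\<close> and \<open>card S = n\<close> respectively, which is the condition
  of bidegree \<open>n|0\<close>.\<close>

lemma h_deg_eigenspace:
  assumes f: "f \<in> CY sD (Suc n)"
  shows "f \<in> h_deg sA sM n \<longleftrightarrow> brD f piA = cochain_scale sD (of_nat n) f"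
proof
  have piA: "piA \<in> D.cochains" using piA_CY by (rule D.CY_cochains)
  assume h: "f \<in> h_deg sA sM n"
  have "brD f piA - cochain_scale sD (of_nat n) f = 0"
  proof (rule cochain_eq_0_pure)
    show "brD f piA - cochain_scale sD (of_nat n) f \<in> D.cochains"
      using D.CY_cochains[OF f] piA D.subspace_cochains
      by (intro D.cochains_closed(3) D.MM_bracket_cochains) (auto intro: D.cochain.subspace_scale)
  next
    fix y :: "unit tree" and as :: "('a \<times> 'm) list" and S
    assume len: "size y = length as" and S: "pure_at S as"
    show "(brD f piA - cochain_scale sD (of_nat n) f) y as = 0"
    proof (cases "length as = Suc n")
      case True
      have "f y as \<in> bideg_values (int n) (card S)" using h S by (auto simp: h_deg_iff)
      hence "(card S = Suc n \<and> snd (f y as) = 0) \<or> (card S = n \<and> fst (f y as) = 0) \<or> f y as = 0"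
        by (auto simp: bideg_values_def split: if_splits)
      thus ?thesis
        using bracket_piA_pure[OF f _ True S, of y] len True
        by (auto simp: cochain_scale_def sD_eq prod_eq_iff A.scale_left_distrib)
    next
      case False
      have "brD f piA y as = 0"
        using D.CY_length[OF D.bracket_CY[OF f piA_CY], of as y] False D.MM_bracket_CY[OF f piA_CY] by simp
      thus ?thesis using D.CY_length[OF f False] by (simp add: cochain_scale_def)
    qed
  qed
  thus "brD f piA = cochain_scale sD (of_nat n) f" by simp
next
  assume eig: "brD f piA = cochain_scale sD (of_nat n) f"
  show "f \<in> h_deg sA sM n"
    unfolding h_deg_iff
  proof (intro conjI allI impI f)
    fix y :: "unit tree" and as :: "('a \<times> 'm) list" and S
    assume S: "pure_at S as"
    show "f y as \<in> bideg_values (int n) (card S)"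
    proof (cases "size y = Suc n \<and> length as = Suc n")
      case True
      have *: "sD (of_nat (card S)) (f y as) - (fst (f y as), 0) = sD (of_nat n) (f y as)"
        using bracket_piA_pure[OF f _ _ S, of y] True eig by (simp add: cochain_scale_def)
      have "sM (of_nat (card S) - of_nat n) (snd (f y as)) = 0"
        using arg_cong[OF *, of snd] by (simp add: sD_eq M.scale_left_diff_distrib)
      moreover have "sA (of_nat (card S) - of_nat (Suc n)) (fst (f y as)) = 0"
        using arg_cong[OF *, of fst] by (simp add: sD_eq A.scale_left_diff_distrib A.scale_left_distrib algebra_simps)
      \<comment> \<open>Characteristic 0 separates the eigenvalues.\<close>
      moreover have "of_nat (card S) - of_nat k = (0 :: 'k) \<longleftrightarrow> card S = k" for k
        by simp
      ultimately have "card S = n \<or> snd (f y as) = 0" "card S = Suc n \<or> fst (f y as) = 0"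
        by (metis M.scale_eq_0_iff, metis A.scale_eq_0_iff)
      thus ?thesis by (auto simp: bideg_values_def prod_eq_iff)
    next
      case False
      hence "size y \<noteq> length as \<or> length as \<noteq> Suc n" by auto
      hence "f y as = 0" using D.CY_length[OF f] D.CY_cochains[OF f] unfolding D.cochains_iff by blast
      thus ?thesis by (simp add: bideg_values_closed)
    qed
  qed
qed

lemma CY_cochain_deg: "f \<in> CY sD (Suc n) \<Longrightarrow> f \<in> D.cochain_deg (int n)"
  by (simp add: D.cochain_deg_def int_graded_def)

lemma br_h_deg:
  assumes f: "f \<in> h_deg sA sM m" and g: "g \<in> h_deg sA sM n"
  shows "brD f g \<in> h_deg sA sM (m + n)"
proof -
  note CY = h_deg_CY[OF f] h_deg_CY[OF g]
  note C = D.CY_cochains[OF CY(1)] D.CY_cochains[OF CY(2)]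
  have fg: "brD f g \<in> CY sD (Suc (m + n))"
    using D.bracket_CY[OF CY] D.MM_bracket_CY[OF CY] by simp
  \<comment> \<open>Since \<open>piA\<close> has degree 0, the Jacobi identity becomes an unsigned
    Leibniz rule, so eigenvalues add.\<close>
  have "brD (brD f g) piA = brD f (brD g piA) + brD (brD f piA) g"
    using D.MM_bracket_jacobi[OF CY_cochain_deg[OF CY(1)] CY_cochain_deg[OF CY(2)] CY_cochain_deg[OF piA_CY]] by simp
  also have "\<dots> = brD f (cochain_scale sD (of_nat n) g) + brD (cochain_scale sD (of_nat m) f) g"
    using f g h_deg_eigenspace CY by simp
  also have "\<dots> = cochain_scale sD (of_nat n) (brD f g) + cochain_scale sD (of_nat m) (brD f g)"
    using D.MM_bracket_lin(1)[OF C(1) D.cochains_closed(1) C(2), of "of_nat m"]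
      D.MM_bracket_lin(2)[OF C(2) D.cochains_closed(1) C(1), of "of_nat n"] D.MM_bracket_0 C by simp
  also have "\<dots> = cochain_scale sD (of_nat (m + n)) (brD f g)"
    by (simp add: D.cochain.scale_left_distrib add.commute)
  finally show ?thesis using h_deg_eigenspace[OF fg] by simp
qed

text \<open>Degree \<open>n\<close> lives on lists of length \<open>n + 1\<close>, so even degree
  means odd length.\<close>

definition ev_part :: "('a \<times> 'm) cochain \<Rightarrow> ('a \<times> 'm) cochain" where
  "ev_part f = (\<lambda>y as. if odd (length as) then f y as else 0)"

definition od_part :: "('a \<times> 'm) cochain \<Rightarrow> ('a \<times> 'm) cochain" where
  "od_part f = (\<lambda>y as. if odd (length as) then 0 else f y as)"

lemma parts_cochains:
  assumes "f \<in> D.cochains"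
  shows "ev_part f \<in> D.cochains" "od_part f \<in> D.cochains"
  using assms by (auto simp: D.cochains_iff ev_part_def od_part_def)

lemma int_graded_subspace:
  "(\<And>n. D.cochain.subspace (W n)) \<Longrightarrow> D.cochain.subspace (int_graded W k)"
  by (simp add: int_graded_def D.cochain.subspace_single_0)

sublocale derived_bracket_data "cochain_scale sD" D.cochains D.cochain_deg
  "int_graded (h_deg sA sM)" "int_graded (a_deg sA sM)" brD proj_a ev_part od_part
proof (intro derived_bracket_data.intro derived_bracket_data_axioms.intro)
  show "vector_space (cochain_scale sD)" by (rule D.vector_space_cochain_scale)
  show "D.cochain.subspace D.cochains" by (rule D.subspace_cochains)
  show "D.cochain.subspace (D.cochain_deg n)" for n by (rule D.subspace_cochain_deg)
  show "D.cochain_deg n \<subseteq> D.cochains" for n using D.cochain_deg_cochains by blast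
  show "w i = 0" if "finite I" "\<And>i. i \<in> I \<Longrightarrow> w i \<in> D.cochain_deg i" "(\<Sum>i\<in>I. w i) = 0" "i \<in> I" for I w i
    using that by (rule D.cochain_deg_indep)
  show "D.cochain.subspace (int_graded (h_deg sA sM) n)" "D.cochain.subspace (int_graded (a_deg sA sM) n)" for n
    by (intro int_graded_subspace subspace_bideg; rule h_deg_iff a_deg_iff)+
  show "int_graded (h_deg sA sM) n \<subseteq> D.cochain_deg n" "int_graded (a_deg sA sM) n \<subseteq> D.cochain_deg n" for n
    by (auto simp: int_graded_def D.cochain_deg_def h_deg_CY a_deg_CY)
  have zero: "0 \<in> int_graded (h_deg sA sM) n" for n
    by (intro D.cochain.subspace_0 int_graded_subspace subspace_bideg) (rule h_deg_iff)
  have proj_a_0: "proj_a 0 = (0 :: ('a \<times> 'm) cochain)"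
    by (intro ext) (simp add: proj_a_def zero_prod_def)
  show "brD x y \<in> int_graded (h_deg sA sM) (a + b)"
    if "x \<in> int_graded (h_deg sA sM) a" "y \<in> int_graded (h_deg sA sM) b" for x y a b
    using that(1)
  proof (cases rule: int_graded_cases)
    case m: (1 m)
    show ?thesis
      using that(2)
    proof (cases rule: int_graded_cases)
      case n: (1 n)
      thus ?thesis using m br_h_deg[of x m y n] by (simp add: int_graded_def nat_add_distrib)
    qed (use m zero in \<open>simp add: D.MM_bracket_0 D.CY_cochains[OF h_deg_CY]\<close>)
  next
    case 2
    have "y \<in> D.cochains"
      using that(2) by (cases rule: int_graded_cases) (auto intro: D.CY_cochains h_deg_CY D.cochains_closed(1))
    thus ?thesis using 2 zero by (simp add: D.MM_bracket_0)
  qed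
  show "brD x y = 0" if "x \<in> int_graded (a_deg sA sM) a" "y \<in> int_graded (a_deg sA sM) b" for x y a b
  proof -
    have C: "x \<in> D.cochains" "y \<in> D.cochains"
      using that by (auto elim!: int_graded_cases intro: D.CY_cochains a_deg_CY D.cochains_closed(1))
    show ?thesis
      using that by (auto elim!: int_graded_cases simp: br_a_deg D.MM_bracket_0 C D.cochains_closed(1))
  qed
  show "proj_a x \<in> int_graded (a_deg sA sM) n" if "x \<in> D.cochain_deg n" for x n
    using that by (simp add: int_graded_def D.cochain_deg_def proj_a_0 proj_a_a_deg split: if_splits)
  show "proj_a x = x" if "x \<in> int_graded (a_deg sA sM) n" for x n
    using that by (auto simp: int_graded_def proj_a_0 proj_a_id split: if_splits)
  show "proj_a x = 0" if "x \<in> int_graded (h_deg sA sM) n" for x n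
    using that by (auto simp: int_graded_def proj_a_0 proj_a_h_deg split: if_splits)
  show "proj_a (brD x y) = 0" if "proj_a x = 0" "proj_a y = 0" for x y
    using that by (rule proj_a_kernel)
  show "ev_part x = (if even n then x else 0)" "od_part x = (if even n then 0 else x)" if "x \<in> D.cochain_deg n" for x n
  proof -
    have 0: "x y as = 0" if "odd (length as) \<noteq> even n" for y as
      using that by (intro D.cochain_deg_length[OF \<open>x \<in> D.cochain_deg n\<close>]) presburger
    show "ev_part x = (if even n then x else 0)" "od_part x = (if even n then 0 else x)"
      using 0 by (auto simp: ev_part_def od_part_def fun_eq_iff)
  qed
  show "ev_part (cochain_scale sD c x + y) = cochain_scale sD c (ev_part x) + ev_part y"
    "od_part (cochain_scale sD c x + y) = cochain_scale sD c (od_part x) + od_part y" for c x y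
    by (intro ext; simp add: ev_part_def od_part_def cochain_scale_def)+
qed (auto intro: D.MM_bracket_cochains D.MM_bracket_lin D.MM_bracket_deg D.MM_bracket_antisym D.MM_bracket_jacobi
    proj_a_cochains proj_a_lin parts_cochains)

end

theorem theorem5p7:
  fixes sA :: "'k::field_char_0 \<Rightarrow> 'a::ab_group_add \<Rightarrow> 'a"
    and sM :: "'k \<Rightarrow> 'm::ab_group_add \<Rightarrow> 'm"
  assumes "vector_space sA" and "vector_space sM"
  shows "\<exists>l :: nat \<Rightarrow> (('a \<times> 'm) cochain \<times> ('a \<times> 'm) cochain) list \<Rightarrow>
                 ('a \<times> 'm) cochain \<times> ('a \<times> 'm) cochain.
    L_infinity_algebra (sh_plus_a_scale sA sM) (sh_plus_a sA sM) l \<and>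
    (\<forall>m n f g. f \<in> h_deg sA sM m \<and> g \<in> h_deg sA sM n \<longrightarrow>
      l 2 [(f, 0), (g, 0)] =
        (cochain_scale (module_prod.scale sA sM) ((-1) ^ m)
           (MM_bracket (module_prod.scale sA sM) f g), 0)) \<and>
    (\<forall>k n f hs. k \<ge> 2 \<and> f \<in> h_deg sA sM n \<and> length hs = k - 1 \<and>
        (\<forall>h\<in>set hs. \<exists>d. h \<in> a_deg sA sM d) \<longrightarrow>
      l k ((f, 0) # map (\<lambda>h. (0, h)) hs) =
        (0, proj_a (foldl (MM_bracket (module_prod.scale sA sM)) f hs))) \<and>
    (\<forall>k xs S. k \<ge> 1 \<and> length xs = k \<and> S \<subseteq> {..<k} \<and>
        (\<forall>i\<in>S. \<exists>n. xs ! i \<in> h_deg sA sM n \<times> {0}) \<and>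
        (\<forall>i\<in>{..<k} - S. \<exists>n. xs ! i \<in> {0} \<times> a_deg sA sM n) \<and>
        \<not> (k = 2 \<and> card S = 2) \<and> \<not> (k \<ge> 2 \<and> card S = 1) \<longrightarrow>
      l k xs = 0)"
proof -
  interpret direct_sum sA sM
    using assms by (simp add: direct_sum_def)
  have graded: "h_deg sA sM n \<subseteq> int_graded (h_deg sA sM) (int n)" "a_deg sA sM n \<subseteq> int_graded (a_deg sA sM) (int n)" for n
    by (simp_all add: int_graded_def)
  have "V = sh_plus_a sA sM" by (intro ext) (simp add: V_def sh_plus_a_def)
  hence 1: "L_infinity_algebra (sh_plus_a_scale sA sM) (sh_plus_a sA sM) (\<lambda>k. l)"
    using L_infinity_algebra_l by (simp add: sh_plus_a_scale_def)
  have 2: "l [(f, 0), (g, 0)] = (cochain_scale sD ((-1) ^ m) (brD f g), 0)"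
    if "f \<in> h_deg sA sM m" "g \<in> h_deg sA sM n" for f g m n
    using l_pair[OF subsetD[OF graded(1) that(1)] subsetD[OF graded(1) that(2)]]
    by (simp add: sg_eq_scale(1)[OF D.vector_space_cochain_scale])
  have 3: "l ((f, 0) # map (\<lambda>h. (0, h)) hs) = (0, proj_a (foldl brD f hs))"
    if "f \<in> h_deg sA sM n" "\<forall>h\<in>set hs. \<exists>d. h \<in> a_deg sA sM d" for f n hs
    by (rule l_single[OF H_G[OF subsetD[OF graded(1) that(1)]]]) (use that(2) in \<open>auto intro: D.CY_cochains a_deg_CY\<close>)
  have 4: "l xs = 0"
    if "S \<subseteq> {..<length xs}" "\<forall>i\<in>S. \<exists>n. xs ! i \<in> h_deg sA sM n \<times> {0}"
      "\<forall>i\<in>{..<length xs} - S. \<exists>n. xs ! i \<in> {0} \<times> a_deg sA sM n"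
      "\<not> (length xs = 2 \<and> card S = 2)" "\<not> (length xs \<ge> 2 \<and> card S = 1)" for xs S
  proof (rule l_other[OF that(1) _ _ that(4,5)])
    show "\<exists>d. xs ! i \<in> int_graded (h_deg sA sM) d \<times> {0}" if i: "i \<in> S" for i
    proof -
      obtain n where "xs ! i \<in> h_deg sA sM n \<times> {0}"
        using bspec[OF \<open>\<forall>i\<in>S. \<exists>n. xs ! i \<in> h_deg sA sM n \<times> {0}\<close> i] ..
      thus ?thesis using graded(1)[of n] by (intro exI[of _ "int n"]) auto
    qed
    show "\<exists>d. xs ! i \<in> {0} \<times> int_graded (a_deg sA sM) d" if i: "i \<in> {..<length xs} - S" for i
    proof -
      obtain n where "xs ! i \<in> {0} \<times> a_deg sA sM n"
        using bspec[OF \<open>\<forall>i\<in>{..<length xs} - S. \<exists>n. xs ! i \<in> {0} \<times> a_deg sA sM n\<close> i] ..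
      thus ?thesis using graded(2)[of n] by (intro exI[of _ "int n"]) auto
    qed
  qed
  show ?thesis
  proof (intro exI[of _ "\<lambda>k. l"] conjI allI impI)
    fix m n f g assume "f \<in> h_deg sA sM m \<and> g \<in> h_deg sA sM n"
    thus "l [(f, 0), (g, 0)] = (cochain_scale sD ((-1) ^ m) (brD f g), 0)" using 2 by blast
  next
    fix k n f hs
    assume "2 \<le> k \<and> f \<in> h_deg sA sM n \<and> length hs = k - 1 \<and> (\<forall>h\<in>set hs. \<exists>d. h \<in> a_deg sA sM d)"
    thus "l ((f, 0) # map (Pair 0) hs) = (0, proj_a (foldl brD f hs))" using 3 by blast
  next
    fix k xs S
    assume "1 \<le> k \<and> length xs = k \<and> S \<subseteq> {..<k} \<and>
      (\<forall>i\<in>S. \<exists>n. xs ! i \<in> h_deg sA sM n \<times> {0}) \<and>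
      (\<forall>i\<in>{..<k} - S. \<exists>n. xs ! i \<in> {0} \<times> a_deg sA sM n) \<and>
      \<not> (k = 2 \<and> card S = 2) \<and> \<not> (2 \<le> k \<and> card S = 1)"
    thus "l xs = 0" by (intro 4[of S]) simp_all
  qed (rule 1)
qed

end
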